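(* Let $K$ be a commutative ring and let $M|N$ be an irreducible, depth two, Frobenius and proper extension of $K$-algebras. Let $A=\mathrm{End}({}_NM_N)$. Then $M|N$ is a split extension if and only if $A$ is a separable $K$-algebra.
   Context: A $K$-algebra extension $\iota:N\to M$ is proper if $\iota$ is injective; irreducible if the centralizer $R=C_M(N)$ equals $K1_M$ ($K$ being identified with $R$ via $k\mapsto k1_M$); D2 (depth two) if $M\otimes_NM$ is isomorphic to a direct summand of $\oplus^n\,{}_NM_M$ as an $N$-$M$-bimodule and of $\oplus^m\,{}_MM_N$ as an $M$-$N$-bimodule, for some $n,m\ge1$; Frobenius if there are an $N$-$N$-bimodule map $E:M\to N$ and finitely many $x_i,y_i\in M$ with $\sum_ix_iE(y_im)=m=\sum_iE(mx_i)y_i$ for all $m\in M$; split if $N$ is a direct summand of $M$ as an $N$-bimodule. $\mathrm{End}({}_NM_N)$ is the $K$-algebra of $N$-bimodule endomorphisms of $M$ under composition. *)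

theory Defs
  imports "HOL-Algebra.Algebra"
begin

section \<open>Bimodules\<close>

text \<open>
  A bimodule is a commutative group, written multiplicatively as everywhere in the group
  library of HOL-Algebra, with a left and a right action. So on a bimodule
  \<open>\<otimes>\<close>, \<open>\<one>\<close>, \<open>inv\<close> denote addition, zero and negation.
\<close>

record ('r, 's, 'a) bimodule = "'a monoid" +
  lact :: "'r \<Rightarrow> 'a \<Rightarrow> 'a"
  ract :: "'a \<Rightarrow> 's \<Rightarrow> 'a"

locale bimodule = R?: ring R + S?: ring S + B?: comm_group B
  for R :: "('r, 'x) ring_scheme" and S :: "('s, 'y) ring_scheme"
    and B :: "('r, 's, 'a, 'z) bimodule_scheme" +
  assumes lact_closed:
      "\<lbrakk>r \<in> carrier R; x \<in> carrier B\<rbrakk> \<Longrightarrow> lact B r x \<in> carrier B"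
    and ract_closed:
      "\<lbrakk>x \<in> carrier B; s \<in> carrier S\<rbrakk> \<Longrightarrow> ract B x s \<in> carrier B"
    and lact_add_left: "\<lbrakk>r \<in> carrier R; r' \<in> carrier R; x \<in> carrier B\<rbrakk> \<Longrightarrow>
      lact B (r \<oplus>\<^bsub>R\<^esub> r') x = lact B r x \<otimes>\<^bsub>B\<^esub> lact B r' x"
    and lact_add_right: "\<lbrakk>r \<in> carrier R; x \<in> carrier B; y \<in> carrier B\<rbrakk> \<Longrightarrow>
      lact B r (x \<otimes>\<^bsub>B\<^esub> y) = lact B r x \<otimes>\<^bsub>B\<^esub> lact B r y"
    and lact_mult: "\<lbrakk>r \<in> carrier R; r' \<in> carrier R; x \<in> carrier B\<rbrakk> \<Longrightarrow>
      lact B (r \<otimes>\<^bsub>R\<^esub> r') x = lact B r (lact B r' x)"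
    and lact_one: "x \<in> carrier B \<Longrightarrow> lact B \<one>\<^bsub>R\<^esub> x = x"
    and ract_add_right: "\<lbrakk>x \<in> carrier B; s \<in> carrier S; s' \<in> carrier S\<rbrakk> \<Longrightarrow>
      ract B x (s \<oplus>\<^bsub>S\<^esub> s') = ract B x s \<otimes>\<^bsub>B\<^esub> ract B x s'"
    and ract_add_left: "\<lbrakk>x \<in> carrier B; y \<in> carrier B; s \<in> carrier S\<rbrakk> \<Longrightarrow>
      ract B (x \<otimes>\<^bsub>B\<^esub> y) s = ract B x s \<otimes>\<^bsub>B\<^esub> ract B y s"
    and ract_mult: "\<lbrakk>x \<in> carrier B; s \<in> carrier S; s' \<in> carrier S\<rbrakk> \<Longrightarrow>
      ract B x (s \<otimes>\<^bsub>S\<^esub> s') = ract B (ract B x s) s'"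
    and ract_one: "x \<in> carrier B \<Longrightarrow> ract B x \<one>\<^bsub>S\<^esub> = x"
    and lact_ract: "\<lbrakk>r \<in> carrier R; x \<in> carrier B; s \<in> carrier S\<rbrakk> \<Longrightarrow>
      lact B r (ract B x s) = ract B (lact B r x) s"

definition bimod_hom ::
  "('r, 'x) ring_scheme \<Rightarrow> ('s, 'y) ring_scheme \<Rightarrow> ('r, 's, 'a, 'z) bimodule_scheme \<Rightarrow>
   ('r, 's, 'b, 'w) bimodule_scheme \<Rightarrow> ('a \<Rightarrow> 'b) set"
  where "bimod_hom R S B C = {f \<in> hom B C.
    (\<forall>r\<in>carrier R. \<forall>x\<in>carrier B. f (lact B r x) = lact C r (f x)) \<and>
    (\<forall>x\<in>carrier B. \<forall>s\<in>carrier S. f (ract B x s) = ract C (f x) s)}"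

definition subbimodule ::
  "('r, 'x) ring_scheme \<Rightarrow> ('s, 'y) ring_scheme \<Rightarrow> 'a set \<Rightarrow> ('r, 's, 'a, 'z) bimodule_scheme \<Rightarrow> bool"
  where "subbimodule R S P B \<longleftrightarrow> subgroup P B \<and>
    (\<forall>r\<in>carrier R. \<forall>x\<in>P. lact B r x \<in> P) \<and> (\<forall>x\<in>P. \<forall>s\<in>carrier S. ract B x s \<in> P)"

definition direct_summand ::
  "('r, 'x) ring_scheme \<Rightarrow> ('s, 'y) ring_scheme \<Rightarrow> 'a set \<Rightarrow> ('r, 's, 'a, 'z) bimodule_scheme \<Rightarrow> bool"
  where "direct_summand R S P B \<longleftrightarrow> subbimodule R S P B \<and>
    (\<exists>Q. subbimodule R S Q B \<and> P <#>\<^bsub>B\<^esub> Q = carrier B \<and> P \<inter> Q = {\<one>\<^bsub>B\<^esub>})"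

definition iso_direct_summand ::
  "('r, 'x) ring_scheme \<Rightarrow> ('s, 'y) ring_scheme \<Rightarrow> ('r, 's, 'a, 'z) bimodule_scheme \<Rightarrow>
   ('r, 's, 'b, 'w) bimodule_scheme \<Rightarrow> bool"
  where "iso_direct_summand R S C B \<longleftrightarrow>
    (\<exists>P. direct_summand R S P B \<and> (\<exists>f\<in>bimod_hom R S C B. bij_betw f (carrier C) P))"

definition power_bimod ::
  "nat \<Rightarrow> ('r, 's, 'a, 'z) bimodule_scheme \<Rightarrow> ('r, 's, nat \<Rightarrow> 'a) bimodule"
  where "power_bimod n B = (let G = product_group {..<n} (\<lambda>_. B) in
    \<lparr>carrier = carrier G, monoid.mult = monoid.mult G, one = one G,
     lact = \<lambda>r v. \<lambda>i\<in>{..<n}. lact B r (v i),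
     ract = \<lambda>v s. \<lambda>i\<in>{..<n}. ract B (v i) s\<rparr>)"

text \<open>
  \<open>restrict_bimod M \<phi> \<psi>\<close> is the ring \<open>M\<close> as a bimodule, acting on the left through
  the ring homomorphism \<open>\<phi>\<close> into \<open>M\<close> and on the right through \<open>\<psi>\<close>.
\<close>

definition restrict_bimod ::
  "('m, 'z) ring_scheme \<Rightarrow> ('r \<Rightarrow> 'm) \<Rightarrow> ('s \<Rightarrow> 'm) \<Rightarrow> ('r, 's, 'm) bimodule"
  where "restrict_bimod M \<phi> \<psi> =
    \<lparr>carrier = carrier M, monoid.mult = add M, one = \<zero>\<^bsub>M\<^esub>,
     lact = \<lambda>r x. \<phi> r \<otimes>\<^bsub>M\<^esub> x, ract = \<lambda>x s. x \<otimes>\<^bsub>M\<^esub> \<psi> s\<rparr>"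

lemma bimodule_restrict_bimod:
  assumes "ring R" "ring S" "ring M" "\<phi> \<in> ring_hom R M" "\<psi> \<in> ring_hom S M"
  shows "bimodule R S (restrict_bimod M \<phi> \<psi>)"
proof -
  interpret R: ring R by fact
  interpret S: ring S by fact
  interpret M: ring M by fact
  interpret f: ring_hom_ring R M \<phi> by (intro ring_hom_ringI2 assms)
  interpret g: ring_hom_ring S M \<psi> by (intro ring_hom_ringI2 assms)
  have "comm_group (restrict_bimod M \<phi> \<psi>)"
    by (rule comm_groupI)
      (auto simp: restrict_bimod_def M.a_ac intro: M.add.l_inv_ex)
  then show ?thesis
    by (intro bimodule.intro bimodule_axioms.intro assms)
      (auto simp: restrict_bimod_def M.l_distr M.r_distr M.m_assoc)
qed

section \<open>Tensor products over a ring\<close>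

text \<open>
  The tensor product of an \<open>(R, S)\<close>-bimodule \<open>B\<close> and an \<open>(S, T)\<close>-bimodule \<open>C\<close> over \<open>S\<close>: the
  free abelian group on \<open>carrier B \<times> carrier C\<close> modulo the subgroup generated by the
  biadditivity and balancing relations.
\<close>

definition tensor_relations ::
  "('s, 'y) ring_scheme \<Rightarrow> ('r, 's, 'a, 'z) bimodule_scheme \<Rightarrow> ('s, 't, 'b, 'w) bimodule_scheme \<Rightarrow>
   ('a \<times> 'b \<Rightarrow>\<^sub>0 int) set"
  where "tensor_relations S B C =
    {frag_of (x \<otimes>\<^bsub>B\<^esub> x', y) - frag_of (x, y) - frag_of (x', y) | x x' y.
       x \<in> carrier B \<and> x' \<in> carrier B \<and> y \<in> carrier C} \<union>
    {frag_of (x, y \<otimes>\<^bsub>C\<^esub> y') - frag_of (x, y) - frag_of (x, y') | x y y'.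
       x \<in> carrier B \<and> y \<in> carrier C \<and> y' \<in> carrier C} \<union>
    {frag_of (ract B x s, y) - frag_of (x, lact C s y) | x s y.
       x \<in> carrier B \<and> s \<in> carrier S \<and> y \<in> carrier C}"

definition tensor_free ::
  "('r, 's, 'a, 'z) bimodule_scheme \<Rightarrow> ('s, 't, 'b, 'w) bimodule_scheme \<Rightarrow> ('a \<times> 'b \<Rightarrow>\<^sub>0 int) monoid"
  where "tensor_free B C = free_Abelian_group (carrier B \<times> carrier C)"

definition tensor_kernel ::
  "('s, 'y) ring_scheme \<Rightarrow> ('r, 's, 'a, 'z) bimodule_scheme \<Rightarrow> ('s, 't, 'b, 'w) bimodule_scheme \<Rightarrow>
   ('a \<times> 'b \<Rightarrow>\<^sub>0 int) set"
  where "tensor_kernel S B C = generate (tensor_free B C) (tensor_relations S B C)"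

definition pure_tensor ::
  "('s, 'y) ring_scheme \<Rightarrow> ('r, 's, 'a, 'z) bimodule_scheme \<Rightarrow> ('s, 't, 'b, 'w) bimodule_scheme \<Rightarrow>
   'a \<Rightarrow> 'b \<Rightarrow> ('a \<times> 'b \<Rightarrow>\<^sub>0 int) set"
  where "pure_tensor S B C x y = tensor_kernel S B C #>\<^bsub>tensor_free B C\<^esub> frag_of (x, y)"

text \<open>
  Elements are cosets. The actions \<open>r (x \<otimes> y) = (r x) \<otimes> y\<close> and \<open>(x \<otimes> y) t = x \<otimes> (y t)\<close> are
  the maps induced on cosets by the additive extension of the action on generators; the
  product with the kernel enlarges the image of a coset to a full coset.
\<close>

definition tensor ::
  "('s, 'y) ring_scheme \<Rightarrow> ('r, 's, 'a, 'z) bimodule_scheme \<Rightarrow> ('s, 't, 'b, 'w) bimodule_scheme \<Rightarrow>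
   ('r, 't, ('a \<times> 'b \<Rightarrow>\<^sub>0 int) set) bimodule"
  where "tensor S B C = (let F = tensor_free B C; H = tensor_kernel S B C in
    \<lparr>carrier = carrier (F Mod H), monoid.mult = monoid.mult (F Mod H), one = one (F Mod H),
     lact = \<lambda>r U. H <#>\<^bsub>F\<^esub> (frag_extend (\<lambda>(x, y). frag_of (lact B r x, y)) ` U),
     ract = \<lambda>U t. H <#>\<^bsub>F\<^esub> (frag_extend (\<lambda>(x, y). frag_of (x, ract C y t)) ` U)\<rparr>)"

lemma bimodule_tensor:
  fixes R :: "('r, 'x) ring_scheme" and S :: "('s, 'y) ring_scheme" and T :: "('t, 'u) ring_scheme"
    and B :: "('r, 's, 'a, 'z) bimodule_scheme" and C :: "('s, 't, 'b, 'w) bimodule_scheme"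
  assumes "bimodule R S B" "bimodule S T C"
  shows "bimodule R T (tensor S B C)"
    and "\<And>r x y. \<lbrakk>r \<in> carrier R; x \<in> carrier B; y \<in> carrier C\<rbrakk> \<Longrightarrow>
      lact (tensor S B C) r (pure_tensor S B C x y) = pure_tensor S B C (lact B r x) y"
    and "\<And>x y t. \<lbrakk>x \<in> carrier B; y \<in> carrier C; t \<in> carrier T\<rbrakk> \<Longrightarrow>
      ract (tensor S B C) (pure_tensor S B C x y) t = pure_tensor S B C x (ract C y t)"
proof -
  interpret B: bimodule R S B by fact
  interpret C: bimodule S T C by fact
  define F where "F = tensor_free B C"
  define H where "H = tensor_kernel S B C"
  interpret F: comm_group F
    by (simp add: F_def tensor_free_def abelian_free_Abelian_group)
  have F: "c \<in> carrier F \<longleftrightarrow> Poly_Mapping.keys c \<subseteq> carrier B \<times> carrier C"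
    "c \<otimes>\<^bsub>F\<^esub> d = c + d" "\<one>\<^bsub>F\<^esub> = 0" for c d
    by (simp_all add: F_def tensor_free_def)
  have F_diff: "c - d \<in> carrier F" if "c \<in> carrier F" "d \<in> carrier F" for c d
    using that keys_diff[of c d] by (auto simp: F)
  have F_inv: "inv\<^bsub>F\<^esub> c = - c" if "c \<in> carrier F" for c
    using that by (simp add: F_def tensor_free_def)
  have F0: "0 \<in> carrier F" by (simp add: F)
  have F_of: "frag_of (x, y) \<in> carrier F" if "x \<in> carrier B" "y \<in> carrier C" for x y
    using that by (simp add: F)
  have rel: "tensor_relations S B C \<subseteq> carrier F"
    by (auto simp: tensor_relations_def intro!: F_diff F_of B.ract_closed C.lact_closed)
  have H_gen: "H = generate F (tensor_relations S B C)"
    by (simp add: H_def F_def tensor_kernel_def)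
  have HF: "subgroup H F"
    unfolding H_gen by (rule F.generate_is_subgroup[OF rel])
  interpret H: normal H F by (rule F.subgroup_imp_normal[OF HF])
  have H_diff: "c - d \<in> H" if "c \<in> H" "d \<in> H" for c d
    using H.m_closed[OF that(1) H.m_inv_closed[OF that(2)]] H.mem_carrier[OF that(2)] by (simp add: F(2) F_inv)
  have H_minus: "- c \<in> H" if "c \<in> H" for c
    using H_diff[OF H.one_closed that] by (simp add: F)
  have H_add: "c + d \<in> H" if "c \<in> H" "d \<in> H" for c d
    using H.m_closed[OF that] by (simp add: F)
  have H0: "0 \<in> H" using H.one_closed by (simp add: F)
  have Hrel: "tensor_relations S B C \<subseteq> H"
    unfolding H_gen by (auto intro: generate.incl)
  have rel1: "frag_of (x \<otimes>\<^bsub>B\<^esub> x', y) - frag_of (x, y) - frag_of (x', y) \<in> H"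
    if "x \<in> carrier B" "x' \<in> carrier B" "y \<in> carrier C" for x x' y
    by (rule subsetD[OF Hrel]) (use that in \<open>unfold tensor_relations_def, blast\<close>)
  have rel2: "frag_of (x, y \<otimes>\<^bsub>C\<^esub> y') - frag_of (x, y) - frag_of (x, y') \<in> H"
    if "x \<in> carrier B" "y \<in> carrier C" "y' \<in> carrier C" for x y y'
    by (rule subsetD[OF Hrel]) (use that in \<open>unfold tensor_relations_def, blast\<close>)
  have rel3: "frag_of (ract B x s, y) - frag_of (x, lact C s y) \<in> H"
    if "x \<in> carrier B" "s \<in> carrier S" "y \<in> carrier C" for x s y
    by (rule subsetD[OF Hrel]) (use that in \<open>unfold tensor_relations_def, blast\<close>)
  have coset_eq: "H #>\<^bsub>F\<^esub> c = H #>\<^bsub>F\<^esub> d \<longleftrightarrow> c - d \<in> H"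
    if "c \<in> carrier F" "d \<in> carrier F" for c d
  proof -
    have "c \<in> H #>\<^bsub>F\<^esub> d \<longleftrightarrow> c - d \<in> H"
      using H.rcos_module[OF F.is_group that(2,1)] that by (simp add: F F_inv)
    then show ?thesis
      using F.repr_independence[OF _ that(2) HF, of c] F.rcos_self[OF that(1) HF] by auto
  qed
  have coset_add: "(H #>\<^bsub>F\<^esub> c) <#>\<^bsub>F\<^esub> (H #>\<^bsub>F\<^esub> d) = H #>\<^bsub>F\<^esub> (c + d)"
    if "c \<in> carrier F" "d \<in> carrier F" for c d
    using H.rcos_sum[OF that] by (simp add: F)
  have add_ind: "g c \<in> H" if "c \<in> carrier F" "g 0 = 0" "\<And>a b. g (a - b) = g a - g b"
      "\<And>x y. x \<in> carrier B \<Longrightarrow> y \<in> carrier C \<Longrightarrow> g (frag_of (x, y)) \<in> H"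
    for g :: "_ \<Rightarrow> ('a \<times> 'b) \<Rightarrow>\<^sub>0 int" and c
    using that(1)[unfolded F(1)]
    by (induction c rule: frag_induction) (auto simp: that(2,3) H0 intro: H_diff that(4))
  have induced: "f c \<in> carrier F" "H <#>\<^bsub>F\<^esub> (f ` (H #>\<^bsub>F\<^esub> c)) = H #>\<^bsub>F\<^esub> f c"
    if "c \<in> carrier F" and f: "f = frag_extend h"
      and hF: "\<And>x y. x \<in> carrier B \<Longrightarrow> y \<in> carrier C \<Longrightarrow> h (x, y) \<in> carrier F"
      and hrel: "\<And>c. c \<in> tensor_relations S B C \<Longrightarrow> f c \<in> H"
    for f :: "('a \<times> 'b \<Rightarrow>\<^sub>0 int) \<Rightarrow> _" and h c
  proof -
    have fF: "f c \<in> carrier F" if "c \<in> carrier F" for c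
      using that[unfolded F(1)]
      by (induction c rule: frag_induction)
        (auto simp: f frag_extend_diff F_diff hF F0)
    then show "f c \<in> carrier F" using that by blast
    have fH: "f d \<in> H" if "d \<in> H" for d
      using that unfolding H_gen
    proof (induction d rule: generate.induct)
      case one then show ?case using H0 by (simp add: f F H_gen)
    next
      case (incl d) then show ?case using hrel by (simp add: H_gen)
    next
      case (inv d) then show ?case using hrel[of d] H_minus rel by (auto simp: f frag_extend_minus F_inv H_gen)
    next
      case (eng d e) then show ?case using H_add by (simp add: f frag_extend_add F H_gen)
    qed
    show "H <#>\<^bsub>F\<^esub> (f ` (H #>\<^bsub>F\<^esub> c)) = H #>\<^bsub>F\<^esub> f c"
    proof
      show "H <#>\<^bsub>F\<^esub> (f ` (H #>\<^bsub>F\<^esub> c)) \<subseteq> H #>\<^bsub>F\<^esub> f c"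
      proof
        fix u assume "u \<in> H <#>\<^bsub>F\<^esub> (f ` (H #>\<^bsub>F\<^esub> c))"
        then obtain a b where ab: "a \<in> H" "b \<in> H" "u = a + f (b + c)"
          by (auto simp: set_mult_def r_coset_def F)
        then have "u = (a + f b) + f c" by (simp add: f frag_extend_add)
        then show "u \<in> H #>\<^bsub>F\<^esub> f c"
          using H_add[OF ab(1) fH[OF ab(2)]] by (auto simp: r_coset_def F)
      qed
      have "c \<in> H #>\<^bsub>F\<^esub> c" using H0 by (force simp: r_coset_def F)
      then show "H #>\<^bsub>F\<^esub> f c \<subseteq> H <#>\<^bsub>F\<^esub> (f ` (H #>\<^bsub>F\<^esub> c))"
        unfolding r_coset_def[of F H "f c"] set_mult_def by blast
    qed
  qed
  define l where "l r = frag_extend (\<lambda>(x, y). frag_of (lact B r x, y) :: 'a \<times> 'b \<Rightarrow>\<^sub>0 int)" for r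
  define rr where "rr t = frag_extend (\<lambda>(x, y). frag_of (x, ract C y t) :: 'a \<times> 'b \<Rightarrow>\<^sub>0 int)" for t
  let ?T = "tensor S B C"
  have T: "carrier ?T = rcosets\<^bsub>F\<^esub> H" "\<And>U V. U \<otimes>\<^bsub>?T\<^esub> V = U <#>\<^bsub>F\<^esub> V" "\<one>\<^bsub>?T\<^esub> = H"
    "\<And>r U. lact ?T r U = H <#>\<^bsub>F\<^esub> (l r ` U)" "\<And>U t. ract ?T U t = H <#>\<^bsub>F\<^esub> (rr t ` U)"
    by (simp_all add: tensor_def Let_def F_def H_def l_def rr_def FactGroup_def)
  have l_of: "l r (frag_of (x, y)) = frag_of (lact B r x, y)" for r x y by (simp add: l_def)
  have rr_of: "rr t (frag_of (x, y)) = frag_of (x, ract C y t)" for t x y by (simp add: rr_def)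
  have lin: "l r 0 = 0" "l r (a - b) = l r a - l r b" "l r (a + b) = l r a + l r b"
    "rr t 0 = 0" "rr t (a - b) = rr t a - rr t b" "rr t (a + b) = rr t a + rr t b" for r t a b
    by (simp_all add: l_def rr_def frag_extend_diff frag_extend_add)
  have lrel: "l r c \<in> H" if "r \<in> carrier R" "c \<in> tensor_relations S B C" for r c
    using that
    by (auto simp: tensor_relations_def lin l_of B.lact_add_right B.lact_ract
        intro!: rel1 rel2 rel3 B.lact_closed)
  have rrel: "rr t c \<in> H" if "t \<in> carrier T" "c \<in> tensor_relations S B C" for t c
    using that
    by (auto simp: tensor_relations_def lin rr_of C.ract_add_left C.lact_ract[symmetric]
        intro!: rel1 rel2 rel3 C.ract_closed)
  have l_co: "l r c \<in> carrier F" "H <#>\<^bsub>F\<^esub> (l r ` (H #>\<^bsub>F\<^esub> c)) = H #>\<^bsub>F\<^esub> l r c"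
    if "r \<in> carrier R" "c \<in> carrier F" for r c
    by (rule induced[OF that(2) l_def, of r];
        use lrel that in \<open>auto intro!: F_of B.lact_closed\<close>)+
  have r_co: "rr t c \<in> carrier F" "H <#>\<^bsub>F\<^esub> (rr t ` (H #>\<^bsub>F\<^esub> c)) = H #>\<^bsub>F\<^esub> rr t c"
    if "t \<in> carrier T" "c \<in> carrier F" for t c
    by (rule induced[OF that(2) rr_def, of t];
        use rrel that in \<open>auto intro!: F_of C.ract_closed\<close>)+
  have ex: "\<exists>c\<in>carrier F. U = H #>\<^bsub>F\<^esub> c" if "U \<in> carrier ?T" for U
    using that by (auto simp: T RCOSETS_def)
  have co_in: "H #>\<^bsub>F\<^esub> c \<in> carrier ?T" if "c \<in> carrier F" for c
    using that by (auto simp: T RCOSETS_def)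
  have F_add: "c + d \<in> carrier F" if "c \<in> carrier F" "d \<in> carrier F" for c d
    using F.m_closed[OF that] by (simp add: F)
  have ring_T: "ring T" "ring R" using B.R.ring_axioms C.S.ring_axioms by auto
  have "group (F Mod H)" by (rule H.factorgroup_is_group)
  then have grp: "group ?T"
    by (simp add: group_def group_axioms_def monoid_def Units_def FactGroup_def T)
  have ab: "comm_group ?T"
  proof (rule group.group_comm_groupI[OF grp])
    fix U V assume "U \<in> carrier ?T" "V \<in> carrier ?T"
    then show "U \<otimes>\<^bsub>?T\<^esub> V = V \<otimes>\<^bsub>?T\<^esub> U"
      by (metis ex T(2) coset_add add.commute)
  qed
  note [simp] = T(2,4,5) coset_add l_co r_co F_add co_in lin
  show "bimodule R T ?T"
  proof (intro bimodule.intro ring_T ab bimodule_axioms.intro)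
    fix r r' U V s s'
    show "lact ?T r U \<in> carrier ?T" if "r \<in> carrier R" "U \<in> carrier ?T"
      using ex[OF that(2)] that(1) by auto
    show "ract ?T U s \<in> carrier ?T" if "U \<in> carrier ?T" "s \<in> carrier T"
      using ex[OF that(1)] that(2) by auto
    show "lact ?T r (U \<otimes>\<^bsub>?T\<^esub> V) = lact ?T r U \<otimes>\<^bsub>?T\<^esub> lact ?T r V"
      if "r \<in> carrier R" "U \<in> carrier ?T" "V \<in> carrier ?T"
      using ex[OF that(2)] ex[OF that(3)] that(1) by auto
    show "ract ?T (U \<otimes>\<^bsub>?T\<^esub> V) s = ract ?T U s \<otimes>\<^bsub>?T\<^esub> ract ?T V s"
      if "U \<in> carrier ?T" "V \<in> carrier ?T" "s \<in> carrier T"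
      using ex[OF that(1)] ex[OF that(2)] that(3) by auto
    show "lact ?T (r \<oplus>\<^bsub>R\<^esub> r') U = lact ?T r U \<otimes>\<^bsub>?T\<^esub> lact ?T r' U"
      if "r \<in> carrier R" "r' \<in> carrier R" "U \<in> carrier ?T"
    proof -
      obtain c where c: "c \<in> carrier F" "U = H #>\<^bsub>F\<^esub> c" using \<open>U \<in> carrier ?T\<close> ex by blast
      have "l (r \<oplus>\<^bsub>R\<^esub> r') c - (l r c + l r' c) \<in> H"
        by (rule add_ind[OF c(1)])
          (use that in \<open>auto simp: l_of B.lact_add_left diff_diff_add[symmetric] intro!: rel1 B.lact_closed\<close>)
      then show ?thesis using c that by (simp add: coset_eq)
    qed
    show "ract ?T U (s \<oplus>\<^bsub>T\<^esub> s') = ract ?T U s \<otimes>\<^bsub>?T\<^esub> ract ?T U s'"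
      if "U \<in> carrier ?T" "s \<in> carrier T" "s' \<in> carrier T"
    proof -
      obtain c where c: "c \<in> carrier F" "U = H #>\<^bsub>F\<^esub> c" using \<open>U \<in> carrier ?T\<close> ex by blast
      have "rr (s \<oplus>\<^bsub>T\<^esub> s') c - (rr s c + rr s' c) \<in> H"
        by (rule add_ind[OF c(1)])
          (use that in \<open>auto simp: rr_of C.ract_add_right diff_diff_add[symmetric] intro!: rel2 C.ract_closed\<close>)
      then show ?thesis using c that by (simp add: coset_eq)
    qed
    show "lact ?T (r \<otimes>\<^bsub>R\<^esub> r') U = lact ?T r (lact ?T r' U)"
      if "r \<in> carrier R" "r' \<in> carrier R" "U \<in> carrier ?T"
    proof -
      obtain c where c: "c \<in> carrier F" "U = H #>\<^bsub>F\<^esub> c" using \<open>U \<in> carrier ?T\<close> ex by blast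
      have "l (r \<otimes>\<^bsub>R\<^esub> r') c - l r (l r' c) \<in> H"
        by (rule add_ind[OF c(1)]) (use that in \<open>auto simp: l_of B.lact_mult H0\<close>)
      then show ?thesis using c that by (simp add: coset_eq)
    qed
    show "ract ?T U (s \<otimes>\<^bsub>T\<^esub> s') = ract ?T (ract ?T U s) s'"
      if "U \<in> carrier ?T" "s \<in> carrier T" "s' \<in> carrier T"
    proof -
      obtain c where c: "c \<in> carrier F" "U = H #>\<^bsub>F\<^esub> c" using \<open>U \<in> carrier ?T\<close> ex by blast
      have "rr (s \<otimes>\<^bsub>T\<^esub> s') c - rr s' (rr s c) \<in> H"
        by (rule add_ind[OF c(1)]) (use that in \<open>auto simp: rr_of C.ract_mult H0\<close>)
      then show ?thesis using c that by (simp add: coset_eq)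
    qed
    show "lact ?T \<one>\<^bsub>R\<^esub> U = U" if "U \<in> carrier ?T"
    proof -
      obtain c where c: "c \<in> carrier F" "U = H #>\<^bsub>F\<^esub> c" using \<open>U \<in> carrier ?T\<close> ex by blast
      have "l \<one>\<^bsub>R\<^esub> c - c \<in> H"
        by (rule add_ind[OF c(1)]) (auto simp: l_of B.lact_one H0)
      then show ?thesis using c that by (simp add: coset_eq)
    qed
    show "ract ?T U \<one>\<^bsub>T\<^esub> = U" if "U \<in> carrier ?T"
    proof -
      obtain c where c: "c \<in> carrier F" "U = H #>\<^bsub>F\<^esub> c" using \<open>U \<in> carrier ?T\<close> ex by blast
      have "rr \<one>\<^bsub>T\<^esub> c - c \<in> H"
        by (rule add_ind[OF c(1)]) (auto simp: rr_of C.ract_one H0)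
      then show ?thesis using c that by (simp add: coset_eq)
    qed
    show "lact ?T r (ract ?T U s) = ract ?T (lact ?T r U) s"
      if "r \<in> carrier R" "U \<in> carrier ?T" "s \<in> carrier T"
    proof -
      obtain c where c: "c \<in> carrier F" "U = H #>\<^bsub>F\<^esub> c" using \<open>U \<in> carrier ?T\<close> ex by blast
      have "l r (rr s c) - rr s (l r c) \<in> H"
        by (rule add_ind[OF c(1)]) (auto simp: rr_of l_of H0)
      then show ?thesis using c that by (simp add: coset_eq)
    qed
  qed
  have pure: "pure_tensor S B C x y = H #>\<^bsub>F\<^esub> frag_of (x, y)" for x y
    by (simp add: pure_tensor_def H_def F_def)
  show "lact ?T r (pure_tensor S B C x y) = pure_tensor S B C (lact B r x) y"
    if "r \<in> carrier R" "x \<in> carrier B" "y \<in> carrier C" for r x y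
    using that by (simp add: pure F_of l_of)
  show "ract ?T (pure_tensor S B C x y) t = pure_tensor S B C x (ract C y t)"
    if "x \<in> carrier B" "y \<in> carrier C" "t \<in> carrier T" for x y t
    using that by (simp add: pure F_of rr_of)
qed

section \<open>Algebras and algebra extensions\<close>

text \<open>The locale \<open>algebra\<close> of HOL-Algebra is restricted to commutative algebras.\<close>

locale assoc_algebra = module K M + M: ring M
  for K :: "('k, 'x) ring_scheme" (structure) and M :: "('k, 'm, 'z) module_scheme" (structure) +
  assumes smult_mult_left: "\<lbrakk>k \<in> carrier K; x \<in> carrier M; y \<in> carrier M\<rbrakk> \<Longrightarrow>
      (k \<odot>\<^bsub>M\<^esub> x) \<otimes>\<^bsub>M\<^esub> y = k \<odot>\<^bsub>M\<^esub> (x \<otimes>\<^bsub>M\<^esub> y)"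
    and smult_mult_right: "\<lbrakk>k \<in> carrier K; x \<in> carrier M; y \<in> carrier M\<rbrakk> \<Longrightarrow>
      x \<otimes>\<^bsub>M\<^esub> (k \<odot>\<^bsub>M\<^esub> y) = k \<odot>\<^bsub>M\<^esub> (x \<otimes>\<^bsub>M\<^esub> y)"

locale algebra_extension = M: assoc_algebra K M + N: assoc_algebra K N
  for K :: "('k, 'x) ring_scheme" and N :: "('k, 'n, 'w) module_scheme"
    and M :: "('k, 'm, 'z) module_scheme" and \<iota> :: "'n \<Rightarrow> 'm" +
  assumes ring_hom: "\<iota> \<in> ring_hom N M"
    and smult_hom: "\<lbrakk>k \<in> carrier K; a \<in> carrier N\<rbrakk> \<Longrightarrow> \<iota> (k \<odot>\<^bsub>N\<^esub> a) = k \<odot>\<^bsub>M\<^esub> \<iota> a"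

definition unit_map :: "('k, 'm, 'z) module_scheme \<Rightarrow> 'k \<Rightarrow> 'm"
  where "unit_map A k = k \<odot>\<^bsub>A\<^esub> \<one>\<^bsub>A\<^esub>"

definition proper_extension ::
  "('k, 'n, 'w) module_scheme \<Rightarrow> ('k, 'm, 'z) module_scheme \<Rightarrow> ('n \<Rightarrow> 'm) \<Rightarrow> bool"
  where "proper_extension N M \<iota> \<longleftrightarrow> inj_on \<iota> (carrier N)"

definition centralizer ::
  "('k, 'n, 'w) module_scheme \<Rightarrow> ('k, 'm, 'z) module_scheme \<Rightarrow> ('n \<Rightarrow> 'm) \<Rightarrow> 'm set"
  where "centralizer N M \<iota> =
    {m \<in> carrier M. \<forall>a\<in>carrier N. \<iota> a \<otimes>\<^bsub>M\<^esub> m = m \<otimes>\<^bsub>M\<^esub> \<iota> a}"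

text \<open>Bijectivity expresses that \<open>K\<close> is identified with the centralizer via \<open>k \<mapsto> k 1\<close>.\<close>

definition irreducible_extension ::
  "('k, 'x) ring_scheme \<Rightarrow> ('k, 'n, 'w) module_scheme \<Rightarrow> ('k, 'm, 'z) module_scheme \<Rightarrow>
   ('n \<Rightarrow> 'm) \<Rightarrow> bool"
  where "irreducible_extension K N M \<iota> \<longleftrightarrow>
    bij_betw (unit_map M) (carrier K) (centralizer N M \<iota>)"

text \<open>The bimodules \<open>\<^sub>NM\<^sub>M\<close>, \<open>\<^sub>MM\<^sub>N\<close>, \<open>\<^sub>NM\<^sub>N\<close> and \<open>\<^sub>NN\<^sub>N\<close>.\<close>

abbreviation bimod_NM :: "('k, 'm, 'z) module_scheme \<Rightarrow> ('n \<Rightarrow> 'm) \<Rightarrow> ('n, 'm, 'm) bimodule"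
  where "bimod_NM M \<iota> \<equiv> restrict_bimod M \<iota> (\<lambda>x. x)"

abbreviation bimod_MN :: "('k, 'm, 'z) module_scheme \<Rightarrow> ('n \<Rightarrow> 'm) \<Rightarrow> ('m, 'n, 'm) bimodule"
  where "bimod_MN M \<iota> \<equiv> restrict_bimod M (\<lambda>x. x) \<iota>"

abbreviation bimod_NN :: "('k, 'm, 'z) module_scheme \<Rightarrow> ('n \<Rightarrow> 'm) \<Rightarrow> ('n, 'n, 'm) bimodule"
  where "bimod_NN M \<iota> \<equiv> restrict_bimod M \<iota> \<iota>"

abbreviation bimod_self :: "('k, 'n, 'w) module_scheme \<Rightarrow> ('n, 'n, 'n) bimodule"
  where "bimod_self N \<equiv> restrict_bimod N (\<lambda>x. x) (\<lambda>x. x)"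

definition depth_two ::
  "('k, 'n, 'w) module_scheme \<Rightarrow> ('k, 'm, 'z) module_scheme \<Rightarrow> ('n \<Rightarrow> 'm) \<Rightarrow> bool"
  where "depth_two N M \<iota> \<longleftrightarrow>
    (\<exists>n\<ge>1. iso_direct_summand N M
      (tensor N (bimod_NN M \<iota>) (bimod_NM M \<iota>)) (power_bimod n (bimod_NM M \<iota>))) \<and>
    (\<exists>m\<ge>1. iso_direct_summand M N
      (tensor N (bimod_MN M \<iota>) (bimod_NN M \<iota>)) (power_bimod m (bimod_MN M \<iota>)))"

definition frobenius_extension ::
  "('k, 'n, 'w) module_scheme \<Rightarrow> ('k, 'm, 'z) module_scheme \<Rightarrow> ('n \<Rightarrow> 'm) \<Rightarrow> bool"
  where "frobenius_extension N M \<iota> \<longleftrightarrow>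
    (\<exists>E\<in>bimod_hom N N (bimod_NN M \<iota>) (bimod_self N).
     \<exists>(n::nat) x y. x \<in> {..<n} \<rightarrow> carrier M \<and> y \<in> {..<n} \<rightarrow> carrier M \<and>
      (\<forall>m\<in>carrier M.
        (\<Oplus>\<^bsub>M\<^esub>i\<in>{..<n}. x i \<otimes>\<^bsub>M\<^esub> \<iota> (E (y i \<otimes>\<^bsub>M\<^esub> m))) = m \<and>
        (\<Oplus>\<^bsub>M\<^esub>i\<in>{..<n}. \<iota> (E (m \<otimes>\<^bsub>M\<^esub> x i)) \<otimes>\<^bsub>M\<^esub> y i) = m))"

text \<open>\<open>N\<close> is regarded as a subbimodule of \<open>\<^sub>NM\<^sub>N\<close> by means of \<open>\<iota>\<close>.\<close>

definition split_extension ::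
  "('k, 'n, 'w) module_scheme \<Rightarrow> ('k, 'm, 'z) module_scheme \<Rightarrow> ('n \<Rightarrow> 'm) \<Rightarrow> bool"
  where "split_extension N M \<iota> \<longleftrightarrow> direct_summand N N (\<iota> ` carrier N) (bimod_NN M \<iota>)"

section \<open>The endomorphism algebra and separability\<close>

text \<open>Endomorphisms are extensional, so that equal endomorphisms are equal as functions.\<close>

definition bimod_End ::
  "('k, 'n, 'w) module_scheme \<Rightarrow> ('k, 'm, 'z) module_scheme \<Rightarrow> ('n \<Rightarrow> 'm) \<Rightarrow> ('k, 'm \<Rightarrow> 'm) module"
  where "bimod_End N M \<iota> =
    \<lparr>carrier = bimod_hom N N (bimod_NN M \<iota>) (bimod_NN M \<iota>) \<inter> extensional (carrier M),
     monoid.mult = compose (carrier M), one = (\<lambda>x\<in>carrier M. x),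
     ring.zero = (\<lambda>x\<in>carrier M. \<zero>\<^bsub>M\<^esub>), add = (\<lambda>f g. \<lambda>x\<in>carrier M. f x \<oplus>\<^bsub>M\<^esub> g x),
     smult = (\<lambda>k f. \<lambda>x\<in>carrier M. k \<odot>\<^bsub>M\<^esub> f x)\<rparr>"

lemma (in algebra_extension) assoc_algebra_bimod_End:
  "assoc_algebra K (bimod_End N M \<iota>)"
proof -
  interpret h: ring_hom_ring N M \<iota>
    by (intro ring_hom_ringI2 M.M.ring_axioms N.M.ring_axioms ring_hom)
  note defs = bimod_End_def bimod_hom_def restrict_bimod_def hom_def
  let ?A = "bimod_End N M \<iota>"
  have add: "f \<oplus>\<^bsub>?A\<^esub> g \<in> carrier ?A" if "f \<in> carrier ?A" "g \<in> carrier ?A" for f g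
    using that by (auto simp: defs M.M.l_distr M.M.r_distr M.M.a_ac Pi_iff)
  have mult: "f \<otimes>\<^bsub>?A\<^esub> g \<in> carrier ?A" if "f \<in> carrier ?A" "g \<in> carrier ?A" for f g
    using that by (auto simp: defs compose_def Pi_iff)
  have smult: "k \<odot>\<^bsub>?A\<^esub> f \<in> carrier ?A" if "f \<in> carrier ?A" "k \<in> carrier K" for f k
    using that by (auto simp: defs M.smult_r_distr M.smult_mult_left M.smult_mult_right Pi_iff)
  have zero: "\<zero>\<^bsub>?A\<^esub> \<in> carrier ?A" and one: "\<one>\<^bsub>?A\<^esub> \<in> carrier ?A"
    by (auto simp: defs)
  have neg: "\<exists>g\<in>carrier ?A. g \<oplus>\<^bsub>?A\<^esub> f = \<zero>\<^bsub>?A\<^esub>" if "f \<in> carrier ?A" for f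
    using that
    by (intro bexI[of _ "\<lambda>x\<in>carrier M. \<ominus>\<^bsub>M\<^esub> f x"])
      (auto simp: defs M.M.l_neg M.M.r_neg M.M.minus_add M.M.l_minus M.M.r_minus M.M.a_ac Pi_iff intro!: ext)
  have ext: "f = g" if "f \<in> carrier ?A" "g \<in> carrier ?A" "\<And>x. x \<in> carrier M \<Longrightarrow> f x = g x" for f g
    using that by (auto simp: bimod_End_def intro: extensionalityI)
  have app: "f x \<in> carrier M" "f (x \<oplus>\<^bsub>M\<^esub> y) = f x \<oplus>\<^bsub>M\<^esub> f y"
    if "f \<in> carrier ?A" "x \<in> carrier M" "y \<in> carrier M" for f x y
    using that by (auto simp: defs)
  have sm: "f (k \<odot>\<^bsub>M\<^esub> x) = k \<odot>\<^bsub>M\<^esub> f x"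
    if "f \<in> carrier ?A" "k \<in> carrier K" "x \<in> carrier M" for f k x
  proof -
    have "k \<odot>\<^bsub>M\<^esub> y = \<iota> (k \<odot>\<^bsub>N\<^esub> \<one>\<^bsub>N\<^esub>) \<otimes>\<^bsub>M\<^esub> y" if "y \<in> carrier M" for y
      using that \<open>k \<in> carrier K\<close> by (simp add: smult_hom M.smult_mult_left)
    moreover have "f (\<iota> (k \<odot>\<^bsub>N\<^esub> \<one>\<^bsub>N\<^esub>) \<otimes>\<^bsub>M\<^esub> x) = \<iota> (k \<odot>\<^bsub>N\<^esub> \<one>\<^bsub>N\<^esub>) \<otimes>\<^bsub>M\<^esub> f x"
      using that by (auto simp: defs)
    ultimately show ?thesis using that app by simp
  qed
  have ev: "(f \<oplus>\<^bsub>?A\<^esub> g) x = f x \<oplus>\<^bsub>M\<^esub> g x" "(f \<otimes>\<^bsub>?A\<^esub> g) x = f (g x)"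
    "(k \<odot>\<^bsub>?A\<^esub> f) x = k \<odot>\<^bsub>M\<^esub> f x" "\<zero>\<^bsub>?A\<^esub> x = \<zero>\<^bsub>M\<^esub>" "\<one>\<^bsub>?A\<^esub> x = x"
    if "x \<in> carrier M" for f g k x
    using that by (auto simp: bimod_End_def compose_def)
  have ab: "abelian_group ?A"
    by (rule abelian_groupI)
      (auto intro!: ext add zero neg simp: ev app M.M.a_ac)
  have "ring ?A"
    by (rule ringI[OF ab], rule monoidI)
      (auto intro!: ext add mult one simp: ev app M.M.a_ac)
  then show ?thesis
    by (intro assoc_algebra.intro module.intro module_axioms.intro assoc_algebra_axioms.intro ab
        M.R.cring_axioms)
      (auto intro!: ext add mult smult simp: ev app sm M.smult_r_distr M.smult_l_distr M.smult_assoc1)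
qed

text \<open>
  \<open>A\<close> is separable if the multiplication \<open>\<mu>\<close> from \<open>A \<otimes>\<^sub>K A\<close> to \<open>A\<close> is a split epimorphism of
  \<open>A\<close>-\<open>A\<close>-bimodules. As a homomorphism \<open>\<mu>\<close> is determined by its values on pure tensors.
\<close>

definition algebra_tensor ::
  "('k, 'x) ring_scheme \<Rightarrow> ('k, 'a, 'z) module_scheme \<Rightarrow> ('a, 'a, ('a \<times> 'a \<Rightarrow>\<^sub>0 int) set) bimodule"
  where "algebra_tensor K A =
    tensor K (restrict_bimod A (\<lambda>a. a) (unit_map A)) (restrict_bimod A (unit_map A) (\<lambda>a. a))"

definition algebra_pure_tensor ::
  "('k, 'x) ring_scheme \<Rightarrow> ('k, 'a, 'z) module_scheme \<Rightarrow> 'a \<Rightarrow> 'a \<Rightarrow> ('a \<times> 'a \<Rightarrow>\<^sub>0 int) set"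
  where "algebra_pure_tensor K A =
    pure_tensor K (restrict_bimod A (\<lambda>a. a) (unit_map A)) (restrict_bimod A (unit_map A) (\<lambda>a. a))"

definition separable_algebra ::
  "('k, 'x) ring_scheme \<Rightarrow> ('k, 'a, 'z) module_scheme \<Rightarrow> bool"
  where "separable_algebra K A \<longleftrightarrow>
    (\<exists>\<mu>\<in>bimod_hom A A (algebra_tensor K A) (bimod_self A).
      (\<forall>a\<in>carrier A. \<forall>b\<in>carrier A. \<mu> (algebra_pure_tensor K A a b) = a \<otimes>\<^bsub>A\<^esub> b) \<and>
      (\<exists>\<sigma>\<in>bimod_hom A A (bimod_self A) (algebra_tensor K A). \<forall>a\<in>carrier A. \<mu> (\<sigma> a) = a))"

end

theory Submission
  imports Defs
begin

text \<open>
  Half of the depth two condition gives \<open>N\<close>-central elements \<open>t\<^sub>i\<close> of \<open>M \<otimes>\<^sub>N M\<close> and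
  \<open>\<beta>\<^sub>i \<in> A\<close> with \<open>m \<otimes> m' = \<Sum>\<^sub>i t\<^sub>i \<beta>\<^sub>i(m) m'\<close>. Irreducibility turns \<open>\<epsilon>(\<alpha>) = \<alpha>(1)\<close> into a
  character of \<open>A\<close> and the coefficients in \<open>\<alpha> = \<Sum>\<^sub>i \<alpha>(t\<^sub>i\<^sup>1) t\<^sub>i\<^sup>2 \<beta>\<^sub>i\<close> into scalars.
  If \<open>F\<close> is a bimodule projection of \<open>M\<close> onto \<open>N\<close>, then \<open>\<Sum>\<^sub>i t\<^sub>i\<^sup>1 F(t\<^sub>i\<^sup>2 -) \<otimes> \<beta>\<^sub>i\<close> is a
  separability element; its Casimir property follows by expanding \<open>\<beta>\<^sub>i \<circ> \<alpha>\<close> in the \<open>\<beta>\<^sub>j\<close>.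
  Conversely, a separability element \<open>\<Sum>\<^sub>i a\<^sub>i \<otimes> b\<^sub>i\<close> yields the normalised left integral
  \<open>F = \<Sum>\<^sub>i \<epsilon>(b\<^sub>i) a\<^sub>i\<close>, that is \<open>\<alpha> \<circ> F = \<epsilon>(\<alpha>) F\<close> and \<open>F(1) = 1\<close>. Then
  \<open>F(x) \<otimes> 1 = 1 \<otimes> F(x)\<close> in \<open>M \<otimes>\<^sub>N M\<close>, and the Frobenius system gives
  \<open>F(m) = \<Sum>\<^sub>k F(x\<^sub>k) E(y\<^sub>k m) = \<Sum>\<^sub>k E(F(x\<^sub>k) y\<^sub>k m) \<in> N\<close>, so \<open>F\<close> splits the extension.
\<close>

section \<open>Bimodules, direct summands and tensor products\<close>

text \<open>Over an infinite index set both products take the default value, the unit, which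
  \<open>h\<close> preserves. As bimodules are written multiplicatively, this is how sums are moved
  through additive maps.\<close>

lemma hom_finprod:
  assumes "comm_group G" "comm_group H" "h \<in> hom G H" "f \<in> I \<rightarrow> carrier G"
  shows "h (finprod G f I) = finprod H (\<lambda>i. h (f i)) I"
proof -
  interpret G: comm_group G by fact
  interpret H: comm_group H by fact
  interpret h: group_hom G H h
    by (simp add: group_hom_def group_hom_axioms_def assms G.is_group H.is_group)
  show ?thesis
    using assms(4) by (induction I rule: infinite_finite_induct) (auto simp: Pi_iff)
qed

lemma finprod_restrict_bimod: "finprod (restrict_bimod M \<phi> \<psi>) f I = finsum M f I"
  by (simp add: finsum_def finprod_def restrict_bimod_def)

lemma restrict_bimod_simps [simp]:
  "carrier (restrict_bimod M \<phi> \<psi>) = carrier M"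
  "x \<otimes>\<^bsub>restrict_bimod M \<phi> \<psi>\<^esub> y = x \<oplus>\<^bsub>M\<^esub> y"
  "\<one>\<^bsub>restrict_bimod M \<phi> \<psi>\<^esub> = \<zero>\<^bsub>M\<^esub>"
  "lact (restrict_bimod M \<phi> \<psi>) r x = \<phi> r \<otimes>\<^bsub>M\<^esub> x"
  "ract (restrict_bimod M \<phi> \<psi>) x s = x \<otimes>\<^bsub>M\<^esub> \<psi> s"
  by (simp_all add: restrict_bimod_def)

section \<open>Direct summands, projections and retractions\<close>

context bimodule
begin

lemma lact_hom: "r \<in> carrier R \<Longrightarrow> lact B r \<in> hom B B"
  by (simp add: hom_def lact_closed lact_add_right)

lemma ract_hom: "s \<in> carrier S \<Longrightarrow> (\<lambda>x. ract B x s) \<in> hom B B"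
  by (simp add: hom_def ract_closed ract_add_left)

text \<open>The complement gives every element a unique factorization with one factor in
  \<open>P\<close> and one in \<open>Q\<close>; \<open>p\<close> keeps the first. Uniqueness reduces
  compatibility with sums and actions to a check on the factors.\<close>

lemma direct_summand_projection:
  assumes "direct_summand R S P B"
  obtains p where "p \<in> bimod_hom R S B B" "\<And>x. x \<in> carrier B \<Longrightarrow> p x \<in> P"
    "\<And>x. x \<in> P \<Longrightarrow> p x = x"
proof -
  obtain Q where P: "subbimodule R S P B" and Q: "subbimodule R S Q B"
    and PQ: "P <#>\<^bsub>B\<^esub> Q = carrier B" "P \<inter> Q = {\<one>\<^bsub>B\<^esub>}"
    using assms by (auto simp: direct_summand_def)
  interpret P: subgroup P B using P by (simp add: subbimodule_def)
  interpret Q: subgroup Q B using Q by (simp add: subbimodule_def)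
  \<comment> \<open>The quotient of \<open>a\<close> by \<open>a'\<close> equals that of
    \<open>b'\<close> by \<open>b\<close>, so it lies in \<open>P \<inter> Q\<close> and is
    trivial.\<close>
  have unique: "a = a'"
    if eq: "a \<otimes>\<^bsub>B\<^esub> b = a' \<otimes>\<^bsub>B\<^esub> b'" and mem: "a \<in> P" "a' \<in> P" "b \<in> Q" "b' \<in> Q" for a a' b b'
  proof -
    have c: "a \<in> carrier B" "a' \<in> carrier B" "b \<in> carrier B" "b' \<in> carrier B"
      using mem by auto
    have "inv\<^bsub>B\<^esub> a' \<otimes>\<^bsub>B\<^esub> a \<otimes>\<^bsub>B\<^esub> b = b'"
      using eq c by (simp add: B.m_assoc B.inv_solve_left')
    then have "inv\<^bsub>B\<^esub> a' \<otimes>\<^bsub>B\<^esub> a = b' \<otimes>\<^bsub>B\<^esub> inv\<^bsub>B\<^esub> b"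
      using c by (metis B.inv_closed B.inv_solve_right B.m_closed)
    then have "inv\<^bsub>B\<^esub> a' \<otimes>\<^bsub>B\<^esub> a \<in> P \<inter> Q"
      using mem by (metis IntI P.m_closed P.m_inv_closed Q.m_closed Q.m_inv_closed)
    then have "inv\<^bsub>B\<^esub> a' \<otimes>\<^bsub>B\<^esub> a = \<one>\<^bsub>B\<^esub>" using PQ by simp
    then show ?thesis using c by (metis B.inv_closed B.inv_equality B.inv_inv B.inv_comm)
  qed
  have dec: "\<exists>a\<in>P. \<exists>b\<in>Q. x = a \<otimes>\<^bsub>B\<^esub> b" if "x \<in> carrier B" for x
    using that unfolding PQ(1)[symmetric] by (auto simp: set_mult_def)
  \<comment> \<open>Off the carrier the choice is arbitrary, which is harmless because
    \<open>bimod_hom\<close> constrains values on the carrier only.\<close>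
  define p where "p x = (SOME a. a \<in> P \<and> (\<exists>b\<in>Q. x = a \<otimes>\<^bsub>B\<^esub> b))" for x
  have p: "p (a \<otimes>\<^bsub>B\<^esub> b) = a" if "a \<in> P" "b \<in> Q" for a b
    unfolding p_def by (rule some_equality) (use that unique in blast)+
  have p_mem: "p x \<in> P" if "x \<in> carrier B" for x
    using dec[OF that] p by auto
  have mult: "p (x \<otimes>\<^bsub>B\<^esub> y) = p x \<otimes>\<^bsub>B\<^esub> p y" if xy: "x \<in> carrier B" "y \<in> carrier B" for x y
  proof -
    obtain a b c d where *: "a \<in> P" "b \<in> Q" "x = a \<otimes>\<^bsub>B\<^esub> b" "c \<in> P" "d \<in> Q" "y = c \<otimes>\<^bsub>B\<^esub> d"
      using dec xy by meson
    then have "x \<otimes>\<^bsub>B\<^esub> y = (a \<otimes>\<^bsub>B\<^esub> c) \<otimes>\<^bsub>B\<^esub> (b \<otimes>\<^bsub>B\<^esub> d)"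
      by (simp add: B.m_ac)
    then show ?thesis using * by (simp add: p)
  qed
  have "p (lact B r x) = lact B r (p x)" if "r \<in> carrier R" "x \<in> carrier B" for r x
    using dec[OF that(2)] that P Q by (auto simp: subbimodule_def lact_add_right p)
  moreover have "p (ract B x s) = ract B (p x) s" if "s \<in> carrier S" "x \<in> carrier B" for s x
    using dec[OF that(2)] that P Q by (auto simp: subbimodule_def ract_add_left p)
  ultimately have "p \<in> bimod_hom R S B B"
    using p_mem mult by (auto simp: bimod_hom_def hom_def)
  moreover have "p x = x" if "x \<in> P" for x
    using p[OF that Q.one_closed] that by simp
  ultimately show ?thesis using that p_mem by blast
qed

text \<open>The complement is the kernel of \<open>p\<close>: each \<open>x\<close> is the product
  of \<open>p x\<close> and \<open>inv (p x) \<otimes> x\<close>, and \<open>p\<close> kills the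
  second factor.\<close>

lemma direct_summandI:
  assumes p: "p \<in> bimod_hom R S B B" and P: "subbimodule R S P B"
    and mem: "\<And>x. x \<in> carrier B \<Longrightarrow> p x \<in> P" and id: "\<And>x. x \<in> P \<Longrightarrow> p x = x"
  shows "direct_summand R S P B"
proof -
  have hom: "p \<in> hom B B"
    and pl: "\<And>r x. r \<in> carrier R \<Longrightarrow> x \<in> carrier B \<Longrightarrow> p (lact B r x) = lact B r (p x)"
    and pr: "\<And>x s. s \<in> carrier S \<Longrightarrow> x \<in> carrier B \<Longrightarrow> p (ract B x s) = ract B (p x) s"
    using p by (auto simp: bimod_hom_def)
  interpret P: subgroup P B using P by (simp add: subbimodule_def)
  interpret p: group_hom B B p
    by (simp add: group_hom_def group_hom_axioms_def hom B.is_group)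
  \<comment> \<open>Actions fix the neutral element, so an element killed by \<open>p\<close> is
    still killed after acting on it.\<close>
  have l1: "lact B r \<one>\<^bsub>B\<^esub> = \<one>\<^bsub>B\<^esub>" if "r \<in> carrier R" for r
    using group_hom.hom_one[of B B "lact B r"] lact_hom[OF that]
    by (simp add: group_hom_def group_hom_axioms_def B.is_group)
  have r1: "ract B \<one>\<^bsub>B\<^esub> s = \<one>\<^bsub>B\<^esub>" if "s \<in> carrier S" for s
    using group_hom.hom_one[of B B "\<lambda>x. ract B x s"] ract_hom[OF that]
    by (simp add: group_hom_def group_hom_axioms_def B.is_group)
  let ?Q = "kernel B B p"
  have "subbimodule R S ?Q B"
    unfolding subbimodule_def using p.subgroup_kernel l1 r1
    by (auto simp: kernel_def lact_closed ract_closed pl pr)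
  moreover have "P <#>\<^bsub>B\<^esub> ?Q = carrier B"
  proof
    show "P <#>\<^bsub>B\<^esub> ?Q \<subseteq> carrier B" by (auto simp: set_mult_def kernel_def)
    show "carrier B \<subseteq> P <#>\<^bsub>B\<^esub> ?Q"
    proof
      fix x assume x: "x \<in> carrier B"
      then have "p (inv\<^bsub>B\<^esub> p x \<otimes>\<^bsub>B\<^esub> x) = \<one>\<^bsub>B\<^esub>" by (simp add: id mem)
      then have "inv\<^bsub>B\<^esub> p x \<otimes>\<^bsub>B\<^esub> x \<in> ?Q" using x by (simp add: kernel_def)
      moreover have "x = p x \<otimes>\<^bsub>B\<^esub> (inv\<^bsub>B\<^esub> p x \<otimes>\<^bsub>B\<^esub> x)"
        using x by (simp add: B.m_assoc[symmetric])
      ultimately show "x \<in> P <#>\<^bsub>B\<^esub> ?Q" using mem[OF x] by (auto simp: set_mult_def)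
    qed
  qed
  moreover have "P \<inter> ?Q = {\<one>\<^bsub>B\<^esub>}" using id by (auto simp: kernel_def)
  ultimately show ?thesis using P by (auto simp: direct_summand_def)
qed

text \<open>\<open>g\<close> projects onto the image \<open>P\<close> of \<open>f\<close> and then
  inverts \<open>f\<close>. In this form, coordinates in \<open>B\<close> can be pulled back along
  \<open>f\<close> and unit vectors pushed to \<open>C\<close> along \<open>g\<close>.\<close>

lemma iso_direct_summand_retraction:
  assumes C: "bimodule R S C" and "iso_direct_summand R S C B"
  obtains f g where "f \<in> bimod_hom R S C B" "g \<in> bimod_hom R S B C"
    "\<And>x. x \<in> carrier C \<Longrightarrow> g (f x) = x"
proof -
  interpret C: bimodule R S C by fact
  obtain P f where P: "direct_summand R S P B" and f: "f \<in> bimod_hom R S C B"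
    and bij: "bij_betw f (carrier C) P"
    using assms(2) by (auto simp: iso_direct_summand_def)
  obtain p where p: "p \<in> bimod_hom R S B B" "\<And>x. x \<in> carrier B \<Longrightarrow> p x \<in> P"
    "\<And>x. x \<in> P \<Longrightarrow> p x = x"
    using direct_summand_projection[OF P] by blast
  define g where "g x = inv_into (carrier C) f (p x)" for x
  have inj: "inj_on f (carrier C)" and img: "f ` carrier C = P"
    using bij by (auto simp: bij_betw_def)
  have gC: "g x \<in> carrier C" and fg: "f (g x) = p x" if "x \<in> carrier B" for x
    using p(2)[OF that] by (auto simp: g_def img[symmetric] inv_into_into f_inv_into_f)
  \<comment> \<open>Injectivity of \<open>f\<close> reduces an equation for \<open>g\<close> to one
    after applying \<open>f\<close>, where \<open>f (g x)\<close> is \<open>p x\<close>.\<close>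
  have g_eq: "g x = c" if "x \<in> carrier B" "c \<in> carrier C" "f c = p x" for x c
    using that inj by (simp add: g_def[of x] that(3)[symmetric])
  have "g \<in> bimod_hom R S B C"
    using p f gC fg
    by (auto simp: bimod_hom_def hom_def Pi_iff intro!: g_eq C.lact_closed C.ract_closed
        lact_closed ract_closed)
  moreover have "g (f x) = x" if "x \<in> carrier C" for x
    using that p img f by (intro g_eq) (auto simp: bimod_hom_def hom_def)
  ultimately show ?thesis using that f by blast
qed

end

section \<open>Finite direct powers of a bimodule\<close>

lemma bimodule_power_bimod:
  assumes "bimodule R S B"
  shows "bimodule R S (power_bimod n B)"
proof -
  interpret bimodule R S B by fact
  let ?V = "power_bimod n B"
  have V: "carrier ?V = PiE {..<n} (\<lambda>_. carrier B)"
    "\<And>v w. v \<otimes>\<^bsub>?V\<^esub> w = (\<lambda>i\<in>{..<n}. v i \<otimes>\<^bsub>B\<^esub> w i)" "\<one>\<^bsub>?V\<^esub> = (\<lambda>i\<in>{..<n}. \<one>\<^bsub>B\<^esub>)"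
    "\<And>r v. lact ?V r v = (\<lambda>i\<in>{..<n}. lact B r (v i))"
    "\<And>v s. ract ?V v s = (\<lambda>i\<in>{..<n}. ract B (v i) s)"
    by (simp_all add: power_bimod_def Let_def)
  have "comm_group ?V"
  proof (rule comm_groupI)
    fix v assume "v \<in> carrier ?V"
    then show "\<exists>w\<in>carrier ?V. w \<otimes>\<^bsub>?V\<^esub> v = \<one>\<^bsub>?V\<^esub>"
      by (intro bexI[of _ "\<lambda>i\<in>{..<n}. inv\<^bsub>B\<^esub> v i"]) (auto simp: V PiE_iff)
  qed (auto simp: V PiE_iff B.m_assoc extensional_def restrict_def fun_eq_iff intro: B.m_comm)
  then show ?thesis
    by (intro bimodule.intro bimodule_axioms.intro R.ring_axioms S.ring_axioms)
      (auto simp: V PiE_iff extensional_def restrict_def fun_eq_iff lact_closed ract_closed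
        lact_add_left lact_add_right lact_mult lact_one ract_add_left ract_add_right ract_mult
        ract_one lact_ract)
qed

lemma power_bimod_simps:
  "carrier (power_bimod n B) = PiE {..<n} (\<lambda>_. carrier B)"
  "v \<otimes>\<^bsub>power_bimod n B\<^esub> w = (\<lambda>i\<in>{..<n}. v i \<otimes>\<^bsub>B\<^esub> w i)"
  "\<one>\<^bsub>power_bimod n B\<^esub> = (\<lambda>i\<in>{..<n}. \<one>\<^bsub>B\<^esub>)"
  "lact (power_bimod n B) r v = (\<lambda>i\<in>{..<n}. lact B r (v i))"
  "ract (power_bimod n B) v s = (\<lambda>i\<in>{..<n}. ract B (v i) s)"
  by (simp_all add: power_bimod_def Let_def)

text \<open>The embedding of the \<open>i\<close>-th coordinate; for \<open>i \<ge> n\<close> its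
  value is the neutral element of the power.\<close>

definition single_bimod :: "nat \<Rightarrow> ('r, 's, 'a, 'z) bimodule_scheme \<Rightarrow> nat \<Rightarrow> 'a \<Rightarrow> nat \<Rightarrow> 'a"
  where "single_bimod n B i x = (\<lambda>j\<in>{..<n}. if j = i then x else \<one>\<^bsub>B\<^esub>)"

lemma power_bimod_decompose:
  assumes "bimodule R S B" "v \<in> carrier (power_bimod n B)"
  shows "v = finprod (power_bimod n B) (\<lambda>i. single_bimod n B i (v i)) {..<n}"
proof -
  interpret bimodule R S B by fact
  interpret V: bimodule R S "power_bimod n B" by (rule bimodule_power_bimod) fact
  have mem: "v i \<in> carrier B" if "i < n" for i
    using assms(2) that by (auto simp: power_bimod_simps(1))
  have single: "single_bimod n B i (v i) \<in> carrier (power_bimod n B)" if "i < n" for i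
    using mem that by (simp add: single_bimod_def power_bimod_simps(1))
  \<comment> \<open>Induction on the number \<open>k\<close> of factors: the partial product is
    \<open>v\<close> with all coordinates from \<open>k\<close> on made neutral.\<close>
  have "finprod (power_bimod n B) (\<lambda>i. single_bimod n B i (v i)) {..<k} =
      (\<lambda>j\<in>{..<n}. if j < k then v j else \<one>\<^bsub>B\<^esub>)" if "k \<le> n" for k
    using that
  proof (induction k)
    case 0
    then show ?case by (simp add: power_bimod_simps)
  next
    case (Suc k)
    have "finprod (power_bimod n B) (\<lambda>i. single_bimod n B i (v i)) {..<Suc k} =
      single_bimod n B k (v k) \<otimes>\<^bsub>power_bimod n B\<^esub>
      finprod (power_bimod n B) (\<lambda>i. single_bimod n B i (v i)) {..<k}"
      unfolding lessThan_Suc using Suc.prems by (intro V.finprod_insert) (auto intro!: single)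
    also have "\<dots> = (\<lambda>j\<in>{..<n}. if j < Suc k then v j else \<one>\<^bsub>B\<^esub>)"
      unfolding Suc.IH[OF Suc_leD[OF Suc.prems]]
      unfolding power_bimod_simps(2) single_bimod_def
      by (rule restrict_ext) (use mem in \<open>auto simp: less_Suc_eq\<close>)
    finally show ?case .
  qed
  from this[OF order_refl]
  have "finprod (power_bimod n B) (\<lambda>i. single_bimod n B i (v i)) {..<n} = restrict v {..<n}"
    by (simp cong: restrict_cong)
  also have "\<dots> = v" using assms(2) by (simp add: power_bimod_simps(1) PiE_restrict)
  finally show ?thesis by simp
qed

section \<open>Universal property and generators of the tensor product\<close>

locale bimodule_pair = B: bimodule R S B + C: bimodule S T C
  for R :: "('r, 'x) ring_scheme" and S :: "('s, 'y) ring_scheme" and T :: "('t, 'u) ring_scheme"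
    and B :: "('r, 's, 'a, 'z) bimodule_scheme" and C :: "('s, 't, 'b, 'w) bimodule_scheme"
begin

sublocale tensor: bimodule R T "tensor S B C"
  by (rule bimodule_tensor(1)[OF B.bimodule_axioms C.bimodule_axioms])

lemmas lact_pure_tensor = bimodule_tensor(2)[OF B.bimodule_axioms C.bimodule_axioms]
lemmas ract_pure_tensor = bimodule_tensor(3)[OF B.bimodule_axioms C.bimodule_axioms]

lemma tensor_free_simps:
  "c \<in> carrier (tensor_free B C) \<longleftrightarrow> Poly_Mapping.keys c \<subseteq> carrier B \<times> carrier C"
  "c \<otimes>\<^bsub>tensor_free B C\<^esub> d = c + d" "\<one>\<^bsub>tensor_free B C\<^esub> = 0"
  by (simp_all add: tensor_free_def)

lemma comm_group_tensor_free: "comm_group (tensor_free B C)"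
  by (simp add: tensor_free_def abelian_free_Abelian_group)

lemma tensor_free_diff:
  "d \<in> carrier (tensor_free B C) \<Longrightarrow> c - d = c \<otimes>\<^bsub>tensor_free B C\<^esub> inv\<^bsub>tensor_free B C\<^esub> d"
  by (simp add: tensor_free_def)

lemma tensor_relations_subset: "tensor_relations S B C \<subseteq> carrier (tensor_free B C)"
proof -
  interpret F: comm_group "tensor_free B C" by (rule comm_group_tensor_free)
  have diff: "c - d \<in> carrier (tensor_free B C)"
    if "c \<in> carrier (tensor_free B C)" "d \<in> carrier (tensor_free B C)" for c d
    using that by (simp add: tensor_free_diff)
  have "frag_of (x, y) \<in> carrier (tensor_free B C)" if "x \<in> carrier B" "y \<in> carrier C" for x y
    using that by (simp add: tensor_free_simps)
  then show ?thesis
    by (auto simp: tensor_relations_def B.ract_closed C.lact_closed intro!: diff)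
qed

lemma normal_tensor_kernel: "tensor_kernel S B C \<lhd> tensor_free B C"
  unfolding tensor_kernel_def
  by (intro comm_group.subgroup_imp_normal comm_group_tensor_free group.generate_is_subgroup
      tensor_relations_subset comm_group.axioms(2))

lemma tensor_simps:
  "carrier (tensor S B C) = carrier (tensor_free B C Mod tensor_kernel S B C)"
  "U \<otimes>\<^bsub>tensor S B C\<^esub> V = U \<otimes>\<^bsub>tensor_free B C Mod tensor_kernel S B C\<^esub> V"
  by (simp_all add: tensor_def Let_def)

lemma tensor_coset_hom:
  "(\<lambda>c. tensor_kernel S B C #>\<^bsub>tensor_free B C\<^esub> c) \<in> hom (tensor_free B C) (tensor S B C)"
  using normal.r_coset_hom_Mod[OF normal_tensor_kernel] unfolding hom_def tensor_simps .

lemma pure_tensor_closed: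
  assumes "x \<in> carrier B" "y \<in> carrier C"
  shows "pure_tensor S B C x y \<in> carrier (tensor S B C)"
proof -
  have "frag_of (x, y) \<in> carrier (tensor_free B C)"
    using assms by (simp add: tensor_free_simps)
  then show ?thesis
    unfolding pure_tensor_def using tensor_coset_hom by (rule hom_in_carrier[rotated])
qed

lemma tensor_coset_relation:
  assumes "c \<in> tensor_relations S B C"
  shows "tensor_kernel S B C #>\<^bsub>tensor_free B C\<^esub> c = \<one>\<^bsub>tensor S B C\<^esub>"
proof -
  interpret F: comm_group "tensor_free B C" by (rule comm_group_tensor_free)
  have "c \<in> tensor_kernel S B C"
    using assms by (simp add: tensor_kernel_def generate.incl)
  then have "tensor_kernel S B C #>\<^bsub>tensor_free B C\<^esub> c = tensor_kernel S B C"
    using F.coset_join2[OF subsetD[OF tensor_relations_subset assms]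
        normal_imp_subgroup[OF normal_tensor_kernel]] by blast
  then show ?thesis by (simp add: tensor_def Let_def)
qed

text \<open>Each identity is one family of generators of \<open>tensor_kernel\<close>, and a
  generator has the trivial coset.\<close>

lemma pure_tensor_relations:
  "\<lbrakk>x \<in> carrier B; x' \<in> carrier B; y \<in> carrier C\<rbrakk> \<Longrightarrow>
    pure_tensor S B C (x \<otimes>\<^bsub>B\<^esub> x') y = pure_tensor S B C x y \<otimes>\<^bsub>tensor S B C\<^esub> pure_tensor S B C x' y"
  "\<lbrakk>x \<in> carrier B; y \<in> carrier C; y' \<in> carrier C\<rbrakk> \<Longrightarrow>
    pure_tensor S B C x (y \<otimes>\<^bsub>C\<^esub> y') = pure_tensor S B C x y \<otimes>\<^bsub>tensor S B C\<^esub> pure_tensor S B C x y'"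
  "\<lbrakk>x \<in> carrier B; s \<in> carrier S; y \<in> carrier C\<rbrakk> \<Longrightarrow>
    pure_tensor S B C (ract B x s) y = pure_tensor S B C x (lact C s y)"
proof -
  let ?F = "tensor_free B C" and ?T = "tensor S B C"
  let ?q = "\<lambda>c. tensor_kernel S B C #>\<^bsub>?F\<^esub> c"
  have add: "?q (c + d) = ?q c \<otimes>\<^bsub>?T\<^esub> ?q d" if "c \<in> carrier ?F" "d \<in> carrier ?F" for c d
    using tensor_coset_hom that by (auto simp: hom_def tensor_free_simps)
  \<comment> \<open>Writing \<open>c\<close> as \<open>(c - d) + d\<close> exhibits the relation as
    a summand that vanishes in the quotient.\<close>
  have eq: "?q c = ?q d" if rel: "c - d \<in> tensor_relations S B C" and d: "d \<in> carrier ?F" for c d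
  proof -
    have "?q ((c - d) + d) = \<one>\<^bsub>?T\<^esub> \<otimes>\<^bsub>?T\<^esub> ?q d"
      using add[OF subsetD[OF tensor_relations_subset rel] d] tensor_coset_relation[OF rel] by simp
    moreover have "?q d \<in> carrier ?T" using tensor_coset_hom d by (auto simp: hom_def)
    ultimately show ?thesis by simp
  qed
  have of: "frag_of (x, y) \<in> carrier ?F" if "x \<in> carrier B" "y \<in> carrier C" for x y
    using that by (simp add: tensor_free_simps)
  have of2: "c + d \<in> carrier ?F" if "c \<in> carrier ?F" "d \<in> carrier ?F" for c d
    using group.is_monoid[OF comm_group.axioms(2)[OF comm_group_tensor_free]] that
    by (metis monoid.m_closed tensor_free_simps(2))
  show "pure_tensor S B C (x \<otimes>\<^bsub>B\<^esub> x') y = pure_tensor S B C x y \<otimes>\<^bsub>?T\<^esub> pure_tensor S B C x' y"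
    if "x \<in> carrier B" "x' \<in> carrier B" "y \<in> carrier C" for x x' y
    unfolding pure_tensor_def using that
    by (subst add[symmetric], simp_all only: of)
      (intro eq of2 of, unfold tensor_relations_def diff_diff_add[symmetric], blast+)
  show "pure_tensor S B C x (y \<otimes>\<^bsub>C\<^esub> y') = pure_tensor S B C x y \<otimes>\<^bsub>?T\<^esub> pure_tensor S B C x y'"
    if "x \<in> carrier B" "y \<in> carrier C" "y' \<in> carrier C" for x y y'
    unfolding pure_tensor_def using that
    by (subst add[symmetric], simp_all only: of)
      (intro eq of2 of, unfold tensor_relations_def diff_diff_add[symmetric], blast+)
  show "pure_tensor S B C (ract B x s) y = pure_tensor S B C x (lact C s y)"
    if "x \<in> carrier B" "s \<in> carrier S" "y \<in> carrier C" for x s y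
    unfolding pure_tensor_def using that
    by (auto intro!: eq of C.lact_closed simp: tensor_relations_def)
qed

text \<open>\<open>h\<close> extends additively to the free abelian group; the extension kills the
  relations, hence the subgroup they generate, and so factors through the quotient. The target
  carries no actions: linearity of an induced map is checked afterwards on pure tensors.\<close>

lemma tensor_universal:
  assumes G: "comm_group G"
    and closed: "\<And>x y. \<lbrakk>x \<in> carrier B; y \<in> carrier C\<rbrakk> \<Longrightarrow> h x y \<in> carrier G"
    and add_left: "\<And>x x' y. \<lbrakk>x \<in> carrier B; x' \<in> carrier B; y \<in> carrier C\<rbrakk> \<Longrightarrow>
      h (x \<otimes>\<^bsub>B\<^esub> x') y = h x y \<otimes>\<^bsub>G\<^esub> h x' y"
    and add_right: "\<And>x y y'. \<lbrakk>x \<in> carrier B; y \<in> carrier C; y' \<in> carrier C\<rbrakk> \<Longrightarrow>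
      h x (y \<otimes>\<^bsub>C\<^esub> y') = h x y \<otimes>\<^bsub>G\<^esub> h x y'"
    and balanced: "\<And>x s y. \<lbrakk>x \<in> carrier B; s \<in> carrier S; y \<in> carrier C\<rbrakk> \<Longrightarrow>
      h (ract B x s) y = h x (lact C s y)"
  obtains H where "H \<in> hom (tensor S B C) G"
    "\<And>x y. \<lbrakk>x \<in> carrier B; y \<in> carrier C\<rbrakk> \<Longrightarrow> H (pure_tensor S B C x y) = h x y"
proof -
  interpret G: comm_group G by fact
  let ?F = "tensor_free B C"
  interpret F: comm_group ?F by (rule comm_group_tensor_free)
  obtain k where k: "k \<in> hom ?F G"
    and k_of: "\<And>z. z \<in> carrier B \<times> carrier C \<Longrightarrow> k (frag_of z) = h (fst z) (snd z)"
    using G.free_Abelian_group_universal[of "\<lambda>z. h (fst z) (snd z)" "carrier B \<times> carrier C"] closed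
    unfolding tensor_free_def image_subset_iff by (metis mem_Times_iff)
  interpret k: group_hom ?F G k
    by (simp add: group_hom_def group_hom_axioms_def F.is_group G.is_group k)
  have of: "frag_of (x, y) \<in> carrier ?F" if "x \<in> carrier B" "y \<in> carrier C" for x y
    using that by (simp add: tensor_free_simps)
  have sub: "c - d \<in> carrier ?F" "k (c - d) = k c \<otimes>\<^bsub>G\<^esub> inv\<^bsub>G\<^esub> k d"
    if "c \<in> carrier ?F" "d \<in> carrier ?F" for c d
  proof -
    show "c - d \<in> carrier ?F" "k (c - d) = k c \<otimes>\<^bsub>G\<^esub> inv\<^bsub>G\<^esub> k d"
      unfolding tensor_free_diff[OF that(2)] using that by simp_all
  qed
  \<comment> \<open>A biadditivity relation is mapped to a product of this shape, which is trivial
    because \<open>G\<close> is commutative.\<close>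
  have cancel: "a \<otimes>\<^bsub>G\<^esub> b \<otimes>\<^bsub>G\<^esub> inv\<^bsub>G\<^esub> a \<otimes>\<^bsub>G\<^esub> inv\<^bsub>G\<^esub> b = \<one>\<^bsub>G\<^esub>"
    if "a \<in> carrier G" "b \<in> carrier G" for a b
  proof -
    have "a \<otimes>\<^bsub>G\<^esub> b \<otimes>\<^bsub>G\<^esub> inv\<^bsub>G\<^esub> a \<otimes>\<^bsub>G\<^esub> inv\<^bsub>G\<^esub> b = (a \<otimes>\<^bsub>G\<^esub> inv\<^bsub>G\<^esub> a) \<otimes>\<^bsub>G\<^esub> (b \<otimes>\<^bsub>G\<^esub> inv\<^bsub>G\<^esub> b)"
      using that by (simp only: G.m_ac G.m_closed G.inv_closed)
    then show ?thesis using that by simp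
  qed
  have "tensor_relations S B C \<subseteq> kernel ?F G k"
    by (auto simp: kernel_def tensor_relations_def sub of k_of add_left add_right balanced closed
        B.ract_closed C.lact_closed cancel)
  then have "tensor_kernel S B C \<subseteq> kernel ?F G k"
    unfolding tensor_kernel_def
    by (intro F.generate_subgroup_incl k.subgroup_kernel)
  then obtain H where H: "H \<in> hom (?F Mod tensor_kernel S B C) G"
    "\<And>c. c \<in> carrier ?F \<Longrightarrow> H (tensor_kernel S B C #>\<^bsub>?F\<^esub> c) = k c"
    using k.FactGroup_universal_kernel[OF normal_tensor_kernel] by blast
  show ?thesis
  proof (rule that)
    show "H \<in> hom (tensor S B C) G" using H(1) by (simp add: hom_def tensor_simps)
    show "H (pure_tensor S B C x y) = h x y" if "x \<in> carrier B" "y \<in> carrier C" for x y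
      using that by (simp add: pure_tensor_def H(2) of k_of)
  qed
qed

text \<open>Cosets come from integer combinations of generators, yet plain sums suffice:
  multiplicities become repetitions and a sign is absorbed into the left factor.\<close>

lemma tensor_finite_sum:
  assumes "U \<in> carrier (tensor S B C)"
  obtains n :: nat and x y where "x \<in> {..<n} \<rightarrow> carrier B" "y \<in> {..<n} \<rightarrow> carrier C"
    "U = (\<Otimes>\<^bsub>tensor S B C\<^esub>i\<in>{..<n}. pure_tensor S B C (x i) (y i))"
proof -
  let ?T = "tensor S B C"
  define tsums where "tsums = {U. \<exists>(n :: nat) x y. x \<in> {..<n} \<rightarrow> carrier B \<and> y \<in> {..<n} \<rightarrow> carrier C \<and>
    U = (\<Otimes>\<^bsub>?T\<^esub>i\<in>{..<n}. pure_tensor S B C (x i) (y i))}"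
  have one: "\<one>\<^bsub>?T\<^esub> \<in> tsums"
    unfolding tsums_def
    by (rule CollectI, rule exI[of _ 0]) simp
  have mult: "pure_tensor S B C a b \<otimes>\<^bsub>?T\<^esub> U \<in> tsums"
    if "U \<in> tsums" "a \<in> carrier B" "b \<in> carrier C" for U a b
  proof -
    obtain n :: nat and x y where *: "x \<in> {..<n} \<rightarrow> carrier B" "y \<in> {..<n} \<rightarrow> carrier C"
      "U = (\<Otimes>\<^bsub>?T\<^esub>i\<in>{..<n}. pure_tensor S B C (x i) (y i))"
      using \<open>U \<in> tsums\<close> by (auto simp: tsums_def)
    have "(\<Otimes>\<^bsub>?T\<^esub>i\<in>{..<Suc n}. pure_tensor S B C ((x(n := a)) i) ((y(n := b)) i)) =
      pure_tensor S B C ((x(n := a)) n) ((y(n := b)) n) \<otimes>\<^bsub>?T\<^esub>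
      (\<Otimes>\<^bsub>?T\<^esub>i\<in>{..<n}. pure_tensor S B C ((x(n := a)) i) ((y(n := b)) i))"
      unfolding lessThan_Suc using * that by (intro tensor.B.finprod_insert) (auto intro!: pure_tensor_closed)
    also have "(\<Otimes>\<^bsub>?T\<^esub>i\<in>{..<n}. pure_tensor S B C ((x(n := a)) i) ((y(n := b)) i)) = U"
      unfolding *(3) using * by (intro tensor.B.finprod_cong') (auto intro!: pure_tensor_closed)
    finally have "pure_tensor S B C a b \<otimes>\<^bsub>?T\<^esub> U =
      (\<Otimes>\<^bsub>?T\<^esub>i\<in>{..<Suc n}. pure_tensor S B C ((x(n := a)) i) ((y(n := b)) i))" by simp
    moreover have "x(n := a) \<in> {..<Suc n} \<rightarrow> carrier B" "y(n := b) \<in> {..<Suc n} \<rightarrow> carrier C"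
      using *(1,2) that by (auto simp: Pi_iff less_Suc_eq)
    ultimately show ?thesis unfolding tsums_def by blast
  qed
  let ?q = "\<lambda>c. tensor_kernel S B C #>\<^bsub>tensor_free B C\<^esub> c"
  interpret F: comm_group "tensor_free B C" by (rule comm_group_tensor_free)
  interpret q: group_hom "tensor_free B C" ?T ?q
    by (simp add: group_hom_def group_hom_axioms_def F.is_group tensor.B.is_group tensor_coset_hom)
  \<comment> \<open>Additivity on the left first makes tensors with a neutral left factor trivial
    and then yields the sign rule.\<close>
  have neg: "inv\<^bsub>?T\<^esub> pure_tensor S B C a b = pure_tensor S B C (inv\<^bsub>B\<^esub> a) b"
    if "a \<in> carrier B" "b \<in> carrier C" for a b
  proof -
    have "pure_tensor S B C \<one>\<^bsub>B\<^esub> b = \<one>\<^bsub>?T\<^esub>"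
      using pure_tensor_relations(1)[of "\<one>\<^bsub>B\<^esub>" "\<one>\<^bsub>B\<^esub>" b] that
      by (simp add: tensor.B.l_cancel_one' pure_tensor_closed)
    then have "pure_tensor S B C (inv\<^bsub>B\<^esub> a) b \<otimes>\<^bsub>?T\<^esub> pure_tensor S B C a b = \<one>\<^bsub>?T\<^esub>"
      using that by (simp add: pure_tensor_relations(1)[symmetric])
    then show ?thesis using that by (simp add: tensor.B.inv_equality pure_tensor_closed)
  qed
  have tsums_closed: "V \<in> carrier ?T" if "V \<in> tsums" for V
    using that unfolding tsums_def
    by (clarify, intro tensor.B.finprod_closed) (auto intro: pure_tensor_closed)
  \<comment> \<open>\<open>frag_induction\<close> builds elements from generators by differences.
    The claim therefore treats \<open>?q c\<close> together with its inverse, added to an arbitrary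
    sum \<open>V\<close>; for \<open>c - d\<close> the term of \<open>d\<close> is added first and
    that of \<open>c\<close> afterwards.\<close>
  have step: "?q c \<otimes>\<^bsub>?T\<^esub> V \<in> tsums \<and> inv\<^bsub>?T\<^esub> (?q c) \<otimes>\<^bsub>?T\<^esub> V \<in> tsums \<and> c \<in> carrier (tensor_free B C)"
    if "V \<in> tsums" "Poly_Mapping.keys c \<subseteq> carrier B \<times> carrier C" for c V
    using that(2,1)
  proof (induction c arbitrary: V rule: frag_induction)
    case zero
    have "?q 0 = \<one>\<^bsub>?T\<^esub>" using q.hom_one by (simp add: tensor_free_simps)
    then show ?case using zero tsums_closed by (simp add: tensor_free_simps)
  next
    case (one z)
    then obtain a b where z: "z = (a, b)" "a \<in> carrier B" "b \<in> carrier C" by blast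
    have q: "?q (frag_of z) = pure_tensor S B C a b" by (simp add: pure_tensor_def z)
    have "frag_of z \<in> carrier (tensor_free B C)" using z by (simp add: tensor_free_simps)
    then show ?case
      unfolding q neg[OF z(2,3)]
      using mult[OF one(2) z(2,3)] mult[OF one(2) B.B.inv_closed[OF z(2)] z(3)] by blast
  next
    case (diff c d)
    have cd: "c \<in> carrier (tensor_free B C)" "d \<in> carrier (tensor_free B C)"
      using diff.IH[OF diff.prems] by auto
    have V: "V \<in> carrier ?T" using tsums_closed diff.prems .
    have "?q c \<otimes>\<^bsub>?T\<^esub> (inv\<^bsub>?T\<^esub> (?q d) \<otimes>\<^bsub>?T\<^esub> V) \<in> tsums" "inv\<^bsub>?T\<^esub> (?q c) \<otimes>\<^bsub>?T\<^esub> (?q d \<otimes>\<^bsub>?T\<^esub> V) \<in> tsums"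
      using diff.IH diff.prems by blast+
    then show ?case
      unfolding tensor_free_diff[OF cd(2)] using cd V by (simp add: tensor.B.inv_mult tensor.B.m_ac)
  qed
  have "\<exists>c\<in>carrier (tensor_free B C). U = ?q c"
    using assms by (simp add: tensor_simps(1) FactGroup_def RCOSETS_def)
  then obtain c where c: "c \<in> carrier (tensor_free B C)" "U = ?q c" by blast
  then have "U \<otimes>\<^bsub>?T\<^esub> \<one>\<^bsub>?T\<^esub> \<in> tsums"
    unfolding c(2) using step[OF one, of c] unfolding tensor_free_simps(1) by blast
  then have "U \<in> tsums" using assms by simp
  then show ?thesis unfolding tsums_def using that by blast
qed

text \<open>By \<open>tensor_finite_sum\<close>, pure tensors generate additively. Equivariance of
  maps out of a tensor product is verified this way.\<close>

lemma tensor_hom_eqI: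
  assumes G: "comm_group G" and "f \<in> hom (tensor S B C) G" "g \<in> hom (tensor S B C) G"
    and "\<And>x y. \<lbrakk>x \<in> carrier B; y \<in> carrier C\<rbrakk> \<Longrightarrow>
      f (pure_tensor S B C x y) = g (pure_tensor S B C x y)"
    and U: "U \<in> carrier (tensor S B C)"
  shows "f U = g U"
proof -
  interpret G: comm_group G by fact
  obtain n :: nat and x y where *: "x \<in> {..<n} \<rightarrow> carrier B" "y \<in> {..<n} \<rightarrow> carrier C"
    "U = (\<Otimes>\<^bsub>tensor S B C\<^esub>i\<in>{..<n}. pure_tensor S B C (x i) (y i))"
    using tensor_finite_sum[OF U] by blast
  have p: "(\<lambda>i. pure_tensor S B C (x i) (y i)) \<in> {..<n} \<rightarrow> carrier (tensor S B C)"
    using * by (auto intro: pure_tensor_closed)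
  then show ?thesis
    unfolding *(3) hom_finprod[OF tensor.B.comm_group_axioms G assms(2) p]
      hom_finprod[OF tensor.B.comm_group_axioms G assms(3) p]
    by (intro G.finprod_cong') (use * assms(3,4) in \<open>auto simp: hom_def Pi_iff intro!: pure_tensor_closed\<close>)
qed

end

section \<open>Separable algebras\<close>

text \<open>Induction on \<open>I\<close>; if \<open>I\<close> is infinite, the outer product on the
  left and all inner ones on the right default to the unit.\<close>

lemma (in comm_monoid) finprod_swap:
  assumes "\<And>i j. i \<in> I \<Longrightarrow> j \<in> J \<Longrightarrow> f i j \<in> carrier G" "finite J"
  shows "(\<Otimes>i\<in>I. \<Otimes>j\<in>J. f i j) = (\<Otimes>j\<in>J. \<Otimes>i\<in>I. f i j)"
  using assms(1)
proof (induction I rule: infinite_finite_induct)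
  case (insert i I)
  have "(\<Otimes>i\<in>insert i I. \<Otimes>j\<in>J. f i j) = (\<Otimes>j\<in>J. f i j) \<otimes> (\<Otimes>j\<in>J. \<Otimes>i\<in>I. f i j)"
    using insert by (subst finprod_insert) auto
  also have "\<dots> = (\<Otimes>j\<in>J. f i j \<otimes> (\<Otimes>i\<in>I. f i j))"
    using insert.prems by (intro finprod_multf[symmetric]) auto
  also have "\<dots> = (\<Otimes>j\<in>J. \<Otimes>i\<in>insert i I. f i j)"
    using insert by (intro finprod_cong') auto
  finally show ?case .
qed auto

section \<open>The tensor square of an algebra over its base ring\<close>

context assoc_algebra
begin

lemma unit_map_closed: "k \<in> carrier K \<Longrightarrow> unit_map M k \<in> carrier M"
  by (simp add: unit_map_def)

lemma unit_map_mult: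
  assumes "k \<in> carrier K" "x \<in> carrier M"
  shows "unit_map M k \<otimes>\<^bsub>M\<^esub> x = k \<odot>\<^bsub>M\<^esub> x" "x \<otimes>\<^bsub>M\<^esub> unit_map M k = k \<odot>\<^bsub>M\<^esub> x"
  using assms by (simp_all add: unit_map_def smult_mult_left smult_mult_right)

lemma unit_map_ring_hom: "unit_map M \<in> ring_hom K M"
  by (rule ring_hom_memI)
    (auto simp: unit_map_def smult_l_distr smult_assoc1 smult_mult_left)

lemma bimodule_pair_algebra:
  "bimodule_pair M K M (restrict_bimod M (\<lambda>a. a) (unit_map M)) (restrict_bimod M (unit_map M) (\<lambda>a. a))"
  by (intro bimodule_pair.intro bimodule_restrict_bimod M.ring_axioms R.ring_axioms unit_map_ring_hom)
    (simp_all add: ring_hom_def)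

sublocale MM: bimodule_pair M K M "restrict_bimod M (\<lambda>a. a) (unit_map M)" "restrict_bimod M (unit_map M) (\<lambda>a. a)"
  rewrites "tensor K (restrict_bimod M (\<lambda>a. a) (unit_map M)) (restrict_bimod M (unit_map M) (\<lambda>a. a)) = algebra_tensor K M"
    and "pure_tensor K (restrict_bimod M (\<lambda>a. a) (unit_map M)) (restrict_bimod M (unit_map M) (\<lambda>a. a)) = algebra_pure_tensor K M"
  by (rule bimodule_pair_algebra) (simp_all add: algebra_tensor_def algebra_pure_tensor_def)

abbreviation "T \<equiv> algebra_tensor K M"
abbreviation "pt \<equiv> algebra_pure_tensor K M"

lemma pure_add_left: 
  assumes "f \<in> I \<rightarrow> carrier M" "y \<in> carrier M"
  shows "pt (\<Oplus>\<^bsub>M\<^esub>i\<in>I. f i) y = (\<Otimes>\<^bsub>T\<^esub>i\<in>I. pt (f i) y)"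
proof -
  have "(\<lambda>x. pt x y) \<in> hom (restrict_bimod M (\<lambda>a. a) (unit_map M)) T"
    using MM.pure_tensor_closed MM.pure_tensor_relations(1) assms(2) by (auto simp: hom_def)
  from hom_finprod[OF MM.B.B.comm_group_axioms MM.tensor.B.comm_group_axioms this, of f I] assms(1)
  show ?thesis by (simp add: finprod_restrict_bimod)
qed

lemma pure_add_right: 
  assumes "x \<in> carrier M" "f \<in> I \<rightarrow> carrier M"
  shows "pt x (\<Oplus>\<^bsub>M\<^esub>i\<in>I. f i) = (\<Otimes>\<^bsub>T\<^esub>i\<in>I. pt x (f i))"
proof -
  have "(\<lambda>y. pt x y) \<in> hom (restrict_bimod M (unit_map M) (\<lambda>a. a)) T"
    using MM.pure_tensor_closed MM.pure_tensor_relations(2) assms(1) by (auto simp: hom_def)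
  from hom_finprod[OF MM.C.B.comm_group_axioms MM.tensor.B.comm_group_axioms this, of f I] assms(2)
  show ?thesis by (simp add: finprod_restrict_bimod)
qed

text \<open>\<open>K\<close> acts on both factors through \<open>k \<mapsto> k 1\<close>, so
  balancing over \<open>K\<close> lets scalars cross the tensor sign.\<close>

lemma pure_smult:
  assumes "k \<in> carrier K" "x \<in> carrier M" "y \<in> carrier M"
  shows "pt x (k \<odot>\<^bsub>M\<^esub> y) = pt (k \<odot>\<^bsub>M\<^esub> x) y"
  using MM.pure_tensor_relations(3)[of x k y] assms by (simp add: unit_map_mult)

lemma lact_sum:
  assumes "c \<in> carrier M" "a \<in> I \<rightarrow> carrier M" "b \<in> I \<rightarrow> carrier M"
  shows "lact T c (\<Otimes>\<^bsub>T\<^esub>i\<in>I. pt (a i) (b i)) = (\<Otimes>\<^bsub>T\<^esub>i\<in>I. pt (c \<otimes>\<^bsub>M\<^esub> a i) (b i))"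
proof -
  have "lact T c (\<Otimes>\<^bsub>T\<^esub>i\<in>I. pt (a i) (b i)) = (\<Otimes>\<^bsub>T\<^esub>i\<in>I. lact T c (pt (a i) (b i)))"
    using assms by (intro hom_finprod MM.tensor.B.comm_group_axioms MM.tensor.lact_hom)
      (auto intro!: MM.pure_tensor_closed)
  also have "\<dots> = (\<Otimes>\<^bsub>T\<^esub>i\<in>I. pt (c \<otimes>\<^bsub>M\<^esub> a i) (b i))"
    using assms MM.lact_pure_tensor
    by (intro MM.tensor.B.finprod_cong') (auto intro!: MM.pure_tensor_closed simp: Pi_iff)
  finally show ?thesis .
qed

lemma ract_sum:
  assumes "c \<in> carrier M" "a \<in> I \<rightarrow> carrier M" "b \<in> I \<rightarrow> carrier M"
  shows "ract T (\<Otimes>\<^bsub>T\<^esub>i\<in>I. pt (a i) (b i)) c = (\<Otimes>\<^bsub>T\<^esub>i\<in>I. pt (a i) (b i \<otimes>\<^bsub>M\<^esub> c))"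
proof -
  have "ract T (\<Otimes>\<^bsub>T\<^esub>i\<in>I. pt (a i) (b i)) c = (\<Otimes>\<^bsub>T\<^esub>i\<in>I. ract T (pt (a i) (b i)) c)"
    using assms by (intro hom_finprod[where h = "\<lambda>U. ract T U c"] MM.tensor.B.comm_group_axioms MM.tensor.ract_hom)
      (auto intro!: MM.pure_tensor_closed)
  also have "\<dots> = (\<Otimes>\<^bsub>T\<^esub>i\<in>I. pt (a i) (b i \<otimes>\<^bsub>M\<^esub> c))"
    using assms MM.ract_pure_tensor
    by (intro MM.tensor.B.finprod_cong') (auto intro!: MM.pure_tensor_closed simp: Pi_iff)
  finally show ?thesis .
qed

lemma comm_group_add_monoid: "comm_group (add_monoid M)"
  by (rule M.a_comm_group)

section \<open>Casimir elements, separability and integrals\<close>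

text \<open>This is \<open>c e = e c\<close> for
  \<open>e = \<Sum>\<^sub>i a i \<otimes> b i\<close>. It is stated for a presentation of
  \<open>e\<close>, with the actions already evaluated, so that maps known on pure tensors apply
  termwise.\<close>

definition casimir :: "nat \<Rightarrow> (nat \<Rightarrow> 'm) \<Rightarrow> (nat \<Rightarrow> 'm) \<Rightarrow> bool"
  where "casimir n a b \<longleftrightarrow> a \<in> {..<n} \<rightarrow> carrier M \<and> b \<in> {..<n} \<rightarrow> carrier M \<and>
    (\<forall>c\<in>carrier M. (\<Otimes>\<^bsub>T\<^esub>i\<in>{..<n}. pt (c \<otimes>\<^bsub>M\<^esub> a i) (b i)) =
      (\<Otimes>\<^bsub>T\<^esub>i\<in>{..<n}. pt (a i) (b i \<otimes>\<^bsub>M\<^esub> c)))"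

text \<open>With \<open>e\<close> the given sum, \<open>c \<mapsto> c e\<close> is the section: it
  is left linear by construction, right linear because \<open>e\<close> commutes with every
  \<open>c\<close>, and \<open>\<mu> (c e) = c \<mu>(e) = c\<close>.\<close>

lemma separable_algebraI:
  assumes "casimir n a b" and one: "(\<Oplus>\<^bsub>M\<^esub>i\<in>{..<n}. a i \<otimes>\<^bsub>M\<^esub> b i) = \<one>\<^bsub>M\<^esub>"
  shows "separable_algebra K M"
proof -
  have a: "a \<in> {..<n} \<rightarrow> carrier M" and b: "b \<in> {..<n} \<rightarrow> carrier M"
    and cas: "\<And>c. c \<in> carrier M \<Longrightarrow> (\<Otimes>\<^bsub>T\<^esub>i\<in>{..<n}. pt (c \<otimes>\<^bsub>M\<^esub> a i) (b i)) =
      (\<Otimes>\<^bsub>T\<^esub>i\<in>{..<n}. pt (a i) (b i \<otimes>\<^bsub>M\<^esub> c))"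
    using assms(1) by (auto simp: casimir_def)
  \<comment> \<open>Multiplication descends to the tensor product; at the balancing relation this is
    associativity.\<close>
  obtain \<mu> where \<mu>: "\<mu> \<in> hom T (add_monoid M)"
    and \<mu>_pt: "\<And>x y. \<lbrakk>x \<in> carrier M; y \<in> carrier M\<rbrakk> \<Longrightarrow> \<mu> (pt x y) = x \<otimes>\<^bsub>M\<^esub> y"
  proof (rule MM.tensor_universal[of "add_monoid M" "\<lambda>x y. x \<otimes>\<^bsub>M\<^esub> y"])
    show "comm_group (add_monoid M)" by (rule comm_group_add_monoid)
  qed (auto simp: M.l_distr M.r_distr M.m_assoc unit_map_closed)
  have \<mu>_closed: "\<mu> U \<in> carrier M" if "U \<in> carrier T" for U
    using hom_in_carrier[OF \<mu> that] by simp
  have \<mu>_add: "\<mu> (U \<otimes>\<^bsub>T\<^esub> V) = \<mu> U \<oplus>\<^bsub>M\<^esub> \<mu> V" if "U \<in> carrier T" "V \<in> carrier T" for U V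
    using hom_mult[OF \<mu> that] by simp
  have \<mu>l: "\<mu> (lact T c U) = c \<otimes>\<^bsub>M\<^esub> \<mu> U" if c: "c \<in> carrier M" and U: "U \<in> carrier T" for c U
  proof (rule MM.tensor_hom_eqI[where f = "\<lambda>U. \<mu> (lact T c U)" and g = "\<lambda>U. c \<otimes>\<^bsub>M\<^esub> \<mu> U",
      OF comm_group_add_monoid _ _ _ U])
    show "(\<lambda>U. \<mu> (lact T c U)) \<in> hom T (add_monoid M)"
      using c by (auto simp: hom_def \<mu>_closed \<mu>_add MM.tensor.lact_closed MM.tensor.lact_add_right)
    show "(\<lambda>U. c \<otimes>\<^bsub>M\<^esub> \<mu> U) \<in> hom T (add_monoid M)"
      using c by (auto simp: hom_def \<mu>_closed \<mu>_add M.r_distr)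
  qed (use c MM.lact_pure_tensor in \<open>auto simp: \<mu>_pt M.m_assoc\<close>)
  have \<mu>r: "\<mu> (ract T U c) = \<mu> U \<otimes>\<^bsub>M\<^esub> c" if c: "c \<in> carrier M" and U: "U \<in> carrier T" for c U
  proof (rule MM.tensor_hom_eqI[where f = "\<lambda>U. \<mu> (ract T U c)" and g = "\<lambda>U. \<mu> U \<otimes>\<^bsub>M\<^esub> c",
      OF comm_group_add_monoid _ _ _ U])
    show "(\<lambda>U. \<mu> (ract T U c)) \<in> hom T (add_monoid M)"
      using c by (auto simp: hom_def \<mu>_closed \<mu>_add MM.tensor.ract_closed MM.tensor.ract_add_left)
    show "(\<lambda>U. \<mu> U \<otimes>\<^bsub>M\<^esub> c) \<in> hom T (add_monoid M)"
      using c by (auto simp: hom_def \<mu>_closed \<mu>_add M.l_distr)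
  qed (use c MM.ract_pure_tensor in \<open>auto simp: \<mu>_pt M.m_assoc\<close>)
  have \<mu>_hom: "\<mu> \<in> bimod_hom M M T (bimod_self M)"
    by (auto simp: bimod_hom_def hom_def \<mu>_closed \<mu>_add \<mu>l \<mu>r)
  define e where "e = (\<Otimes>\<^bsub>T\<^esub>i\<in>{..<n}. pt (a i) (b i))"
  have pt_closed: "(\<lambda>i. pt (a i) (b i)) \<in> {..<n} \<rightarrow> carrier T"
    using a b by (auto intro!: MM.pure_tensor_closed)
  have e: "e \<in> carrier T"
    unfolding e_def by (rule MM.tensor.B.finprod_closed[OF pt_closed])
  have "\<mu> e = (\<Oplus>\<^bsub>M\<^esub>i\<in>{..<n}. \<mu> (pt (a i) (b i)))"
    unfolding e_def hom_finprod[OF MM.tensor.B.comm_group_axioms comm_group_add_monoid \<mu> pt_closed]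
    by (simp add: finsum_def)
  also have "\<dots> = (\<Oplus>\<^bsub>M\<^esub>i\<in>{..<n}. a i \<otimes>\<^bsub>M\<^esub> b i)"
    using a b by (intro M.add.finprod_cong') (auto simp: Pi_iff \<mu>_pt)
  finally have \<mu>e: "\<mu> e = \<one>\<^bsub>M\<^esub>" using one by simp
  have swap: "lact T c e = ract T e c" if "c \<in> carrier M" for c
    unfolding e_def lact_sum[OF that a b] ract_sum[OF that a b] by (rule cas[OF that])
  \<comment> \<open>Here \<open>(c d) e = c (d e) = c (e d) = (c e) d\<close>, where
    \<open>swap\<close> gives the middle equality.\<close>
  have ract: "lact T (c \<otimes>\<^bsub>M\<^esub> d) e = ract T (lact T c e) d" if "c \<in> carrier M" "d \<in> carrier M" for c d
    unfolding MM.tensor.lact_mult[OF that e] swap[OF that(2)] MM.tensor.lact_ract[OF that(1) e that(2)] ..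
  have "(\<lambda>c. lact T c e) \<in> hom (bimod_self M) T"
    using e by (auto simp: hom_def MM.tensor.lact_closed MM.tensor.lact_add_left)
  then have "(\<lambda>c. lact T c e) \<in> bimod_hom M M (bimod_self M) T"
    unfolding bimod_hom_def using MM.tensor.lact_mult[OF _ _ e] ract by simp
  moreover have "\<mu> (lact T c e) = c" if "c \<in> carrier M" for c
    using that e by (simp add: \<mu>l \<mu>e)
  ultimately show ?thesis
    unfolding separable_algebra_def
    by (intro bexI[OF _ \<mu>_hom] conjI ballI bexI[of _ "\<lambda>c. lact T c e"] \<mu>_pt)
qed

text \<open>Take a presentation of \<open>\<sigma>(1)\<close>: acting by \<open>c\<close> from
  either side gives \<open>\<sigma>(c)\<close>, and \<open>\<mu>\<close> sends it back to
  \<open>1\<close>.\<close>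

lemma separable_algebraE:
  assumes "separable_algebra K M"
  obtains n a b where "casimir n a b" "(\<Oplus>\<^bsub>M\<^esub>i\<in>{..<n}. a i \<otimes>\<^bsub>M\<^esub> b i) = \<one>\<^bsub>M\<^esub>"
proof -
  obtain \<mu> \<sigma> where \<mu>: "\<mu> \<in> bimod_hom M M T (bimod_self M)"
    and \<mu>_pt: "\<And>x y. \<lbrakk>x \<in> carrier M; y \<in> carrier M\<rbrakk> \<Longrightarrow> \<mu> (pt x y) = x \<otimes>\<^bsub>M\<^esub> y"
    and \<sigma>: "\<sigma> \<in> bimod_hom M M (bimod_self M) T" and \<mu>\<sigma>: "\<And>c. c \<in> carrier M \<Longrightarrow> \<mu> (\<sigma> c) = c"
    using assms unfolding separable_algebra_def by blast
  have "\<sigma> \<one>\<^bsub>M\<^esub> \<in> carrier T" using \<sigma> by (auto simp: bimod_hom_def hom_def)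
  then obtain n :: nat and a b where a: "a \<in> {..<n} \<rightarrow> carrier M" and b: "b \<in> {..<n} \<rightarrow> carrier M"
    and e: "\<sigma> \<one>\<^bsub>M\<^esub> = (\<Otimes>\<^bsub>T\<^esub>i\<in>{..<n}. pt (a i) (b i))"
    by (rule MM.tensor_finite_sum) simp
  have lr: "\<sigma> (c \<otimes>\<^bsub>M\<^esub> x) = lact T c (\<sigma> x)" "\<sigma> (x \<otimes>\<^bsub>M\<^esub> c) = ract T (\<sigma> x) c"
    if "c \<in> carrier M" "x \<in> carrier M" for c x
    using \<sigma> that by (auto simp: bimod_hom_def)
  have "lact T c (\<sigma> \<one>\<^bsub>M\<^esub>) = ract T (\<sigma> \<one>\<^bsub>M\<^esub>) c" if "c \<in> carrier M" for c
    using lr[OF that M.one_closed] that by simp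
  then have "casimir n a b"
    unfolding casimir_def e using a b by (simp add: lact_sum ract_sum)
  moreover have "(\<Oplus>\<^bsub>M\<^esub>i\<in>{..<n}. a i \<otimes>\<^bsub>M\<^esub> b i) = \<one>\<^bsub>M\<^esub>"
  proof -
    have "\<mu> \<in> hom T (add_monoid M)" using \<mu> by (auto simp: bimod_hom_def hom_def)
    then have "\<mu> (\<Otimes>\<^bsub>T\<^esub>i\<in>{..<n}. pt (a i) (b i)) = (\<Oplus>\<^bsub>M\<^esub>i\<in>{..<n}. \<mu> (pt (a i) (b i)))"
      using a b
      by (subst hom_finprod[OF MM.tensor.B.comm_group_axioms comm_group_add_monoid])
        (auto simp: finsum_def intro!: MM.pure_tensor_closed)
    also have "\<dots> = (\<Oplus>\<^bsub>M\<^esub>i\<in>{..<n}. a i \<otimes>\<^bsub>M\<^esub> b i)"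
      using a b by (intro M.add.finprod_cong') (auto simp: Pi_iff \<mu>_pt)
    finally show ?thesis using \<mu>\<sigma>[OF M.one_closed] by (simp add: e)
  qed
  ultimately show ?thesis by (rule that)
qed

text \<open>Applying \<open>x \<otimes> y \<mapsto> \<epsilon>(y) x\<close> to the Casimir identity
  moves \<open>c\<close> from the left of \<open>a i\<close> into \<open>\<epsilon> (b i c)\<close>;
  multiplicativity then extracts the scalar \<open>\<epsilon>(c)\<close>.\<close>

lemma casimir_left_integral:
  assumes cas: "casimir n a b"
    and \<epsilon>: "\<epsilon> \<in> carrier M \<rightarrow> carrier K"
      "\<And>x y. \<lbrakk>x \<in> carrier M; y \<in> carrier M\<rbrakk> \<Longrightarrow> \<epsilon> (x \<oplus>\<^bsub>M\<^esub> y) = \<epsilon> x \<oplus>\<^bsub>K\<^esub> \<epsilon> y"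
      "\<And>k x. \<lbrakk>k \<in> carrier K; x \<in> carrier M\<rbrakk> \<Longrightarrow> \<epsilon> (k \<odot>\<^bsub>M\<^esub> x) = k \<otimes>\<^bsub>K\<^esub> \<epsilon> x"
      "\<And>x y. \<lbrakk>x \<in> carrier M; y \<in> carrier M\<rbrakk> \<Longrightarrow> \<epsilon> (x \<otimes>\<^bsub>M\<^esub> y) = \<epsilon> x \<otimes>\<^bsub>K\<^esub> \<epsilon> y"
    and c: "c \<in> carrier M"
  shows "c \<otimes>\<^bsub>M\<^esub> (\<Oplus>\<^bsub>M\<^esub>i\<in>{..<n}. \<epsilon> (b i) \<odot>\<^bsub>M\<^esub> a i) =
    \<epsilon> c \<odot>\<^bsub>M\<^esub> (\<Oplus>\<^bsub>M\<^esub>i\<in>{..<n}. \<epsilon> (b i) \<odot>\<^bsub>M\<^esub> a i)"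
proof -
  have a: "a \<in> {..<n} \<rightarrow> carrier M" and b: "b \<in> {..<n} \<rightarrow> carrier M"
    using cas by (auto simp: casimir_def)
  have \<epsilon>_closed [simp]: "\<epsilon> x \<in> carrier K" if "x \<in> carrier M" for x using \<epsilon>(1) that by auto
  have smult_left_comm: "k \<odot>\<^bsub>M\<^esub> (l \<odot>\<^bsub>M\<^esub> x) = l \<odot>\<^bsub>M\<^esub> (k \<odot>\<^bsub>M\<^esub> x)"
    if "k \<in> carrier K" "l \<in> carrier K" "x \<in> carrier M" for k l x
    using that by (simp add: smult_assoc1[symmetric] R.m_comm)
  \<comment> \<open>Linearity of \<open>\<epsilon>\<close> over \<open>K\<close> makes this map
    compatible with balancing.\<close>
  obtain H where H: "H \<in> hom T (add_monoid M)"
    and H_pt: "\<And>x y. \<lbrakk>x \<in> carrier M; y \<in> carrier M\<rbrakk> \<Longrightarrow> H (pt x y) = \<epsilon> y \<odot>\<^bsub>M\<^esub> x"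
  proof (rule MM.tensor_universal[of "add_monoid M" "\<lambda>x y. \<epsilon> y \<odot>\<^bsub>M\<^esub> x"])
    show "comm_group (add_monoid M)" by (rule comm_group_add_monoid)
  qed (auto simp: smult_l_distr smult_r_distr \<epsilon>(2-4) unit_map_mult smult_assoc1 smult_left_comm)
  have H_sum: "H (\<Otimes>\<^bsub>T\<^esub>i\<in>{..<n}. pt (f i) (g i)) = (\<Oplus>\<^bsub>M\<^esub>i\<in>{..<n}. \<epsilon> (g i) \<odot>\<^bsub>M\<^esub> f i)"
    if f: "f \<in> {..<n} \<rightarrow> carrier M" and g: "g \<in> {..<n} \<rightarrow> carrier M" for f g
  proof -
    have "H (\<Otimes>\<^bsub>T\<^esub>i\<in>{..<n}. pt (f i) (g i)) = (\<Oplus>\<^bsub>M\<^esub>i\<in>{..<n}. H (pt (f i) (g i)))"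
      using f g H
      by (subst hom_finprod[OF MM.tensor.B.comm_group_axioms comm_group_add_monoid])
        (auto simp: finsum_def intro!: MM.pure_tensor_closed)
    also have "\<dots> = (\<Oplus>\<^bsub>M\<^esub>i\<in>{..<n}. \<epsilon> (g i) \<odot>\<^bsub>M\<^esub> f i)"
      using f g by (intro M.add.finprod_cong') (auto simp: Pi_iff H_pt)
    finally show ?thesis .
  qed
  have "c \<otimes>\<^bsub>M\<^esub> (\<Oplus>\<^bsub>M\<^esub>i\<in>{..<n}. \<epsilon> (b i) \<odot>\<^bsub>M\<^esub> a i) = (\<Oplus>\<^bsub>M\<^esub>i\<in>{..<n}. \<epsilon> (b i) \<odot>\<^bsub>M\<^esub> (c \<otimes>\<^bsub>M\<^esub> a i))"
    using a b c
    by (subst M.finsum_rdistr) (auto intro!: M.add.finprod_cong' simp: smult_mult_right Pi_iff)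
  also have "\<dots> = (\<Oplus>\<^bsub>M\<^esub>i\<in>{..<n}. \<epsilon> (b i \<otimes>\<^bsub>M\<^esub> c) \<odot>\<^bsub>M\<^esub> a i)"
  proof -
    have ca: "(\<lambda>i. c \<otimes>\<^bsub>M\<^esub> a i) \<in> {..<n} \<rightarrow> carrier M" and bc: "(\<lambda>i. b i \<otimes>\<^bsub>M\<^esub> c) \<in> {..<n} \<rightarrow> carrier M"
      using a b c by auto
    have "(\<Otimes>\<^bsub>T\<^esub>i\<in>{..<n}. pt (c \<otimes>\<^bsub>M\<^esub> a i) (b i)) = (\<Otimes>\<^bsub>T\<^esub>i\<in>{..<n}. pt (a i) (b i \<otimes>\<^bsub>M\<^esub> c))"
      using cas c by (simp add: casimir_def)
    from arg_cong[OF this, of H] show ?thesis unfolding H_sum[OF ca b] H_sum[OF a bc] .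
  qed
  also have "\<dots> = (\<Oplus>\<^bsub>M\<^esub>i\<in>{..<n}. \<epsilon> c \<odot>\<^bsub>M\<^esub> (\<epsilon> (b i) \<odot>\<^bsub>M\<^esub> a i))"
    using a b c
    by (intro M.add.finprod_cong') (auto simp: \<epsilon>(4) Pi_iff smult_assoc1[symmetric] R.m_comm)
  also have "\<dots> = \<epsilon> c \<odot>\<^bsub>M\<^esub> (\<Oplus>\<^bsub>M\<^esub>i\<in>{..<n}. \<epsilon> (b i) \<odot>\<^bsub>M\<^esub> a i)"
    using a b c by (intro finsum_smult_ldistr[symmetric]) (auto simp: Pi_iff)
  finally show ?thesis .
qed

end

section \<open>Endomorphisms and depth two quasibases\<close>

context algebra_extension
begin

lemma iota_hom: "ring_hom_ring N M \<iota>"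
  by (intro ring_hom_ringI2 M.M.ring_axioms N.M.ring_axioms ring_hom)

lemma iota_closed [simp]: "a \<in> carrier N \<Longrightarrow> \<iota> a \<in> carrier M"
  using ring_hom by (rule ring_hom_closed)

lemma iota_one [simp]: "\<iota> \<one>\<^bsub>N\<^esub> = \<one>\<^bsub>M\<^esub>"
  using ring_hom by (rule ring_hom_one)

section \<open>The endomorphism algebra, evaluated pointwise\<close>

abbreviation A where "A \<equiv> bimod_End N M \<iota>"

sublocale A: assoc_algebra K A
  by (rule assoc_algebra_bimod_End)

lemma EndI:
  assumes "f \<in> extensional (carrier M)" "\<And>x. x \<in> carrier M \<Longrightarrow> f x \<in> carrier M"
    "\<And>x y. \<lbrakk>x \<in> carrier M; y \<in> carrier M\<rbrakk> \<Longrightarrow> f (x \<oplus>\<^bsub>M\<^esub> y) = f x \<oplus>\<^bsub>M\<^esub> f y"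
    "\<And>a x. \<lbrakk>a \<in> carrier N; x \<in> carrier M\<rbrakk> \<Longrightarrow> f (\<iota> a \<otimes>\<^bsub>M\<^esub> x) = \<iota> a \<otimes>\<^bsub>M\<^esub> f x"
    "\<And>a x. \<lbrakk>a \<in> carrier N; x \<in> carrier M\<rbrakk> \<Longrightarrow> f (x \<otimes>\<^bsub>M\<^esub> \<iota> a) = f x \<otimes>\<^bsub>M\<^esub> \<iota> a"
  shows "f \<in> carrier A"
  using assms by (simp add: bimod_End_def bimod_hom_def hom_def)

lemma End_simps:
  assumes "f \<in> carrier A"
  shows "x \<in> carrier M \<Longrightarrow> f x \<in> carrier M"
    "\<lbrakk>x \<in> carrier M; y \<in> carrier M\<rbrakk> \<Longrightarrow> f (x \<oplus>\<^bsub>M\<^esub> y) = f x \<oplus>\<^bsub>M\<^esub> f y"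
    "\<lbrakk>a \<in> carrier N; x \<in> carrier M\<rbrakk> \<Longrightarrow> f (\<iota> a \<otimes>\<^bsub>M\<^esub> x) = \<iota> a \<otimes>\<^bsub>M\<^esub> f x"
    "\<lbrakk>a \<in> carrier N; x \<in> carrier M\<rbrakk> \<Longrightarrow> f (x \<otimes>\<^bsub>M\<^esub> \<iota> a) = f x \<otimes>\<^bsub>M\<^esub> \<iota> a"
  using assms by (auto simp: bimod_End_def bimod_hom_def hom_def)

lemma End_eqI:
  assumes "f \<in> carrier A" "g \<in> carrier A" "\<And>x. x \<in> carrier M \<Longrightarrow> f x = g x"
  shows "f = g"
  using assms by (auto simp: bimod_End_def intro: extensionalityI)

lemma End_eval:
  assumes "x \<in> carrier M"
  shows "(f \<oplus>\<^bsub>A\<^esub> g) x = f x \<oplus>\<^bsub>M\<^esub> g x" "(f \<otimes>\<^bsub>A\<^esub> g) x = f (g x)"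
    "(k \<odot>\<^bsub>A\<^esub> f) x = k \<odot>\<^bsub>M\<^esub> f x" "\<zero>\<^bsub>A\<^esub> x = \<zero>\<^bsub>M\<^esub>" "\<one>\<^bsub>A\<^esub> x = x"
  using assms by (auto simp: bimod_End_def compose_def)

lemma End_eval_sum:
  assumes "f \<in> I \<rightarrow> carrier A" "x \<in> carrier M"
  shows "(\<Oplus>\<^bsub>A\<^esub>i\<in>I. f i) x = (\<Oplus>\<^bsub>M\<^esub>i\<in>I. f i x)"
  using assms(1)
proof (induction I rule: infinite_finite_induct)
  case (insert i I)
  then have "f i \<in> carrier A" "f \<in> I \<rightarrow> carrier A" by auto
  then show ?case
    using insert assms(2) by (simp add: Pi_iff End_eval End_simps(1))
qed (simp_all add: End_eval assms)

lemma End_sum: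
  assumes f: "f \<in> carrier A" and g: "g \<in> I \<rightarrow> carrier M"
  shows "f (\<Oplus>\<^bsub>M\<^esub>i\<in>I. g i) = (\<Oplus>\<^bsub>M\<^esub>i\<in>I. f (g i))"
proof -
  have "f \<in> hom (add_monoid M) (add_monoid M)"
    using f by (auto simp: hom_def End_simps)
  from hom_finprod[OF M.comm_group_add_monoid M.comm_group_add_monoid this] g
  show ?thesis by (simp add: finsum_def)
qed

text \<open>Scalars act through \<open>N\<close>: \<open>k x\<close> is the product of
  \<open>\<iota> (k 1)\<close> and \<open>x\<close>, so left linearity over \<open>N\<close>
  applies.\<close>

lemma End_smult:
  assumes "f \<in> carrier A" "k \<in> carrier K" "x \<in> carrier M"
  shows "f (k \<odot>\<^bsub>M\<^esub> x) = k \<odot>\<^bsub>M\<^esub> f x"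
proof -
  have "k \<odot>\<^bsub>M\<^esub> y = \<iota> (k \<odot>\<^bsub>N\<^esub> \<one>\<^bsub>N\<^esub>) \<otimes>\<^bsub>M\<^esub> y" if "y \<in> carrier M" for y
    using that assms(2) by (simp add: smult_hom M.smult_mult_left)
  then show ?thesis using assms by (simp add: End_simps)
qed

section \<open>Balanced maps and quasibases\<close>

text \<open>These are the maps on pairs that factor through \<open>M \<otimes>\<^sub>N M\<close>,
  with values in \<open>M\<close>. Once tensor identities are expressed through them, computations
  take place in \<open>M\<close> instead of among cosets.\<close>

definition balanced :: "('m \<Rightarrow> 'm \<Rightarrow> 'm) \<Rightarrow> bool"
  where "balanced h \<longleftrightarrow>
    (\<forall>x\<in>carrier M. \<forall>y\<in>carrier M. h x y \<in> carrier M) \<and>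
    (\<forall>x\<in>carrier M. \<forall>x'\<in>carrier M. \<forall>y\<in>carrier M. h (x \<oplus>\<^bsub>M\<^esub> x') y = h x y \<oplus>\<^bsub>M\<^esub> h x' y) \<and>
    (\<forall>x\<in>carrier M. \<forall>y\<in>carrier M. \<forall>y'\<in>carrier M. h x (y \<oplus>\<^bsub>M\<^esub> y') = h x y \<oplus>\<^bsub>M\<^esub> h x y') \<and>
    (\<forall>x\<in>carrier M. \<forall>a\<in>carrier N. \<forall>y\<in>carrier M. h (x \<otimes>\<^bsub>M\<^esub> \<iota> a) y = h x (\<iota> a \<otimes>\<^bsub>M\<^esub> y))"

lemma balanced_closed: "\<lbrakk>balanced h; x \<in> carrier M; y \<in> carrier M\<rbrakk> \<Longrightarrow> h x y \<in> carrier M"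
  by (simp add: balanced_def)

lemma balanced_End_left:
  assumes "f \<in> carrier A"
  shows "balanced (\<lambda>x y. f x \<otimes>\<^bsub>M\<^esub> y)"
  using assms
  by (auto simp: balanced_def End_simps M.M.l_distr M.M.r_distr M.M.m_assoc)

text \<open>The hypotheses fit maps such as \<open>y \<mapsto> F (y m)\<close>, which are left
  linear over \<open>N\<close> but in general not right linear.\<close>

lemma balanced_right:
  assumes "\<And>x. x \<in> carrier M \<Longrightarrow> f x \<in> carrier M"
    "\<And>x y. \<lbrakk>x \<in> carrier M; y \<in> carrier M\<rbrakk> \<Longrightarrow> f (x \<oplus>\<^bsub>M\<^esub> y) = f x \<oplus>\<^bsub>M\<^esub> f y"
    "\<And>a x. \<lbrakk>a \<in> carrier N; x \<in> carrier M\<rbrakk> \<Longrightarrow> f (\<iota> a \<otimes>\<^bsub>M\<^esub> x) = \<iota> a \<otimes>\<^bsub>M\<^esub> f x"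
  shows "balanced (\<lambda>x y. x \<otimes>\<^bsub>M\<^esub> f y)"
  using assms by (auto simp: balanced_def M.M.l_distr M.M.r_distr M.M.m_assoc)

text \<open>
  A quasibasis consists of central elements \<open>t\<^sub>i = \<Sum>\<^sub>l p i l \<otimes> q i l\<close> of \<open>M \<otimes>\<^sub>N M\<close> and
  endomorphisms \<open>\<beta> i\<close> with \<open>m \<otimes> m' = \<Sum>\<^sub>i t\<^sub>i \<beta>\<^sub>i(m) m'\<close>; both properties are stated after
  applying an arbitrary balanced map.
\<close>

definition quasibasis ::
  "nat \<Rightarrow> (nat \<Rightarrow> nat) \<Rightarrow> (nat \<Rightarrow> nat \<Rightarrow> 'm) \<Rightarrow> (nat \<Rightarrow> nat \<Rightarrow> 'm) \<Rightarrow> (nat \<Rightarrow> 'm \<Rightarrow> 'm) \<Rightarrow> bool"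
  where "quasibasis r s p q \<beta> \<longleftrightarrow>
    (\<forall>i<r. \<beta> i \<in> carrier A) \<and>
    (\<forall>i<r. \<forall>l<s i. p i l \<in> carrier M \<and> q i l \<in> carrier M) \<and>
    (\<forall>h. balanced h \<longrightarrow> (\<forall>i<r. \<forall>a\<in>carrier N.
      (\<Oplus>\<^bsub>M\<^esub>l\<in>{..<s i}. h (\<iota> a \<otimes>\<^bsub>M\<^esub> p i l) (q i l)) = (\<Oplus>\<^bsub>M\<^esub>l\<in>{..<s i}. h (p i l) (q i l \<otimes>\<^bsub>M\<^esub> \<iota> a)))) \<and>
    (\<forall>h. balanced h \<longrightarrow> (\<forall>x\<in>carrier M. \<forall>y\<in>carrier M.
      (\<Oplus>\<^bsub>M\<^esub>i\<in>{..<r}. \<Oplus>\<^bsub>M\<^esub>l\<in>{..<s i}. h (p i l) (q i l \<otimes>\<^bsub>M\<^esub> (\<beta> i x \<otimes>\<^bsub>M\<^esub> y))) = h x y))"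

text \<open>A retraction \<open>g\<close> of \<open>f\<close> factors the identity of
  \<open>M \<otimes>\<^sub>N M\<close> through \<open>M\<^sup>r\<close>. By right linearity over
  \<open>M\<close>, \<open>f\<close> is given by
  \<open>\<beta>\<^sub>i(x) = f(x \<otimes> 1)\<^sub>i\<close> and \<open>g\<close> by the images
  \<open>t\<^sub>i\<close> of the unit vectors; then
  \<open>x \<otimes> y = g(f(x \<otimes> y))\<close> is the sum of the
  \<open>t\<^sub>i \<beta>\<^sub>i(x) y\<close>.\<close>

lemma depth_two_quasibasis:
  assumes "depth_two N M \<iota>"
  obtains r s p q \<beta> where "quasibasis r s p q \<beta>"
proof -
  let ?B = "bimod_NN M \<iota>" and ?C = "bimod_NM M \<iota>"
  interpret BC: bimodule_pair N N M ?B ?C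
    by (intro bimodule_pair.intro bimodule_restrict_bimod M.M.ring_axioms N.M.ring_axioms ring_hom)
      (simp add: ring_hom_def)
  let ?T = "tensor N ?B ?C" and ?pt = "pure_tensor N ?B ?C"
  obtain r where "iso_direct_summand N M ?T (power_bimod r ?C)"
    using assms by (auto simp: depth_two_def)
  let ?V = "power_bimod r ?C" and ?e = "single_bimod r ?C"
  interpret V: bimodule N M ?V
    by (rule bimodule_power_bimod[OF BC.C.bimodule_axioms])
  obtain f g where f: "f \<in> bimod_hom N M ?T ?V" and g: "g \<in> bimod_hom N M ?V ?T"
    and gf: "\<And>U. U \<in> carrier ?T \<Longrightarrow> g (f U) = U"
    using V.iso_direct_summand_retraction[OF BC.tensor.bimodule_axioms \<open>iso_direct_summand N M ?T ?V\<close>]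
    by blast
  have f_closed: "f U \<in> carrier ?V" if "U \<in> carrier ?T" for U
    using f that by (auto simp: bimod_hom_def hom_def)
  have fi_closed: "f U i \<in> carrier M" if "U \<in> carrier ?T" "i < r" for U i
    using f_closed[OF that(1)] that(2) by (auto simp: power_bimod_simps(1))
  have f_add: "f (U \<otimes>\<^bsub>?T\<^esub> W) i = f U i \<oplus>\<^bsub>M\<^esub> f W i"
    if "U \<in> carrier ?T" "W \<in> carrier ?T" "i < r" for U W i
    using f that by (auto simp: bimod_hom_def hom_def power_bimod_simps(2))
  have f_lact: "f (lact ?T a U) i = \<iota> a \<otimes>\<^bsub>M\<^esub> f U i" if "a \<in> carrier N" "U \<in> carrier ?T" "i < r" for a U i
    using f that by (auto simp: bimod_hom_def power_bimod_simps(4))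
  have f_ract: "f (ract ?T U x) i = f U i \<otimes>\<^bsub>M\<^esub> x" if "x \<in> carrier M" "U \<in> carrier ?T" "i < r" for x U i
    using f that by (auto simp: bimod_hom_def power_bimod_simps(5))
  have pt: "?pt x y \<in> carrier ?T" if "x \<in> carrier M" "y \<in> carrier M" for x y
    using BC.pure_tensor_closed that by simp
  define \<beta> where "\<beta> i = (\<lambda>x\<in>carrier M. f (?pt x \<one>\<^bsub>M\<^esub>) i)" for i
  have f_pt: "f (?pt x y) i = \<beta> i x \<otimes>\<^bsub>M\<^esub> y" if "x \<in> carrier M" "y \<in> carrier M" "i < r" for x y i
  proof -
    have "?pt x y = ract ?T (?pt x \<one>\<^bsub>M\<^esub>) y"
      using BC.ract_pure_tensor[of x "\<one>\<^bsub>M\<^esub>" y] that by simp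
    then show ?thesis using that by (simp add: f_ract pt \<beta>_def)
  qed
  have \<beta>: "\<beta> i \<in> carrier A" if i: "i < r" for i
  proof (rule EndI)
    fix x y assume xy: "x \<in> carrier M" "y \<in> carrier M"
    show "\<beta> i x \<in> carrier M" using xy i by (simp add: \<beta>_def fi_closed pt)
    show "\<beta> i (x \<oplus>\<^bsub>M\<^esub> y) = \<beta> i x \<oplus>\<^bsub>M\<^esub> \<beta> i y"
      using xy i BC.pure_tensor_relations(1)[of x y "\<one>\<^bsub>M\<^esub>"] by (simp add: \<beta>_def f_add pt)
  next
    fix a x assume ax: "a \<in> carrier N" "x \<in> carrier M"
    show "\<beta> i (\<iota> a \<otimes>\<^bsub>M\<^esub> x) = \<iota> a \<otimes>\<^bsub>M\<^esub> \<beta> i x"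
      using ax i BC.lact_pure_tensor[of a x "\<one>\<^bsub>M\<^esub>"] f_lact[of a "?pt x \<one>\<^bsub>M\<^esub>" i]
      by (simp add: \<beta>_def pt)
    \<comment> \<open>Right linearity over \<open>N\<close> comes from balancing:
      \<open>x \<iota>(a) \<otimes> 1 = x \<otimes> \<iota>(a)\<close>.\<close>
    show "\<beta> i (x \<otimes>\<^bsub>M\<^esub> \<iota> a) = \<beta> i x \<otimes>\<^bsub>M\<^esub> \<iota> a"
      using ax i BC.pure_tensor_relations(3)[of x a "\<one>\<^bsub>M\<^esub>"] f_pt[of x "\<iota> a" i]
      by (simp add: \<beta>_def)
  qed (simp add: \<beta>_def)
  have \<beta>_closed: "\<beta> i x \<in> carrier M" if "i < r" "x \<in> carrier M" for i x
    using End_simps(1)[OF \<beta>[OF that(1)] that(2)] .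
  have e_closed: "?e i x \<in> carrier ?V" if "x \<in> carrier M" for i x
    using that by (auto simp: single_bimod_def power_bimod_simps(1))
  have e_lact: "lact ?V a (?e i x) = ?e i (\<iota> a \<otimes>\<^bsub>M\<^esub> x)" if "a \<in> carrier N" "x \<in> carrier M" for a i x
    using that by (auto simp: single_bimod_def power_bimod_simps(4) restrict_def fun_eq_iff)
  have e_ract: "ract ?V (?e i x) y = ?e i (x \<otimes>\<^bsub>M\<^esub> y)" if "x \<in> carrier M" "y \<in> carrier M" for i x y
    using that by (auto simp: single_bimod_def power_bimod_simps(5) restrict_def fun_eq_iff)
  have g_lact: "g (lact ?V a v) = lact ?T a (g v)" if "a \<in> carrier N" "v \<in> carrier ?V" for a v
    using g that by (auto simp: bimod_hom_def)
  have g_ract: "g (ract ?V v x) = ract ?T (g v) x" if "x \<in> carrier M" "v \<in> carrier ?V" for x v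
    using g that by (auto simp: bimod_hom_def)
  have g_hom: "g \<in> hom ?V ?T" using g by (simp add: bimod_hom_def)
  \<comment> \<open>For \<open>i \<ge> r\<close> the vector \<open>?e i 1\<close> is neutral, so
    \<open>t i\<close> makes sense for every \<open>i\<close>.\<close>
  define t where "t i = g (?e i \<one>\<^bsub>M\<^esub>)" for i
  have t: "t i \<in> carrier ?T" for i
    unfolding t_def using hom_in_carrier[OF g_hom e_closed] by simp
  \<comment> \<open>Acting by \<open>a\<close> on the left and by \<open>\<iota> a\<close> on the
    right turns \<open>?e i 1\<close> into the same vector \<open>?e i (\<iota> a)\<close>;
    \<open>g\<close> respects both actions.\<close>
  have t_central: "lact ?T a (t i) = ract ?T (t i) (\<iota> a)" if "a \<in> carrier N" for a i
    using that e_lact[OF that, of "\<one>\<^bsub>M\<^esub>" i] e_ract[of "\<one>\<^bsub>M\<^esub>" "\<iota> a" i]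
      g_lact[OF that e_closed[of "\<one>\<^bsub>M\<^esub>" i]] g_ract[OF iota_closed[OF that] e_closed[of "\<one>\<^bsub>M\<^esub>" i]]
    by (simp add: t_def)
  have t_basis: "?pt x y = (\<Otimes>\<^bsub>?T\<^esub>i\<in>{..<r}. ract ?T (t i) (\<beta> i x \<otimes>\<^bsub>M\<^esub> y))"
    if xy: "x \<in> carrier M" "y \<in> carrier M" for x y
  proof -
    have "?pt x y = g (f (?pt x y))" using gf pt[OF xy] by simp
    also have "f (?pt x y) = finprod ?V (\<lambda>i. ?e i (f (?pt x y) i)) {..<r}"
      by (rule power_bimod_decompose[OF BC.C.bimodule_axioms f_closed[OF pt[OF xy]]])
    also have "g \<dots> = (\<Otimes>\<^bsub>?T\<^esub>i\<in>{..<r}. g (?e i (f (?pt x y) i)))"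
      by (rule hom_finprod[OF V.B.comm_group_axioms BC.tensor.B.comm_group_axioms g_hom])
        (use xy in \<open>auto intro!: e_closed fi_closed pt\<close>)
    also have "\<dots> = (\<Otimes>\<^bsub>?T\<^esub>i\<in>{..<r}. ract ?T (t i) (\<beta> i x \<otimes>\<^bsub>M\<^esub> y))"
    proof (intro BC.tensor.B.finprod_cong' refl)
      fix i assume i: "i \<in> {..<r}"
      then have m: "\<beta> i x \<otimes>\<^bsub>M\<^esub> y \<in> carrier M" using xy by (simp add: \<beta>_closed)
      \<comment> \<open>The inserted factor \<open>1\<close> displays the coordinate vector as a
        unit vector acted on from the right.\<close>
      have "g (?e i (f (?pt x y) i)) = g (?e i (\<one>\<^bsub>M\<^esub> \<otimes>\<^bsub>M\<^esub> (\<beta> i x \<otimes>\<^bsub>M\<^esub> y)))"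
        using f_pt[OF xy] i m by simp
      also have "\<dots> = ract ?T (t i) (\<beta> i x \<otimes>\<^bsub>M\<^esub> y)"
        unfolding t_def using m
        by (simp only: e_ract[symmetric] g_ract e_closed M.M.one_closed)
      finally show "g (?e i (f (?pt x y) i)) = ract ?T (t i) (\<beta> i x \<otimes>\<^bsub>M\<^esub> y)" .
    qed (use xy t in \<open>auto intro!: BC.tensor.ract_closed simp: \<beta>_closed\<close>)
    finally show ?thesis .
  qed
  \<comment> \<open>Bundling the conditions on a presentation of \<open>t i\<close> allows
    \<open>s\<close>, \<open>p\<close> and \<open>q\<close> to be chosen for all \<open>i\<close> at
    once.\<close>
  define good where "good i s p q \<longleftrightarrow> p \<in> {..<s::nat} \<rightarrow> carrier M \<and> q \<in> {..<s} \<rightarrow> carrier M \<and>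
    t i = (\<Otimes>\<^bsub>?T\<^esub>l\<in>{..<s}. ?pt (p l) (q l))" for i s p q
  have "\<exists>s p q. good i s p q" for i
  proof (rule BC.tensor_finite_sum[OF t[of i]])
    fix n :: nat and x y
    assume "x \<in> {..<n} \<rightarrow> carrier ?B" "y \<in> {..<n} \<rightarrow> carrier ?C"
      "t i = (\<Otimes>\<^bsub>?T\<^esub>l\<in>{..<n}. ?pt (x l) (y l))"
    then have "good i n x y" unfolding good_def by simp
    then show ?thesis by blast
  qed
  then obtain s p q where good: "\<And>i. good i (s i) (p i) (q i)" by metis
  then have pq: "\<And>i. p i \<in> {..<s i} \<rightarrow> carrier M" "\<And>i. q i \<in> {..<s i} \<rightarrow> carrier M"
    and t_sum: "\<And>i. t i = (\<Otimes>\<^bsub>?T\<^esub>l\<in>{..<s i}. ?pt (p i l) (q i l))"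
    by (simp_all only: good_def)
  have p: "p i l \<in> carrier M" and q: "q i l \<in> carrier M" if "l < s i" for i l
    using pq that by auto
  have lact_t: "lact ?T a (t i) = (\<Otimes>\<^bsub>?T\<^esub>l\<in>{..<s i}. ?pt (\<iota> a \<otimes>\<^bsub>M\<^esub> p i l) (q i l))"
    if "a \<in> carrier N" for a i
  proof -
    have "lact ?T a (t i) = (\<Otimes>\<^bsub>?T\<^esub>l\<in>{..<s i}. lact ?T a (?pt (p i l) (q i l)))"
      unfolding t_sum
      by (intro hom_finprod BC.tensor.B.comm_group_axioms BC.tensor.lact_hom that)
        (auto intro!: pt p q)
    also have "\<dots> = (\<Otimes>\<^bsub>?T\<^esub>l\<in>{..<s i}. ?pt (\<iota> a \<otimes>\<^bsub>M\<^esub> p i l) (q i l))"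
      using BC.lact_pure_tensor[of a] that p q
      by (intro BC.tensor.B.finprod_cong') (auto intro!: pt)
    finally show ?thesis .
  qed
  have ract_t: "ract ?T (t i) x = (\<Otimes>\<^bsub>?T\<^esub>l\<in>{..<s i}. ?pt (p i l) (q i l \<otimes>\<^bsub>M\<^esub> x))"
    if "x \<in> carrier M" for x i
  proof -
    have "ract ?T (t i) x = (\<Otimes>\<^bsub>?T\<^esub>l\<in>{..<s i}. ract ?T (?pt (p i l) (q i l)) x)"
      unfolding t_sum
      by (intro hom_finprod[where h = "\<lambda>U. ract ?T U x"] BC.tensor.B.comm_group_axioms
          BC.tensor.ract_hom that) (auto intro!: pt p q)
    also have "\<dots> = (\<Otimes>\<^bsub>?T\<^esub>l\<in>{..<s i}. ?pt (p i l) (q i l \<otimes>\<^bsub>M\<^esub> x))"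
      using BC.ract_pure_tensor[of _ _ x] that p q
      by (intro BC.tensor.B.finprod_cong') (auto intro!: pt)
    finally show ?thesis .
  qed
  \<comment> \<open>Through the universal property each balanced \<open>h\<close> can be applied to
    \<open>t_central\<close> and \<open>t_basis\<close>, which become the two identities of a
    quasibasis.\<close>
  have induced: "\<exists>H. H \<in> hom ?T (add_monoid M) \<and>
      (\<forall>x\<in>carrier M. \<forall>y\<in>carrier M. H (?pt x y) = h x y)" if h: "balanced h" for h
  proof -
    obtain H where "H \<in> hom ?T (add_monoid M)"
      "\<And>x y. \<lbrakk>x \<in> carrier M; y \<in> carrier M\<rbrakk> \<Longrightarrow> H (?pt x y) = h x y"
    proof (rule BC.tensor_universal[of "add_monoid M" h])
      show "comm_group (add_monoid M)" by (rule M.comm_group_add_monoid)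
    qed (use h in \<open>auto simp: balanced_def\<close>)
    then show ?thesis by blast
  qed
  have H_sum: "H (\<Otimes>\<^bsub>?T\<^esub>l\<in>{..<n}. ?pt (x l) (y l)) = (\<Oplus>\<^bsub>M\<^esub>l\<in>{..<n}. h (x l) (y l))"
    if H: "H \<in> hom ?T (add_monoid M)" "\<forall>x\<in>carrier M. \<forall>y\<in>carrier M. H (?pt x y) = h x y"
      and h: "balanced h" and xy: "\<And>l. l < n \<Longrightarrow> x l \<in> carrier M" "\<And>l. l < n \<Longrightarrow> y l \<in> carrier M"
    for H h x y and n :: nat
  proof -
    have "H (\<Otimes>\<^bsub>?T\<^esub>l\<in>{..<n}. ?pt (x l) (y l)) = (\<Oplus>\<^bsub>M\<^esub>l\<in>{..<n}. H (?pt (x l) (y l)))"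
      unfolding finsum_def
      by (intro hom_finprod BC.tensor.B.comm_group_axioms M.comm_group_add_monoid H)
        (auto intro!: pt xy)
    also have "\<dots> = (\<Oplus>\<^bsub>M\<^esub>l\<in>{..<n}. h (x l) (y l))"
      using H(2) h xy by (intro M.add.finprod_cong') (auto simp: balanced_closed)
    finally show ?thesis .
  qed
  have central: "(\<Oplus>\<^bsub>M\<^esub>l\<in>{..<s i}. h (\<iota> a \<otimes>\<^bsub>M\<^esub> p i l) (q i l)) = (\<Oplus>\<^bsub>M\<^esub>l\<in>{..<s i}. h (p i l) (q i l \<otimes>\<^bsub>M\<^esub> \<iota> a))"
    if h: "balanced h" and a: "a \<in> carrier N" for h i a
  proof -
    obtain H where H: "H \<in> hom ?T (add_monoid M)" "\<forall>x\<in>carrier M. \<forall>y\<in>carrier M. H (?pt x y) = h x y"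
      using induced[OF h] by blast
    have "H (lact ?T a (t i)) = (\<Oplus>\<^bsub>M\<^esub>l\<in>{..<s i}. h (\<iota> a \<otimes>\<^bsub>M\<^esub> p i l) (q i l))"
      unfolding lact_t[OF a] by (rule H_sum[OF H h]) (use a p q in auto)
    moreover have "H (ract ?T (t i) (\<iota> a)) = (\<Oplus>\<^bsub>M\<^esub>l\<in>{..<s i}. h (p i l) (q i l \<otimes>\<^bsub>M\<^esub> \<iota> a))"
      unfolding ract_t[OF iota_closed[OF a]] by (rule H_sum[OF H h]) (use a p q in auto)
    ultimately show ?thesis by (simp only: t_central[OF a])
  qed
  have basis: "(\<Oplus>\<^bsub>M\<^esub>i\<in>{..<r}. \<Oplus>\<^bsub>M\<^esub>l\<in>{..<s i}. h (p i l) (q i l \<otimes>\<^bsub>M\<^esub> (\<beta> i x \<otimes>\<^bsub>M\<^esub> y))) = h x y"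
    if h: "balanced h" and xy: "x \<in> carrier M" "y \<in> carrier M" for h x y
  proof -
    obtain H where H: "H \<in> hom ?T (add_monoid M)" "\<forall>x\<in>carrier M. \<forall>y\<in>carrier M. H (?pt x y) = h x y"
      using induced[OF h] by blast
    have "h x y = H (?pt x y)" using H(2) xy by simp
    also have "\<dots> = (\<Oplus>\<^bsub>M\<^esub>i\<in>{..<r}. H (ract ?T (t i) (\<beta> i x \<otimes>\<^bsub>M\<^esub> y)))"
      unfolding t_basis[OF xy] finsum_def
      by (intro hom_finprod BC.tensor.B.comm_group_axioms M.comm_group_add_monoid H)
        (use xy t in \<open>auto intro!: BC.tensor.ract_closed simp: \<beta>_closed\<close>)
    also have "\<dots> = (\<Oplus>\<^bsub>M\<^esub>i\<in>{..<r}. \<Oplus>\<^bsub>M\<^esub>l\<in>{..<s i}. h (p i l) (q i l \<otimes>\<^bsub>M\<^esub> (\<beta> i x \<otimes>\<^bsub>M\<^esub> y)))"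
    proof (intro M.add.finprod_cong' refl)
      fix i assume "i \<in> {..<r}"
      then have m: "\<beta> i x \<otimes>\<^bsub>M\<^esub> y \<in> carrier M" using xy by (simp add: \<beta>_closed)
      show "H (ract ?T (t i) (\<beta> i x \<otimes>\<^bsub>M\<^esub> y)) =
          (\<Oplus>\<^bsub>M\<^esub>l\<in>{..<s i}. h (p i l) (q i l \<otimes>\<^bsub>M\<^esub> (\<beta> i x \<otimes>\<^bsub>M\<^esub> y)))"
        unfolding ract_t[OF m] by (rule H_sum[OF H h]) (use m p q in auto)
    qed (use xy p q in \<open>auto intro!: M.M.finsum_closed balanced_closed[OF h] simp: \<beta>_closed\<close>)
    finally show ?thesis ..
  qed
  have "quasibasis r s p q \<beta>"
    unfolding quasibasis_def by (intro conjI allI impI ballI \<beta> p q central basis)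
  then show ?thesis by (rule that)
qed

lemma quasibasisD:
  assumes "quasibasis r s p q \<beta>"
  shows "i < r \<Longrightarrow> \<beta> i \<in> carrier A"
    "\<lbrakk>i < r; l < s i\<rbrakk> \<Longrightarrow> p i l \<in> carrier M"
    "\<lbrakk>i < r; l < s i\<rbrakk> \<Longrightarrow> q i l \<in> carrier M"
    "\<lbrakk>balanced h; i < r; a \<in> carrier N\<rbrakk> \<Longrightarrow>
      (\<Oplus>\<^bsub>M\<^esub>l\<in>{..<s i}. h (\<iota> a \<otimes>\<^bsub>M\<^esub> p i l) (q i l)) = (\<Oplus>\<^bsub>M\<^esub>l\<in>{..<s i}. h (p i l) (q i l \<otimes>\<^bsub>M\<^esub> \<iota> a))"
    "\<lbrakk>balanced h; x \<in> carrier M; y \<in> carrier M\<rbrakk> \<Longrightarrow>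
      (\<Oplus>\<^bsub>M\<^esub>i\<in>{..<r}. \<Oplus>\<^bsub>M\<^esub>l\<in>{..<s i}. h (p i l) (q i l \<otimes>\<^bsub>M\<^esub> (\<beta> i x \<otimes>\<^bsub>M\<^esub> y))) = h x y"
  using assms unfolding quasibasis_def by blast+

text \<open>As \<open>t\<^sub>i\<close> is central and \<open>f\<close> a bimodule map, \<open>a
  f(t\<^sub>i\<^sup>1) t\<^sub>i\<^sup>2 = f(a t\<^sub>i\<^sup>1) t\<^sub>i\<^sup>2 =
  f(t\<^sub>i\<^sup>1) t\<^sub>i\<^sup>2 a\<close>.\<close>

lemma quasibasis_coefficient:
  assumes qb: "quasibasis r s p q \<beta>" and f: "f \<in> carrier A" and i: "i < r"
  shows "(\<Oplus>\<^bsub>M\<^esub>l\<in>{..<s i}. f (p i l) \<otimes>\<^bsub>M\<^esub> q i l) \<in> centralizer N M \<iota>"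
proof -
  note pq [simp] = quasibasisD(2,3)[OF qb i] and f' [simp] = End_simps[OF f]
  have "\<iota> a \<otimes>\<^bsub>M\<^esub> (\<Oplus>\<^bsub>M\<^esub>l\<in>{..<s i}. f (p i l) \<otimes>\<^bsub>M\<^esub> q i l) = (\<Oplus>\<^bsub>M\<^esub>l\<in>{..<s i}. f (p i l) \<otimes>\<^bsub>M\<^esub> q i l) \<otimes>\<^bsub>M\<^esub> \<iota> a"
    if a: "a \<in> carrier N" for a
  proof -
    have "\<iota> a \<otimes>\<^bsub>M\<^esub> (\<Oplus>\<^bsub>M\<^esub>l\<in>{..<s i}. f (p i l) \<otimes>\<^bsub>M\<^esub> q i l) = (\<Oplus>\<^bsub>M\<^esub>l\<in>{..<s i}. \<iota> a \<otimes>\<^bsub>M\<^esub> (f (p i l) \<otimes>\<^bsub>M\<^esub> q i l))"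
      by (rule M.M.finsum_rdistr) (use a in auto)
    also have "\<dots> = (\<Oplus>\<^bsub>M\<^esub>l\<in>{..<s i}. f (\<iota> a \<otimes>\<^bsub>M\<^esub> p i l) \<otimes>\<^bsub>M\<^esub> q i l)"
      by (rule M.add.finprod_cong') (use a in \<open>auto simp: M.M.m_assoc\<close>)
    also have "\<dots> = (\<Oplus>\<^bsub>M\<^esub>l\<in>{..<s i}. f (p i l) \<otimes>\<^bsub>M\<^esub> (q i l \<otimes>\<^bsub>M\<^esub> \<iota> a))"
      by (rule quasibasisD(4)[OF qb balanced_End_left[OF f] i a])
    also have "\<dots> = (\<Oplus>\<^bsub>M\<^esub>l\<in>{..<s i}. f (p i l) \<otimes>\<^bsub>M\<^esub> q i l \<otimes>\<^bsub>M\<^esub> \<iota> a)"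
      by (rule M.add.finprod_cong') (use a in \<open>auto simp: M.M.m_assoc\<close>)
    also have "\<dots> = (\<Oplus>\<^bsub>M\<^esub>l\<in>{..<s i}. f (p i l) \<otimes>\<^bsub>M\<^esub> q i l) \<otimes>\<^bsub>M\<^esub> \<iota> a"
      by (rule M.M.finsum_ldistr[symmetric]) (use a in auto)
    finally show ?thesis .
  qed
  moreover have "(\<Oplus>\<^bsub>M\<^esub>l\<in>{..<s i}. f (p i l) \<otimes>\<^bsub>M\<^esub> q i l) \<in> carrier M"
    by (rule M.M.finsum_closed) auto
  ultimately show ?thesis by (simp add: centralizer_def)
qed

text \<open>The basis identity at \<open>x \<otimes> 1\<close> under the balanced map
  \<open>x \<otimes> y \<mapsto> f(x) y\<close>. By \<open>quasibasis_coefficient\<close> the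
  coefficients centralize \<open>N\<close>; when they are scalars, the \<open>\<beta> i\<close> span
  \<open>A\<close> over \<open>K\<close>.\<close>

lemma quasibasis_expansion:
  assumes qb: "quasibasis r s p q \<beta>" and f: "f \<in> carrier A" and x: "x \<in> carrier M"
  shows "f x = (\<Oplus>\<^bsub>M\<^esub>i\<in>{..<r}. (\<Oplus>\<^bsub>M\<^esub>l\<in>{..<s i}. f (p i l) \<otimes>\<^bsub>M\<^esub> q i l) \<otimes>\<^bsub>M\<^esub> \<beta> i x)"
proof -
  note pq = quasibasisD(2,3)[OF qb] and f' = End_simps[OF f]
  have \<beta>: "\<beta> i x \<in> carrier M" if "i < r" for i
    using End_simps(1)[OF quasibasisD(1)[OF qb that] x] .
  have "f x = f x \<otimes>\<^bsub>M\<^esub> \<one>\<^bsub>M\<^esub>" using f' x by simp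
  also have "\<dots> = (\<Oplus>\<^bsub>M\<^esub>i\<in>{..<r}. \<Oplus>\<^bsub>M\<^esub>l\<in>{..<s i}. f (p i l) \<otimes>\<^bsub>M\<^esub> (q i l \<otimes>\<^bsub>M\<^esub> (\<beta> i x \<otimes>\<^bsub>M\<^esub> \<one>\<^bsub>M\<^esub>)))"
    by (rule quasibasisD(5)[OF qb balanced_End_left[OF f] x M.M.one_closed, symmetric])
  also have "\<dots> = (\<Oplus>\<^bsub>M\<^esub>i\<in>{..<r}. (\<Oplus>\<^bsub>M\<^esub>l\<in>{..<s i}. f (p i l) \<otimes>\<^bsub>M\<^esub> q i l) \<otimes>\<^bsub>M\<^esub> \<beta> i x)"
  proof (rule M.add.finprod_cong'[OF refl])
    fix i assume "i \<in> {..<r}"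
    then have i: "i < r" by simp
    have "(\<Oplus>\<^bsub>M\<^esub>l\<in>{..<s i}. f (p i l) \<otimes>\<^bsub>M\<^esub> (q i l \<otimes>\<^bsub>M\<^esub> (\<beta> i x \<otimes>\<^bsub>M\<^esub> \<one>\<^bsub>M\<^esub>))) =
        (\<Oplus>\<^bsub>M\<^esub>l\<in>{..<s i}. f (p i l) \<otimes>\<^bsub>M\<^esub> q i l \<otimes>\<^bsub>M\<^esub> \<beta> i x)"
      by (rule M.add.finprod_cong') (use i in \<open>auto simp: M.M.m_assoc pq f' \<beta>\<close>)
    also have "\<dots> = (\<Oplus>\<^bsub>M\<^esub>l\<in>{..<s i}. f (p i l) \<otimes>\<^bsub>M\<^esub> q i l) \<otimes>\<^bsub>M\<^esub> \<beta> i x"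
      by (rule M.M.finsum_ldistr[symmetric]) (use i in \<open>auto simp: pq f' \<beta>\<close>)
    finally show "(\<Oplus>\<^bsub>M\<^esub>l\<in>{..<s i}. f (p i l) \<otimes>\<^bsub>M\<^esub> (q i l \<otimes>\<^bsub>M\<^esub> (\<beta> i x \<otimes>\<^bsub>M\<^esub> \<one>\<^bsub>M\<^esub>))) =
        (\<Oplus>\<^bsub>M\<^esub>l\<in>{..<s i}. f (p i l) \<otimes>\<^bsub>M\<^esub> q i l) \<otimes>\<^bsub>M\<^esub> \<beta> i x" .
  qed (auto intro!: M.M.finsum_closed M.M.m_closed simp: pq f' \<beta>)
  finally show ?thesis .
qed

section \<open>Split extensions and separability\<close>

lemma bimod_NN_bimodule: "bimodule N N (bimod_NN M \<iota>)"
  by (intro bimodule_restrict_bimod M.M.ring_axioms N.M.ring_axioms ring_hom)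

lemma split_extension_iff:
  "split_extension N M \<iota> \<longleftrightarrow> (\<exists>F\<in>carrier A. F \<one>\<^bsub>M\<^esub> = \<one>\<^bsub>M\<^esub> \<and> (\<forall>x\<in>carrier M. F x \<in> \<iota> ` carrier N))"
proof
  assume "split_extension N M \<iota>"
  then obtain F where F: "F \<in> bimod_hom N N (bimod_NN M \<iota>) (bimod_NN M \<iota>)"
    and mem: "\<And>x. x \<in> carrier M \<Longrightarrow> F x \<in> \<iota> ` carrier N"
    and id: "\<And>x. x \<in> \<iota> ` carrier N \<Longrightarrow> F x = x"
    using bimodule.direct_summand_projection[OF bimod_NN_bimodule]
    by (auto simp: split_extension_def)
  \<comment> \<open>Members of \<open>A\<close> are extensional, so the projection is restricted to
    the carrier.\<close>
  have "(\<lambda>x\<in>carrier M. F x) \<in> carrier A"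
    using F by (intro EndI) (auto simp: bimod_hom_def hom_def)
  moreover have "F \<one>\<^bsub>M\<^esub> = \<one>\<^bsub>M\<^esub>"
    using id[of "\<one>\<^bsub>M\<^esub>"] iota_one N.M.one_closed by (metis imageI)
  ultimately show "\<exists>F\<in>carrier A. F \<one>\<^bsub>M\<^esub> = \<one>\<^bsub>M\<^esub> \<and> (\<forall>x\<in>carrier M. F x \<in> \<iota> ` carrier N)"
    using mem by (intro bexI[of _ "\<lambda>x\<in>carrier M. F x"]) auto
next
  assume "\<exists>F\<in>carrier A. F \<one>\<^bsub>M\<^esub> = \<one>\<^bsub>M\<^esub> \<and> (\<forall>x\<in>carrier M. F x \<in> \<iota> ` carrier N)"
  then obtain F where F: "F \<in> carrier A" "F \<one>\<^bsub>M\<^esub> = \<one>\<^bsub>M\<^esub>"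
    and mem: "\<And>x. x \<in> carrier M \<Longrightarrow> F x \<in> \<iota> ` carrier N" by blast
  interpret h: ring_hom_ring N M \<iota> by (rule iota_hom)
  interpret B: bimodule N N "bimod_NN M \<iota>" by (rule bimod_NN_bimodule)
  have neg: "inv\<^bsub>bimod_NN M \<iota>\<^esub> x = \<ominus>\<^bsub>M\<^esub> x" if "x \<in> carrier M" for x
    using that by (intro B.B.inv_equality) (auto simp: M.M.l_neg)
  have "subgroup (\<iota> ` carrier N) (bimod_NN M \<iota>)"
  proof (rule B.B.subgroupI)
    fix x y assume "x \<in> \<iota> ` carrier N" "y \<in> \<iota> ` carrier N"
    then obtain a b where ab: "a \<in> carrier N" "b \<in> carrier N" "x = \<iota> a" "y = \<iota> b" by blast
    have "x \<otimes>\<^bsub>bimod_NN M \<iota>\<^esub> y = \<iota> (a \<oplus>\<^bsub>N\<^esub> b)" "inv\<^bsub>bimod_NN M \<iota>\<^esub> x = \<iota> (\<ominus>\<^bsub>N\<^esub> a)"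
      using ab by (simp_all add: neg)
    then show "x \<otimes>\<^bsub>bimod_NN M \<iota>\<^esub> y \<in> \<iota> ` carrier N" "inv\<^bsub>bimod_NN M \<iota>\<^esub> x \<in> \<iota> ` carrier N"
      using ab(1,2) by (simp_all only: imageI N.M.add.m_closed N.M.a_inv_closed)
  qed auto
  moreover have "\<iota> a \<otimes>\<^bsub>M\<^esub> \<iota> b \<in> \<iota> ` carrier N" if "a \<in> carrier N" "b \<in> carrier N" for a b
    unfolding h.hom_mult[OF that, symmetric] using that by (intro imageI N.M.m_closed)
  ultimately have "subbimodule N N (\<iota> ` carrier N) (bimod_NN M \<iota>)"
    by (auto simp: subbimodule_def)
  \<comment> \<open>Left linearity and \<open>F(1) = 1\<close> make \<open>F\<close> the identity on
    the image of \<open>N\<close>, hence a projection onto it.\<close>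
  moreover have "F (\<iota> a) = \<iota> a" if "a \<in> carrier N" for a
    using End_simps(3)[OF F(1) that M.M.one_closed] that by (simp add: F(2))
  moreover have "F \<in> bimod_hom N N (bimod_NN M \<iota>) (bimod_NN M \<iota>)"
    using F(1) by (simp add: bimod_End_def)
  ultimately show "split_extension N M \<iota>"
    unfolding split_extension_def using mem by (intro B.direct_summandI[of F]) auto
qed

section \<open>From a splitting to a separability element\<close>

text \<open>The Casimir property of
  \<open>\<Sum>\<^sub>i \<tau>\<^sub>i \<otimes> \<beta>\<^sub>i\<close> rests on one scalar matrix
  serving both sides: \<open>\<beta>\<^sub>i c = \<Sum>\<^sub>j \<kappa>\<^sub>i\<^sub>j
  \<beta>\<^sub>j\<close> and \<open>c \<tau>\<^sub>j = \<Sum>\<^sub>i \<kappa>\<^sub>i\<^sub>j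
  \<tau>\<^sub>i\<close>. Scalars then cross the tensor sign over \<open>K\<close>.\<close>

lemma separable_if_split:
  assumes qb: "quasibasis r s p q \<beta>" and cent: "centralizer N M \<iota> \<subseteq> unit_map M ` carrier K"
    and F: "F \<in> carrier A" "F \<one>\<^bsub>M\<^esub> = \<one>\<^bsub>M\<^esub>" "\<And>x. x \<in> carrier M \<Longrightarrow> F x \<in> \<iota> ` carrier N"
  shows "separable_algebra K A"
proof -
  note pq = quasibasisD(2,3)[OF qb] and \<beta> = quasibasisD(1)[OF qb] and F' = End_simps[OF F(1)]
  have \<beta>_closed: "\<beta> i x \<in> carrier M" if "i < r" "x \<in> carrier M" for i x
    using End_simps(1)[OF \<beta>[OF that(1)] that(2)] .
  \<comment> \<open>This is \<open>t\<^sub>i\<^sup>1 F(t\<^sub>i\<^sup>2 m)\<close>. Left linearity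
    over \<open>N\<close> will come from centrality of \<open>t\<^sub>i\<close>, right linearity
    from that of \<open>F\<close>.\<close>
  define \<tau> where "\<tau> i = (\<lambda>m\<in>carrier M. \<Oplus>\<^bsub>M\<^esub>l\<in>{..<s i}. p i l \<otimes>\<^bsub>M\<^esub> F (q i l \<otimes>\<^bsub>M\<^esub> m))" for i
  have bal: "balanced (\<lambda>x y. x \<otimes>\<^bsub>M\<^esub> F (y \<otimes>\<^bsub>M\<^esub> m))" if "m \<in> carrier M" for m
    using that by (intro balanced_right) (auto simp: F' M.M.l_distr M.M.m_assoc)
  have \<tau>: "\<tau> i \<in> carrier A" if i: "i < r" for i
  proof (rule EndI)
    fix x y assume xy: "x \<in> carrier M" "y \<in> carrier M"
    show "\<tau> i x \<in> carrier M"
      using xy by (auto simp: \<tau>_def intro!: M.M.finsum_closed M.M.m_closed pq[OF i] F'(1))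
    have "\<tau> i (x \<oplus>\<^bsub>M\<^esub> y) = (\<Oplus>\<^bsub>M\<^esub>l\<in>{..<s i}. p i l \<otimes>\<^bsub>M\<^esub> F (q i l \<otimes>\<^bsub>M\<^esub> x) \<oplus>\<^bsub>M\<^esub> p i l \<otimes>\<^bsub>M\<^esub> F (q i l \<otimes>\<^bsub>M\<^esub> y))"
      unfolding \<tau>_def using xy
      by (simp, intro M.add.finprod_cong') (auto simp: M.M.r_distr F' pq[OF i])
    then show "\<tau> i (x \<oplus>\<^bsub>M\<^esub> y) = \<tau> i x \<oplus>\<^bsub>M\<^esub> \<tau> i y"
      using xy by (simp add: \<tau>_def M.M.finsum_addf Pi_iff pq[OF i] F'(1))
  next
    fix a x assume ax: "a \<in> carrier N" "x \<in> carrier M"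
    have "\<tau> i (\<iota> a \<otimes>\<^bsub>M\<^esub> x) = (\<Oplus>\<^bsub>M\<^esub>l\<in>{..<s i}. p i l \<otimes>\<^bsub>M\<^esub> F (q i l \<otimes>\<^bsub>M\<^esub> \<iota> a \<otimes>\<^bsub>M\<^esub> x))"
      unfolding \<tau>_def using ax
      by (simp, intro M.add.finprod_cong') (auto simp: M.M.m_assoc F' pq[OF i])
    also have "\<dots> = (\<Oplus>\<^bsub>M\<^esub>l\<in>{..<s i}. (\<iota> a \<otimes>\<^bsub>M\<^esub> p i l) \<otimes>\<^bsub>M\<^esub> F (q i l \<otimes>\<^bsub>M\<^esub> x))"
      by (rule quasibasisD(4)[OF qb bal[OF ax(2)] i ax(1), symmetric])
    also have "\<dots> = (\<Oplus>\<^bsub>M\<^esub>l\<in>{..<s i}. \<iota> a \<otimes>\<^bsub>M\<^esub> (p i l \<otimes>\<^bsub>M\<^esub> F (q i l \<otimes>\<^bsub>M\<^esub> x)))"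
      using ax by (intro M.add.finprod_cong') (auto simp: M.M.m_assoc F' pq[OF i])
    also have "\<dots> = \<iota> a \<otimes>\<^bsub>M\<^esub> (\<Oplus>\<^bsub>M\<^esub>l\<in>{..<s i}. p i l \<otimes>\<^bsub>M\<^esub> F (q i l \<otimes>\<^bsub>M\<^esub> x))"
      by (rule M.M.finsum_rdistr[symmetric]) (use ax in \<open>auto simp: F' pq[OF i]\<close>)
    also have "\<dots> = \<iota> a \<otimes>\<^bsub>M\<^esub> \<tau> i x" using ax by (simp add: \<tau>_def)
    finally show "\<tau> i (\<iota> a \<otimes>\<^bsub>M\<^esub> x) = \<iota> a \<otimes>\<^bsub>M\<^esub> \<tau> i x" .
    have "\<tau> i (x \<otimes>\<^bsub>M\<^esub> \<iota> a) = (\<Oplus>\<^bsub>M\<^esub>l\<in>{..<s i}. p i l \<otimes>\<^bsub>M\<^esub> F (q i l \<otimes>\<^bsub>M\<^esub> x) \<otimes>\<^bsub>M\<^esub> \<iota> a)"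
      unfolding \<tau>_def using ax
      by (simp, intro M.add.finprod_cong') (auto simp: M.M.m_assoc[symmetric] F' pq[OF i])
    also have "\<dots> = (\<Oplus>\<^bsub>M\<^esub>l\<in>{..<s i}. p i l \<otimes>\<^bsub>M\<^esub> F (q i l \<otimes>\<^bsub>M\<^esub> x)) \<otimes>\<^bsub>M\<^esub> \<iota> a"
      by (rule M.M.finsum_ldistr[symmetric]) (use ax in \<open>auto simp: F' pq[OF i]\<close>)
    also have "\<dots> = \<tau> i x \<otimes>\<^bsub>M\<^esub> \<iota> a" using ax by (simp add: \<tau>_def)
    finally show "\<tau> i (x \<otimes>\<^bsub>M\<^esub> \<iota> a) = \<tau> i x \<otimes>\<^bsub>M\<^esub> \<iota> a" .
  qed (simp add: \<tau>_def)
  \<comment> \<open>The basis identity under the balanced map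
    \<open>x \<otimes> y \<mapsto> x F(y)\<close>. At \<open>y = 1\<close> it shows that the
    \<open>\<tau>\<^sub>i \<beta>\<^sub>i\<close> sum to the unit of \<open>A\<close>.\<close>
  have \<tau>_\<beta>: "(\<Oplus>\<^bsub>M\<^esub>i\<in>{..<r}. \<tau> i (\<beta> i x \<otimes>\<^bsub>M\<^esub> y)) = x \<otimes>\<^bsub>M\<^esub> F y"
    if xy: "x \<in> carrier M" "y \<in> carrier M" for x y
  proof -
    have "balanced (\<lambda>x y. x \<otimes>\<^bsub>M\<^esub> F y)" by (rule balanced_right) (simp_all add: F')
    note basis = quasibasisD(5)[OF qb this xy]
    show ?thesis
      unfolding basis[symmetric]
      by (rule M.add.finprod_cong'[OF refl])
        (use xy in \<open>auto simp: \<tau>_def \<beta>_closed F' pq intro!: M.M.finsum_closed\<close>)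
  qed
  have one: "(\<Oplus>\<^bsub>A\<^esub>i\<in>{..<r}. \<tau> i \<otimes>\<^bsub>A\<^esub> \<beta> i) = \<one>\<^bsub>A\<^esub>"
  proof (rule End_eqI)
    fix x assume x: "x \<in> carrier M"
    have "(\<Oplus>\<^bsub>A\<^esub>i\<in>{..<r}. \<tau> i \<otimes>\<^bsub>A\<^esub> \<beta> i) x = (\<Oplus>\<^bsub>M\<^esub>i\<in>{..<r}. (\<tau> i \<otimes>\<^bsub>A\<^esub> \<beta> i) x)"
      using \<tau> \<beta> x by (intro End_eval_sum) auto
    also have "\<dots> = (\<Oplus>\<^bsub>M\<^esub>i\<in>{..<r}. \<tau> i (\<beta> i x \<otimes>\<^bsub>M\<^esub> \<one>\<^bsub>M\<^esub>))"
      using x by (intro M.add.finprod_cong') (auto simp: End_eval \<beta>_closed End_simps(1)[OF \<tau>])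
    also have "\<dots> = x" using \<tau>_\<beta>[OF x M.M.one_closed] x by (simp add: F(2))
    finally show "(\<Oplus>\<^bsub>A\<^esub>i\<in>{..<r}. \<tau> i \<otimes>\<^bsub>A\<^esub> \<beta> i) x = \<one>\<^bsub>A\<^esub> x" using x by (simp add: End_eval)
  qed (use \<tau> \<beta> in \<open>auto intro!: A.M.finsum_closed\<close>)
  have cas: "(\<Otimes>\<^bsub>A.T\<^esub>i\<in>{..<r}. A.pt (c \<otimes>\<^bsub>A\<^esub> \<tau> i) (\<beta> i)) = (\<Otimes>\<^bsub>A.T\<^esub>i\<in>{..<r}. A.pt (\<tau> i) (\<beta> i \<otimes>\<^bsub>A\<^esub> c))"
    if c: "c \<in> carrier A" for c
  proof -
    note c' = End_simps[OF c]
    have coeff: "(\<Oplus>\<^bsub>M\<^esub>l\<in>{..<s j}. \<beta> i (c (p j l)) \<otimes>\<^bsub>M\<^esub> q j l) \<in> unit_map M ` carrier K"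
      if "i < r" "j < r" for i j
    proof -
      have "(\<Oplus>\<^bsub>M\<^esub>l\<in>{..<s j}. (\<beta> i \<otimes>\<^bsub>A\<^esub> c) (p j l) \<otimes>\<^bsub>M\<^esub> q j l) \<in> centralizer N M \<iota>"
        by (rule quasibasis_coefficient[OF qb A.M.m_closed[OF \<beta>[OF that(1)] c] that(2)])
      also have "(\<Oplus>\<^bsub>M\<^esub>l\<in>{..<s j}. (\<beta> i \<otimes>\<^bsub>A\<^esub> c) (p j l) \<otimes>\<^bsub>M\<^esub> q j l) =
          (\<Oplus>\<^bsub>M\<^esub>l\<in>{..<s j}. \<beta> i (c (p j l)) \<otimes>\<^bsub>M\<^esub> q j l)"
        using that by (intro M.add.finprod_cong') (auto simp: End_eval pq \<beta>_closed c')
      finally show ?thesis using cent by (rule subsetD[rotated])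
    qed
    \<comment> \<open>The coefficient of \<open>\<beta> j\<close> in the expansion of
      \<open>\<beta> i\<close> composed with \<open>c\<close>, pulled back to a scalar;
      \<open>cent\<close> supplies the preimage.\<close>
    define \<kappa> where "\<kappa> i j = inv_into (carrier K) (unit_map M)
      (\<Oplus>\<^bsub>M\<^esub>l\<in>{..<s j}. \<beta> i (c (p j l)) \<otimes>\<^bsub>M\<^esub> q j l)" for i j
    have \<kappa>: "\<kappa> i j \<in> carrier K"
      and \<kappa>_eq: "unit_map M (\<kappa> i j) = (\<Oplus>\<^bsub>M\<^esub>l\<in>{..<s j}. \<beta> i (c (p j l)) \<otimes>\<^bsub>M\<^esub> q j l)"
      if "i < r" "j < r" for i j
      unfolding \<kappa>_def using coeff[OF that] by (rule inv_into_into, rule f_inv_into_f)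
    have right: "\<beta> i \<otimes>\<^bsub>A\<^esub> c = (\<Oplus>\<^bsub>A\<^esub>j\<in>{..<r}. \<kappa> i j \<odot>\<^bsub>A\<^esub> \<beta> j)" if i: "i < r" for i
    proof (rule End_eqI)
      fix x assume x: "x \<in> carrier M"
      have "(\<beta> i \<otimes>\<^bsub>A\<^esub> c) x = (\<Oplus>\<^bsub>M\<^esub>j\<in>{..<r}. (\<Oplus>\<^bsub>M\<^esub>l\<in>{..<s j}. (\<beta> i \<otimes>\<^bsub>A\<^esub> c) (p j l) \<otimes>\<^bsub>M\<^esub> q j l) \<otimes>\<^bsub>M\<^esub> \<beta> j x)"
        by (rule quasibasis_expansion[OF qb A.M.m_closed[OF \<beta>[OF i] c] x])
      also have "\<dots> = (\<Oplus>\<^bsub>M\<^esub>j\<in>{..<r}. (\<kappa> i j \<odot>\<^bsub>A\<^esub> \<beta> j) x)"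
      proof (intro M.add.finprod_cong' refl)
        fix j assume "j \<in> {..<r}"
        then have j: "j < r" by simp
        have "(\<Oplus>\<^bsub>M\<^esub>l\<in>{..<s j}. (\<beta> i \<otimes>\<^bsub>A\<^esub> c) (p j l) \<otimes>\<^bsub>M\<^esub> q j l) = unit_map M (\<kappa> i j)"
          unfolding \<kappa>_eq[OF i j]
          using i j by (intro M.add.finprod_cong') (auto simp: End_eval pq \<beta>_closed c')
        then show "(\<Oplus>\<^bsub>M\<^esub>l\<in>{..<s j}. (\<beta> i \<otimes>\<^bsub>A\<^esub> c) (p j l) \<otimes>\<^bsub>M\<^esub> q j l) \<otimes>\<^bsub>M\<^esub> \<beta> j x = (\<kappa> i j \<odot>\<^bsub>A\<^esub> \<beta> j) x"
          using i j x by (simp add: End_eval M.unit_map_mult \<kappa> \<beta>_closed)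
      qed (use i x in \<open>auto simp: End_eval \<kappa> \<beta>_closed\<close>)
      also have "\<dots> = (\<Oplus>\<^bsub>A\<^esub>j\<in>{..<r}. \<kappa> i j \<odot>\<^bsub>A\<^esub> \<beta> j) x"
        using i x \<kappa> \<beta> by (intro End_eval_sum[symmetric]) auto
      finally show "(\<beta> i \<otimes>\<^bsub>A\<^esub> c) x = (\<Oplus>\<^bsub>A\<^esub>j\<in>{..<r}. \<kappa> i j \<odot>\<^bsub>A\<^esub> \<beta> j) x" .
    qed (use i c \<kappa> \<beta> in \<open>auto intro!: A.M.finsum_closed\<close>)
    have left: "c \<otimes>\<^bsub>A\<^esub> \<tau> j = (\<Oplus>\<^bsub>A\<^esub>i\<in>{..<r}. \<kappa> i j \<odot>\<^bsub>A\<^esub> \<tau> i)" if j: "j < r" for j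
    proof (rule End_eqI)
      fix x assume x: "x \<in> carrier M"
      \<comment> \<open>Here it enters that \<open>F\<close> has values in the image of
        \<open>N\<close>, over which \<open>c\<close> is right linear.\<close>
      have c_F: "c (y \<otimes>\<^bsub>M\<^esub> F z) = c y \<otimes>\<^bsub>M\<^esub> F z" if "y \<in> carrier M" "z \<in> carrier M" for y z
        using F(3)[OF that(2)] c'(4) that(1) by auto
      have "(c \<otimes>\<^bsub>A\<^esub> \<tau> j) x = c (\<Oplus>\<^bsub>M\<^esub>l\<in>{..<s j}. p j l \<otimes>\<^bsub>M\<^esub> F (q j l \<otimes>\<^bsub>M\<^esub> x))"
        using x by (simp add: End_eval \<tau>_def)
      also have "\<dots> = (\<Oplus>\<^bsub>M\<^esub>l\<in>{..<s j}. c (p j l \<otimes>\<^bsub>M\<^esub> F (q j l \<otimes>\<^bsub>M\<^esub> x)))"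
        using x j by (intro End_sum[OF c]) (auto simp: pq F')
      \<comment> \<open>\<open>\<tau>_\<beta>\<close> expands \<open>c(p j l) F(q j l x)\<close>.
        Once the sums are exchanged, the inner sum over \<open>l\<close> is the coefficient defining
        \<open>\<kappa> i j\<close>.\<close>
      also have "\<dots> = (\<Oplus>\<^bsub>M\<^esub>l\<in>{..<s j}. \<Oplus>\<^bsub>M\<^esub>i\<in>{..<r}. \<tau> i (\<beta> i (c (p j l)) \<otimes>\<^bsub>M\<^esub> (q j l \<otimes>\<^bsub>M\<^esub> x)))"
        using x j
        by (intro M.add.finprod_cong' refl)
          (auto simp: pq c' c_F \<tau>_\<beta> \<beta>_closed End_simps(1)[OF \<tau>] intro!: M.M.finsum_closed)
      also have "\<dots> = (\<Oplus>\<^bsub>M\<^esub>i\<in>{..<r}. \<Oplus>\<^bsub>M\<^esub>l\<in>{..<s j}. \<tau> i (\<beta> i (c (p j l)) \<otimes>\<^bsub>M\<^esub> (q j l \<otimes>\<^bsub>M\<^esub> x)))"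
        by (rule M.add.finprod_swap) (use x j in \<open>auto simp: pq c' \<beta>_closed End_simps(1)[OF \<tau>]\<close>)
      also have "\<dots> = (\<Oplus>\<^bsub>M\<^esub>i\<in>{..<r}. (\<kappa> i j \<odot>\<^bsub>A\<^esub> \<tau> i) x)"
      proof (intro M.add.finprod_cong' refl)
        fix i assume "i \<in> {..<r}"
        then have i: "i < r" by simp
        have "(\<Oplus>\<^bsub>M\<^esub>l\<in>{..<s j}. \<tau> i (\<beta> i (c (p j l)) \<otimes>\<^bsub>M\<^esub> (q j l \<otimes>\<^bsub>M\<^esub> x))) =
            \<tau> i (\<Oplus>\<^bsub>M\<^esub>l\<in>{..<s j}. \<beta> i (c (p j l)) \<otimes>\<^bsub>M\<^esub> (q j l \<otimes>\<^bsub>M\<^esub> x))"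
          using i j x by (intro End_sum[OF \<tau>, symmetric]) (auto simp: pq c' \<beta>_closed)
        also have "(\<Oplus>\<^bsub>M\<^esub>l\<in>{..<s j}. \<beta> i (c (p j l)) \<otimes>\<^bsub>M\<^esub> (q j l \<otimes>\<^bsub>M\<^esub> x)) =
            (\<Oplus>\<^bsub>M\<^esub>l\<in>{..<s j}. \<beta> i (c (p j l)) \<otimes>\<^bsub>M\<^esub> q j l \<otimes>\<^bsub>M\<^esub> x)"
          using i j x by (intro M.add.finprod_cong') (auto simp: pq c' \<beta>_closed M.M.m_assoc)
        also have "\<dots> = (\<Oplus>\<^bsub>M\<^esub>l\<in>{..<s j}. \<beta> i (c (p j l)) \<otimes>\<^bsub>M\<^esub> q j l) \<otimes>\<^bsub>M\<^esub> x"
          by (rule M.M.finsum_ldistr[symmetric]) (use i j x in \<open>auto simp: pq c' \<beta>_closed\<close>)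
        also have "\<dots> = \<kappa> i j \<odot>\<^bsub>M\<^esub> x"
          using i j x by (simp add: \<kappa>_eq[symmetric] M.unit_map_mult \<kappa>)
        also have "\<tau> i \<dots> = (\<kappa> i j \<odot>\<^bsub>A\<^esub> \<tau> i) x"
          using i j x by (simp add: End_eval End_smult[OF \<tau>] \<kappa>)
        finally show "(\<Oplus>\<^bsub>M\<^esub>l\<in>{..<s j}. \<tau> i (\<beta> i (c (p j l)) \<otimes>\<^bsub>M\<^esub> (q j l \<otimes>\<^bsub>M\<^esub> x))) = (\<kappa> i j \<odot>\<^bsub>A\<^esub> \<tau> i) x" .
      qed (use j x in \<open>auto simp: End_eval \<kappa> End_simps(1)[OF \<tau>]\<close>)
      also have "\<dots> = (\<Oplus>\<^bsub>A\<^esub>i\<in>{..<r}. \<kappa> i j \<odot>\<^bsub>A\<^esub> \<tau> i) x"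
        using j x \<kappa> \<tau> by (intro End_eval_sum[symmetric]) auto
      finally show "(c \<otimes>\<^bsub>A\<^esub> \<tau> j) x = (\<Oplus>\<^bsub>A\<^esub>i\<in>{..<r}. \<kappa> i j \<odot>\<^bsub>A\<^esub> \<tau> i) x" .
    qed (use j c \<kappa> \<tau> in \<open>auto intro!: A.M.finsum_closed\<close>)
    have ptc: "A.pt f g \<in> carrier A.T" if "f \<in> carrier A" "g \<in> carrier A" for f g
      using A.MM.pure_tensor_closed that by simp
    \<comment> \<open>Both sides of the Casimir identity equal the double sum of the
      \<open>\<kappa> i j\<close> multiples of \<open>\<tau> i \<otimes> \<beta> j\<close>: summing
      over \<open>j\<close> first gives one side, over \<open>i\<close> first the other.\<close>
    have "(\<Otimes>\<^bsub>A.T\<^esub>i\<in>{..<r}. A.pt (\<tau> i) (\<beta> i \<otimes>\<^bsub>A\<^esub> c)) = (\<Otimes>\<^bsub>A.T\<^esub>i\<in>{..<r}. \<Otimes>\<^bsub>A.T\<^esub>j\<in>{..<r}. A.pt (\<kappa> i j \<odot>\<^bsub>A\<^esub> \<tau> i) (\<beta> j))"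
    proof (intro A.MM.tensor.B.finprod_cong' refl)
      fix i assume "i \<in> {..<r}"
      then have i: "i < r" by simp
      have "A.pt (\<tau> i) (\<beta> i \<otimes>\<^bsub>A\<^esub> c) = (\<Otimes>\<^bsub>A.T\<^esub>j\<in>{..<r}. A.pt (\<tau> i) (\<kappa> i j \<odot>\<^bsub>A\<^esub> \<beta> j))"
        unfolding right[OF i] by (rule A.pure_add_right) (use i \<tau> \<beta> \<kappa> in auto)
      also have "\<dots> = (\<Otimes>\<^bsub>A.T\<^esub>j\<in>{..<r}. A.pt (\<kappa> i j \<odot>\<^bsub>A\<^esub> \<tau> i) (\<beta> j))"
        by (intro A.MM.tensor.B.finprod_cong' refl)
          (use i \<tau> \<beta> \<kappa> in \<open>auto intro!: ptc simp: A.pure_smult\<close>)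
      finally show "A.pt (\<tau> i) (\<beta> i \<otimes>\<^bsub>A\<^esub> c) = (\<Otimes>\<^bsub>A.T\<^esub>j\<in>{..<r}. A.pt (\<kappa> i j \<odot>\<^bsub>A\<^esub> \<tau> i) (\<beta> j))" .
    qed (use \<tau> \<beta> \<kappa> in \<open>auto intro!: ptc A.MM.tensor.B.finprod_closed\<close>)
    also have "\<dots> = (\<Otimes>\<^bsub>A.T\<^esub>j\<in>{..<r}. \<Otimes>\<^bsub>A.T\<^esub>i\<in>{..<r}. A.pt (\<kappa> i j \<odot>\<^bsub>A\<^esub> \<tau> i) (\<beta> j))"
      by (rule A.MM.tensor.B.finprod_swap) (use \<tau> \<beta> \<kappa> in \<open>auto intro!: ptc\<close>)
    also have "\<dots> = (\<Otimes>\<^bsub>A.T\<^esub>j\<in>{..<r}. A.pt (c \<otimes>\<^bsub>A\<^esub> \<tau> j) (\<beta> j))"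
    proof (intro A.MM.tensor.B.finprod_cong' refl)
      fix j assume "j \<in> {..<r}"
      then have j: "j < r" by simp
      show "(\<Otimes>\<^bsub>A.T\<^esub>i\<in>{..<r}. A.pt (\<kappa> i j \<odot>\<^bsub>A\<^esub> \<tau> i) (\<beta> j)) = A.pt (c \<otimes>\<^bsub>A\<^esub> \<tau> j) (\<beta> j)"
        unfolding left[OF j] by (rule A.pure_add_left[symmetric]) (use j \<tau> \<beta> \<kappa> in auto)
    qed (use \<tau> \<beta> c in \<open>auto intro!: ptc\<close>)
    finally show ?thesis ..
  qed
  have "A.casimir r \<tau> \<beta>"
    unfolding A.casimir_def using \<tau> \<beta> cas by simp
  then show ?thesis using one by (rule A.separable_algebraI)
qed

section \<open>From a separability element to a splitting\<close>

text \<open>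
  If \<open>F\<close> is a left integral, then \<open>F(x) \<otimes> m = \<Sum>\<^sub>i t\<^sub>i \<beta>\<^sub>i(F(x)) m = \<Sum>\<^sub>i t\<^sub>i \<beta>\<^sub>i(1) F(x) m = 1 \<otimes> F(x) m\<close>.
\<close>

lemma left_integral_balanced:
  assumes qb: "quasibasis r s p q \<beta>" and F: "F \<in> carrier A"
    and int: "\<And>c x. \<lbrakk>c \<in> carrier A; x \<in> carrier M\<rbrakk> \<Longrightarrow> c (F x) = c \<one>\<^bsub>M\<^esub> \<otimes>\<^bsub>M\<^esub> F x"
    and h: "balanced h" and x: "x \<in> carrier M" and y: "y \<in> carrier M"
  shows "h (F x) y = h \<one>\<^bsub>M\<^esub> (F x \<otimes>\<^bsub>M\<^esub> y)"
proof -
  note pq = quasibasisD(2,3)[OF qb] and \<beta> = quasibasisD(1)[OF qb]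
  have Fx: "F x \<in> carrier M" using End_simps(1)[OF F x] .
  have \<beta>_closed: "\<beta> i z \<in> carrier M" if "i < r" "z \<in> carrier M" for i z
    using End_simps(1)[OF \<beta>[OF that(1)] that(2)] .
  have "h (F x) y = (\<Oplus>\<^bsub>M\<^esub>i\<in>{..<r}. \<Oplus>\<^bsub>M\<^esub>l\<in>{..<s i}. h (p i l) (q i l \<otimes>\<^bsub>M\<^esub> (\<beta> i (F x) \<otimes>\<^bsub>M\<^esub> y)))"
    by (rule quasibasisD(5)[OF qb h Fx y, symmetric])
  also have "\<dots> = (\<Oplus>\<^bsub>M\<^esub>i\<in>{..<r}. \<Oplus>\<^bsub>M\<^esub>l\<in>{..<s i}. h (p i l) (q i l \<otimes>\<^bsub>M\<^esub> (\<beta> i \<one>\<^bsub>M\<^esub> \<otimes>\<^bsub>M\<^esub> (F x \<otimes>\<^bsub>M\<^esub> y))))"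
  proof (rule M.add.finprod_cong'[OF refl])
    fix i assume "i \<in> {..<r}"
    then have i: "i < r" by simp
    have "\<beta> i (F x) \<otimes>\<^bsub>M\<^esub> y = \<beta> i \<one>\<^bsub>M\<^esub> \<otimes>\<^bsub>M\<^esub> (F x \<otimes>\<^bsub>M\<^esub> y)"
      using i x y Fx by (simp add: int \<beta> M.M.m_assoc \<beta>_closed)
    then show "(\<Oplus>\<^bsub>M\<^esub>l\<in>{..<s i}. h (p i l) (q i l \<otimes>\<^bsub>M\<^esub> (\<beta> i (F x) \<otimes>\<^bsub>M\<^esub> y))) =
        (\<Oplus>\<^bsub>M\<^esub>l\<in>{..<s i}. h (p i l) (q i l \<otimes>\<^bsub>M\<^esub> (\<beta> i \<one>\<^bsub>M\<^esub> \<otimes>\<^bsub>M\<^esub> (F x \<otimes>\<^bsub>M\<^esub> y))))" by simp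
  qed (use y Fx in \<open>auto intro!: M.M.finsum_closed balanced_closed[OF h] simp: pq \<beta>_closed\<close>)
  also have "\<dots> = h \<one>\<^bsub>M\<^esub> (F x \<otimes>\<^bsub>M\<^esub> y)"
    by (rule quasibasisD(5)[OF qb h M.M.one_closed M.M.m_closed[OF Fx y]])
  finally show ?thesis .
qed

text \<open>Apply \<open>F\<close> to \<open>m = \<Sum>\<^sub>i x\<^sub>i E(y\<^sub>i m)\<close>.
  Each term becomes \<open>F(x\<^sub>i) E(y\<^sub>i m) = E(F(x\<^sub>i) y\<^sub>i m)\<close>, which
  already lies in the image of \<open>N\<close>.\<close>

lemma left_integral_range:
  assumes qb: "quasibasis r s p q \<beta>" and "frobenius_extension N M \<iota>" and F: "F \<in> carrier A"
    and int: "\<And>c x. \<lbrakk>c \<in> carrier A; x \<in> carrier M\<rbrakk> \<Longrightarrow> c (F x) = c \<one>\<^bsub>M\<^esub> \<otimes>\<^bsub>M\<^esub> F x"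
    and m: "m \<in> carrier M"
  shows "F m \<in> \<iota> ` carrier N"
proof -
  interpret h: ring_hom_ring N M \<iota> by (rule iota_hom)
  note F' = End_simps[OF F]
  obtain E and n :: nat and x y where E: "E \<in> bimod_hom N N (bimod_NN M \<iota>) (bimod_self N)"
    and xy: "x \<in> {..<n} \<rightarrow> carrier M" "y \<in> {..<n} \<rightarrow> carrier M"
    and frob: "\<And>m. m \<in> carrier M \<Longrightarrow> (\<Oplus>\<^bsub>M\<^esub>i\<in>{..<n}. x i \<otimes>\<^bsub>M\<^esub> \<iota> (E (y i \<otimes>\<^bsub>M\<^esub> m))) = m"
    using \<open>frobenius_extension N M \<iota>\<close> unfolding frobenius_extension_def by blast
  have x: "x i \<in> carrier M" and y: "y i \<in> carrier M" if "i < n" for i using xy that by auto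
  have E_closed: "E z \<in> carrier N" if "z \<in> carrier M" for z
    using E that by (auto simp: bimod_hom_def hom_def)
  have E_add: "E (z \<oplus>\<^bsub>M\<^esub> w) = E z \<oplus>\<^bsub>N\<^esub> E w" if "z \<in> carrier M" "w \<in> carrier M" for z w
    using E that by (auto simp: bimod_hom_def hom_def)
  have E_left: "E (\<iota> a \<otimes>\<^bsub>M\<^esub> z) = a \<otimes>\<^bsub>N\<^esub> E z" if "a \<in> carrier N" "z \<in> carrier M" for a z
    using E that by (auto simp: bimod_hom_def)
  have bal: "balanced (\<lambda>z w. z \<otimes>\<^bsub>M\<^esub> \<iota> (E w))"
    by (rule balanced_right) (simp_all add: E_closed E_add E_left)
  have "F m = F (\<Oplus>\<^bsub>M\<^esub>i\<in>{..<n}. x i \<otimes>\<^bsub>M\<^esub> \<iota> (E (y i \<otimes>\<^bsub>M\<^esub> m)))"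
    using frob[OF m] by simp
  also have "\<dots> = (\<Oplus>\<^bsub>M\<^esub>i\<in>{..<n}. F (x i \<otimes>\<^bsub>M\<^esub> \<iota> (E (y i \<otimes>\<^bsub>M\<^esub> m))))"
    using m by (intro End_sum[OF F]) (auto simp: x y E_closed)
  also have "\<dots> = (\<Oplus>\<^bsub>M\<^esub>i\<in>{..<n}. \<iota> (E (F (x i) \<otimes>\<^bsub>M\<^esub> (y i \<otimes>\<^bsub>M\<^esub> m))))"
  proof (intro M.add.finprod_cong' refl)
    fix i assume "i \<in> {..<n}"
    then have i: "i < n" by simp
    have ym: "y i \<otimes>\<^bsub>M\<^esub> m \<in> carrier M" using y[OF i] m by simp
    have "F (x i \<otimes>\<^bsub>M\<^esub> \<iota> (E (y i \<otimes>\<^bsub>M\<^esub> m))) = F (x i) \<otimes>\<^bsub>M\<^esub> \<iota> (E (y i \<otimes>\<^bsub>M\<^esub> m))"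
      by (rule F'(4)[OF E_closed[OF ym] x[OF i]])
    \<comment> \<open>Under the balanced map \<open>z \<otimes> w \<mapsto> z \<iota>(E w)\<close>,
      the integral \<open>F(x i)\<close> moves into the argument of \<open>E\<close>, leaving
      \<open>1\<close> in front.\<close>
    also have "\<dots> = \<one>\<^bsub>M\<^esub> \<otimes>\<^bsub>M\<^esub> \<iota> (E (F (x i) \<otimes>\<^bsub>M\<^esub> (y i \<otimes>\<^bsub>M\<^esub> m)))"
      by (rule left_integral_balanced[OF qb F int bal x[OF i] ym])
    also have "\<dots> = \<iota> (E (F (x i) \<otimes>\<^bsub>M\<^esub> (y i \<otimes>\<^bsub>M\<^esub> m)))"
      using x[OF i] ym by (simp add: E_closed F')
    finally show "F (x i \<otimes>\<^bsub>M\<^esub> \<iota> (E (y i \<otimes>\<^bsub>M\<^esub> m))) = \<iota> (E (F (x i) \<otimes>\<^bsub>M\<^esub> (y i \<otimes>\<^bsub>M\<^esub> m)))" .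
  qed (use m x y in \<open>auto simp: E_closed F'\<close>)
  also have "\<dots> = \<iota> (\<Oplus>\<^bsub>N\<^esub>i\<in>{..<n}. E (F (x i) \<otimes>\<^bsub>M\<^esub> (y i \<otimes>\<^bsub>M\<^esub> m)))"
    using m by (subst h.hom_finsum) (auto simp: x y E_closed F' o_def)
  finally have eq: "F m = \<iota> (\<Oplus>\<^bsub>N\<^esub>i\<in>{..<n}. E (F (x i) \<otimes>\<^bsub>M\<^esub> (y i \<otimes>\<^bsub>M\<^esub> m)))" .
  show ?thesis
    unfolding eq by (intro imageI N.M.finsum_closed) (use m in \<open>auto simp: x y E_closed F'\<close>)
qed

lemma split_if_separable:
  assumes qb: "quasibasis r s p q \<beta>" and irr: "irreducible_extension K N M \<iota>"
    and frob: "frobenius_extension N M \<iota>" and "separable_algebra K A"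
  shows "split_extension N M \<iota>"
proof -
  have inj: "inj_on (unit_map M) (carrier K)" and img: "unit_map M ` carrier K = centralizer N M \<iota>"
    using irr by (auto simp: irreducible_extension_def bij_betw_def)
  \<comment> \<open>The scalar equal to \<open>f(1)\<close>: since
    \<open>a f(1) = f(a) = f(1) a\<close> for \<open>a\<close> in \<open>N\<close>, irreducibility
    places \<open>f(1)\<close> in \<open>K 1\<close>.\<close>
  define \<epsilon> where "\<epsilon> f = inv_into (carrier K) (unit_map M) (f \<one>\<^bsub>M\<^esub>)" for f :: "'m \<Rightarrow> 'm"
  have "f \<one>\<^bsub>M\<^esub> \<in> centralizer N M \<iota>" if "f \<in> carrier A" for f
    using End_simps(1)[OF that M.M.one_closed] End_simps(3)[OF that _ M.M.one_closed, symmetric]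
      End_simps(4)[OF that _ M.M.one_closed, symmetric]
    by (simp add: centralizer_def)
  then have \<epsilon>: "\<epsilon> f \<in> carrier K" and unit_\<epsilon>: "unit_map M (\<epsilon> f) = f \<one>\<^bsub>M\<^esub>" if "f \<in> carrier A" for f
    using that by (auto simp: \<epsilon>_def img[symmetric] inv_into_into f_inv_into_f)
  \<comment> \<open>Injectivity of \<open>unit_map M\<close> determines the scalar, so each
    homomorphism law for \<open>\<epsilon>\<close> becomes an evaluation at
    \<open>1\<close>.\<close>
  have \<epsilon>_eq: "\<epsilon> f = k" if "f \<in> carrier A" "k \<in> carrier K" "f \<one>\<^bsub>M\<^esub> = k \<odot>\<^bsub>M\<^esub> \<one>\<^bsub>M\<^esub>" for f k
    using that inj unit_\<epsilon>[OF that(1)] \<epsilon>[OF that(1)] by (auto simp: unit_map_def inj_on_def)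
  have f_one: "f \<one>\<^bsub>M\<^esub> = \<epsilon> f \<odot>\<^bsub>M\<^esub> \<one>\<^bsub>M\<^esub>" if "f \<in> carrier A" for f
    using unit_\<epsilon>[OF that] by (simp add: unit_map_def)
  obtain n a b where cas: "A.casimir n a b" and one: "(\<Oplus>\<^bsub>A\<^esub>i\<in>{..<n}. a i \<otimes>\<^bsub>A\<^esub> b i) = \<one>\<^bsub>A\<^esub>"
    using A.separable_algebraE[OF \<open>separable_algebra K A\<close>] .
  have a: "a i \<in> carrier A" and b: "b i \<in> carrier A" if "i < n" for i
    using cas that by (auto simp: A.casimir_def)
  define F where "F = (\<Oplus>\<^bsub>A\<^esub>i\<in>{..<n}. \<epsilon> (b i) \<odot>\<^bsub>A\<^esub> a i)"
  have F: "F \<in> carrier A" unfolding F_def by (rule A.M.finsum_closed) (auto simp: a b \<epsilon>)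
  have int: "c \<otimes>\<^bsub>A\<^esub> F = \<epsilon> c \<odot>\<^bsub>A\<^esub> F" if "c \<in> carrier A" for c
    unfolding F_def
  proof (rule A.casimir_left_integral[OF cas _ _ _ _ that])
    show "\<epsilon> (f \<oplus>\<^bsub>A\<^esub> g) = \<epsilon> f \<oplus>\<^bsub>K\<^esub> \<epsilon> g" if "f \<in> carrier A" "g \<in> carrier A" for f g
      using that \<epsilon> f_one by (intro \<epsilon>_eq) (auto simp: End_eval M.smult_l_distr)
    show "\<epsilon> (k \<odot>\<^bsub>A\<^esub> f) = k \<otimes>\<^bsub>K\<^esub> \<epsilon> f" if "k \<in> carrier K" "f \<in> carrier A" for k f
      using that \<epsilon> f_one by (intro \<epsilon>_eq) (auto simp: End_eval M.smult_assoc1)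
    show "\<epsilon> (f \<otimes>\<^bsub>A\<^esub> g) = \<epsilon> f \<otimes>\<^bsub>K\<^esub> \<epsilon> g" if f: "f \<in> carrier A" and g: "g \<in> carrier A" for f g
    proof (rule \<epsilon>_eq)
      \<comment> \<open>Multiplicativity:
        \<open>f(g(1)) = f(\<epsilon>(g) 1) = \<epsilon>(g) f(1)\<close> by linearity of
        \<open>f\<close> over \<open>K\<close>.\<close>
      have "(f \<otimes>\<^bsub>A\<^esub> g) \<one>\<^bsub>M\<^esub> = \<epsilon> g \<odot>\<^bsub>M\<^esub> f \<one>\<^bsub>M\<^esub>"
        using f_one[OF g] End_smult[OF f \<epsilon>[OF g]] by (simp add: End_eval)
      also have "\<dots> = (\<epsilon> f \<otimes>\<^bsub>K\<^esub> \<epsilon> g) \<odot>\<^bsub>M\<^esub> \<one>\<^bsub>M\<^esub>"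
        using f_one[OF f] \<epsilon>[OF f] \<epsilon>[OF g] by (simp add: M.smult_assoc1[symmetric] M.R.m_comm)
      finally show "(f \<otimes>\<^bsub>A\<^esub> g) \<one>\<^bsub>M\<^esub> = (\<epsilon> f \<otimes>\<^bsub>K\<^esub> \<epsilon> g) \<odot>\<^bsub>M\<^esub> \<one>\<^bsub>M\<^esub>" .
    qed (use f g \<epsilon> in auto)
  qed (auto simp: \<epsilon>)
  \<comment> \<open>Replacing the scalar \<open>\<epsilon> c\<close> by left multiplication with
    \<open>c 1\<close> gives the form of the integral property expected by
    \<open>left_integral_range\<close>.\<close>
  have int': "c (F x) = c \<one>\<^bsub>M\<^esub> \<otimes>\<^bsub>M\<^esub> F x" if c: "c \<in> carrier A" and x: "x \<in> carrier M" for c x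
  proof -
    have "c (F x) = (c \<otimes>\<^bsub>A\<^esub> F) x" using x by (simp add: End_eval)
    also have "\<dots> = \<epsilon> c \<odot>\<^bsub>M\<^esub> F x" using x by (simp add: int[OF c] End_eval)
    also have "\<dots> = unit_map M (\<epsilon> c) \<otimes>\<^bsub>M\<^esub> F x"
      using End_simps(1)[OF F x] \<epsilon>[OF c] by (simp add: M.unit_map_mult)
    finally show ?thesis by (simp add: unit_\<epsilon>[OF c])
  qed
  have "F \<one>\<^bsub>M\<^esub> = (\<Oplus>\<^bsub>M\<^esub>i\<in>{..<n}. (\<epsilon> (b i) \<odot>\<^bsub>A\<^esub> a i) \<one>\<^bsub>M\<^esub>)"
    unfolding F_def by (rule End_eval_sum) (auto simp: a b \<epsilon>)
  \<comment> \<open>The scalar \<open>\<epsilon> (b i)\<close> moves inside \<open>a i\<close> and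
    becomes \<open>b i 1\<close>; the normalisation of the separability element then gives
    \<open>F(1) = 1\<close>.\<close>
  also have "\<dots> = (\<Oplus>\<^bsub>M\<^esub>i\<in>{..<n}. (a i \<otimes>\<^bsub>A\<^esub> b i) \<one>\<^bsub>M\<^esub>)"
    by (intro M.add.finprod_cong' refl)
      (auto simp: End_eval f_one[OF b] End_smult[OF a] End_simps(1)[OF a] \<epsilon> b)
  also have "\<dots> = \<one>\<^bsub>A\<^esub> \<one>\<^bsub>M\<^esub>"
    unfolding one[symmetric] by (rule End_eval_sum[symmetric]) (auto simp: a b)
  finally have "F \<one>\<^bsub>M\<^esub> = \<one>\<^bsub>M\<^esub>" by (simp add: End_eval)
  moreover have "F x \<in> \<iota> ` carrier N" if "x \<in> carrier M" for x
    by (rule left_integral_range[OF qb frob F int' that])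
  ultimately show ?thesis using F split_extension_iff by blast
qed

end

theorem proposition8p3:
  fixes K :: "('k, 'x) ring_scheme"
    and N :: "('k, 'n, 'w) module_scheme"
    and M :: "('k, 'm, 'z) module_scheme"
    and \<iota> :: "'n \<Rightarrow> 'm"
  assumes "algebra_extension K N M \<iota>"
    and "irreducible_extension K N M \<iota>"
    and "depth_two N M \<iota>"
    and "frobenius_extension N M \<iota>"
    and "proper_extension N M \<iota>"
  shows "split_extension N M \<iota> \<longleftrightarrow> separable_algebra K (bimod_End N M \<iota>)"
proof -
  interpret algebra_extension K N M \<iota> by fact
  obtain r s p q \<beta> where qb: "quasibasis r s p q \<beta>"
    using depth_two_quasibasis[OF assms(3)] .
  \<comment> \<open>In the forward direction irreducibility enters as surjectivity of
    \<open>k \<mapsto> k 1\<close> onto the centralizer; in the converse its injectivity also makes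
    the character \<open>\<epsilon>\<close> additive and multiplicative.\<close>
  have cent: "centralizer N M \<iota> \<subseteq> unit_map M ` carrier K"
    using assms(2) by (simp add: irreducible_extension_def bij_betw_def)
  show ?thesis
  proof
    assume "split_extension N M \<iota>"
    then show "separable_algebra K (bimod_End N M \<iota>)"
      using separable_if_split[OF qb cent] split_extension_iff by blast
  next
    assume "separable_algebra K (bimod_End N M \<iota>)"
    then show "split_extension N M \<iota>"
      by (rule split_if_separable[OF qb assms(2,4)])
  qed
qed

end
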